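(* Let $\Gamma_{Bor}=\langle a,b,c\mid [a,[b,c^{-1}]],\ [b,[c,a^{-1}]],\ [c,[a,b^{-1}]]\rangle$ be the fundamental group of the Borromean rings exterior. Then $B(\Gamma_{Bor})$ is reduced, and sending variables to trace functions gives an isomorphism $B(\Gamma_{Bor})\cong\mathbb C[t_a,t_b,t_c,t_{ab},t_{ac},t_{bc},t_{abc}]/I_{Bor}$ with $$I_{Bor}=I_{ns}\cap I_a^+\cap I_a^-\cap I_b^+\cap I_b^-\cap I_c^+\cap I_c^-\cap I_0,$$ an intersection of eight prime ideals. Consequently $X(\Gamma_{Bor},\mathrm{SL}_2(\mathbb C))$ has exactly eight irreducible components, $X_{ns}\cup X_a^+\cup X_a^-\cup X_b^+\cup X_b^-\cup X_c^+\cup X_c^-\cup X_0$ (the vanishing loci of these ideals), with $X_a^\pm,X_b^\pm,X_c^\pm\cong\mathbb C^3$.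
   Context: Let $p=t_at_{bc}+t_bt_{ac}+t_ct_{ab}-t_at_bt_c$ and $q=t_a^2+t_b^2+t_c^2+t_{ab}^2+t_{ac}^2+t_{bc}^2+t_{ab}t_{ac}t_{bc}-t_at_bt_{ab}-t_at_ct_{ac}-t_bt_ct_{bc}-4$. The ideals in $\mathbb C[t_a,t_b,t_c,t_{ab},t_{ac},t_{bc},t_{abc}]$ are: $I_a^\pm=(t_a\mp2,\ t_{ab}\mp t_b,\ t_{ac}\mp t_c,\ t_{abc}\mp t_{bc})$, and $I_b^\pm$, $I_c^\pm$ defined analogously by permuting the roles of $a,b,c$ (e.g. $I_b^\pm=(t_b\mp2,\ t_{ab}\mp t_a,\ t_{bc}\mp t_c,\ t_{abc}\mp t_{ac})$, $I_c^\pm=(t_c\mp2,\ t_{ac}\mp t_a,\ t_{bc}\mp t_b,\ t_{abc}\mp t_{ab})$); $I_{ns}$ is generated by $t_a^2+t_b^2+t_{ab}^2-t_at_bt_{ab}-4$, $t_a^2+t_c^2+t_{ac}^2-t_at_ct_{ac}-4$, $t_b^2+t_c^2+t_{bc}^2-t_bt_ct_{bc}-4$, $t_a p-2t_{ab}t_{ac}-4t_{bc}+2t_bt_c$, $t_b p-2t_{ab}t_{bc}-4t_{ac}+2t_at_c$, $t_c p-2t_{ac}t_{bc}-4t_{ab}+2t_at_b$, and $2t_{abc}-p$; $I_0$ is generated by $t_{abc}^2-p\,t_{abc}+q$, $t_at_{bc}-t_bt_{ac}$, $t_bt_{ac}-t_ct_{ab}$, $t_at_{abc}-t_{ab}t_{ac}$,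 $t_bt_{abc}-t_{ab}t_{bc}$, $t_ct_{abc}-t_{ac}t_{bc}$. $B(\Gamma)$ is the universal algebra of $\mathrm{SL}_2(\mathbb C)$-characters (conjugation invariants of the universal representation algebra) and $X(\Gamma,\mathrm{SL}_2(\mathbb C))$ the corresponding character scheme; $t_\gamma$ is the trace function of $\gamma$. *)

theory Defs
  imports Complex_Main "HOL-Library.Poly_Mapping"
begin

type_synonym 'v mpoly = "('v \<Rightarrow>\<^sub>0 nat) \<Rightarrow>\<^sub>0 complex"

definition mVar :: "'v \<Rightarrow> 'v mpoly" where
  "mVar v = Poly_Mapping.single (Poly_Mapping.single v 1) 1"

definition mConst :: "complex \<Rightarrow> 'v mpoly" where
  "mConst c = Poly_Mapping.single 0 c"

definition msubst :: "('v \<Rightarrow> 'w mpoly) \<Rightarrow> 'v mpoly \<Rightarrow> 'w mpoly" where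
  "msubst \<sigma> p =
     (\<Sum>\<mu>\<in>Poly_Mapping.keys p. mConst (Poly_Mapping.lookup p \<mu>) * (\<Prod>v\<in>Poly_Mapping.keys \<mu>. \<sigma> v ^ Poly_Mapping.lookup \<mu> v))"

definition is_ideal :: "'a::comm_ring_1 set \<Rightarrow> bool" where
  "is_ideal I \<longleftrightarrow> 0 \<in> I \<and> (\<forall>a\<in>I. \<forall>b\<in>I. a + b \<in> I) \<and> (\<forall>r. \<forall>a\<in>I. r * a \<in> I)"

definition gen_ideal :: "'a::comm_ring_1 set \<Rightarrow> 'a set" where
  "gen_ideal S = {x. \<forall>I. is_ideal I \<and> S \<subseteq> I \<longrightarrow> x \<in> I}"

definition is_prime_ideal :: "'a::comm_ring_1 set \<Rightarrow> bool" where
  "is_prime_ideal P \<longleftrightarrow> is_ideal P \<and> 1 \<notin> P \<and> (\<forall>a b. a * b \<in> P \<longrightarrow> a \<in> P \<or> b \<in> P)"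

text \<open>Minimal primes over I (= irreducible components of the vanishing locus / of Spec (R/I)).\<close>
definition minimal_primes_over :: "'a::comm_ring_1 set \<Rightarrow> 'a set set" where
  "minimal_primes_over I = {P. is_prime_ideal P \<and> I \<subseteq> P \<and>
      \<not> (\<exists>Q. is_prime_ideal Q \<and> I \<subseteq> Q \<and> Q \<subset> P)}"

type_synonym 'r mat2 = "bool \<Rightarrow> bool \<Rightarrow> 'r"

definition mmul :: "'r::comm_ring_1 mat2 \<Rightarrow> 'r mat2 \<Rightarrow> 'r mat2" where
  "mmul A B = (\<lambda>i j. A i False * B False j + A i True * B True j)"

definition mtr :: "'r::comm_ring_1 mat2 \<Rightarrow> 'r" where
  "mtr A = A False False + A True True"

definition mdet :: "'r::comm_ring_1 mat2 \<Rightarrow> 'r" where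
  "mdet A = A False False * A True True - A False True * A True False"

text \<open>Adjugate; equals the inverse for matrices of determinant 1.\<close>
definition madj :: "'r::comm_ring_1 mat2 \<Rightarrow> 'r mat2" where
  "madj A = (\<lambda>i j. if i = j then A (\<not> i) (\<not> j) else - A i j)"

definition mid :: "'r::comm_ring_1 mat2" where
  "mid = (\<lambda>i j. if i = j then 1 else 0)"

text \<open>Group commutator [x,y] = x y x^-1 y^-1 (inverse = adjugate, valid in SL_2).\<close>
definition mcomm :: "'r::comm_ring_1 mat2 \<Rightarrow> 'r mat2 \<Rightarrow> 'r mat2" where
  "mcomm X Y = mmul (mmul (mmul X Y) (madj X)) (madj Y)"

datatype gen = GA | GB | GC

text \<open>Coordinates of the universal representation: the entries of the three
matrices rho(a), rho(b), rho(c).\<close>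
type_synonym xvar = "gen \<times> bool \<times> bool"

definition Xm :: "gen \<Rightarrow> xvar mpoly mat2" where
  "Xm g = (\<lambda>i j. mVar (g, i, j))"

definition bor_relators :: "xvar mpoly mat2 set" where
  "bor_relators =
     {mcomm (Xm GA) (mcomm (Xm GB) (madj (Xm GC))),
      mcomm (Xm GB) (mcomm (Xm GC) (madj (Xm GA))),
      mcomm (Xm GC) (mcomm (Xm GA) (madj (Xm GB)))}"

text \<open>Defining ideal of the representation scheme Hom(Gamma_Bor, SL_2(C)) in C[x]:
determinants equal 1 and the relators equal the identity.\<close>
definition J_Bor :: "xvar mpoly set" where
  "J_Bor = gen_ideal
     ({mdet (Xm g) - 1 | g. True} \<union> {R i j - mid i j | R i j. R \<in> bor_relators})"

definition conj_subst :: "complex mat2 \<Rightarrow> xvar \<Rightarrow> xvar mpoly" where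
  "conj_subst M = (\<lambda>(g, i, j).
      mmul (mmul (\<lambda>k l. mConst (M k l)) (Xm g)) (\<lambda>k l. mConst (madj M k l)) i j)"

text \<open>Representatives in C[x] of elements of B(Gamma_Bor): classes modulo J_Bor
fixed by the conjugation action of SL_2(C).\<close>
definition B_Bor :: "xvar mpoly set" where
  "B_Bor = {f. \<forall>M. mdet M = 1 \<longrightarrow> msubst (conj_subst M) f - f \<in> J_Bor}"

datatype tvar = Ta | Tb | Tc | Tab | Tac | Tbc | Tabc

definition trace_map :: "tvar \<Rightarrow> xvar mpoly" where
  "trace_map v = (case v of
      Ta \<Rightarrow> mtr (Xm GA) | Tb \<Rightarrow> mtr (Xm GB) | Tc \<Rightarrow> mtr (Xm GC)
    | Tab \<Rightarrow> mtr (mmul (Xm GA) (Xm GB)) | Tac \<Rightarrow> mtr (mmul (Xm GA) (Xm GC))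
    | Tbc \<Rightarrow> mtr (mmul (Xm GB) (Xm GC))
    | Tabc \<Rightarrow> mtr (mmul (mmul (Xm GA) (Xm GB)) (Xm GC)))"

abbreviation "ta \<equiv> (mVar Ta :: tvar mpoly)"
abbreviation "tb \<equiv> (mVar Tb :: tvar mpoly)"
abbreviation "tc \<equiv> (mVar Tc :: tvar mpoly)"
abbreviation "tab \<equiv> (mVar Tab :: tvar mpoly)"
abbreviation "tac \<equiv> (mVar Tac :: tvar mpoly)"
abbreviation "tbc \<equiv> (mVar Tbc :: tvar mpoly)"
abbreviation "tabc \<equiv> (mVar Tabc :: tvar mpoly)"

definition pP :: "tvar mpoly" where
  "pP = ta*tbc + tb*tac + tc*tab - ta*tb*tc"

definition qQ :: "tvar mpoly" where
  "qQ = ta^2 + tb^2 + tc^2 + tab^2 + tac^2 + tbc^2 + tab*tac*tbc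
        - ta*tb*tab - ta*tc*tac - tb*tc*tbc - 4"

definition I_a :: "complex \<Rightarrow> tvar mpoly set" where
  "I_a s = gen_ideal {ta - mConst (2*s), tab - mConst s * tb, tac - mConst s * tc,
                      tabc - mConst s * tbc}"

definition I_b :: "complex \<Rightarrow> tvar mpoly set" where
  "I_b s = gen_ideal {tb - mConst (2*s), tab - mConst s * ta, tbc - mConst s * tc,
                      tabc - mConst s * tac}"

definition I_c :: "complex \<Rightarrow> tvar mpoly set" where
  "I_c s = gen_ideal {tc - mConst (2*s), tac - mConst s * ta, tbc - mConst s * tb,
                      tabc - mConst s * tab}"

definition I_ns :: "tvar mpoly set" where
  "I_ns = gen_ideal
     {ta^2 + tb^2 + tab^2 - ta*tb*tab - 4,
      ta^2 + tc^2 + tac^2 - ta*tc*tac - 4,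
      tb^2 + tc^2 + tbc^2 - tb*tc*tbc - 4,
      ta*pP - 2*tab*tac - 4*tbc + 2*tb*tc,
      tb*pP - 2*tab*tbc - 4*tac + 2*ta*tc,
      tc*pP - 2*tac*tbc - 4*tab + 2*ta*tb,
      2*tabc - pP}"

definition I_0 :: "tvar mpoly set" where
  "I_0 = gen_ideal
     {tabc^2 - pP*tabc + qQ, ta*tbc - tb*tac, tb*tac - tc*tab,
      ta*tabc - tab*tac, tb*tabc - tab*tbc, tc*tabc - tac*tbc}"

definition I_Bor :: "tvar mpoly set" where
  "I_Bor = I_ns \<inter> I_a 1 \<inter> I_a (-1) \<inter> I_b 1 \<inter> I_b (-1) \<inter> I_c 1 \<inter> I_c (-1) \<inter> I_0"

definition eight_ideals :: "tvar mpoly set set" where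
  "eight_ideals = {I_ns, I_a 1, I_a (-1), I_b 1, I_b (-1), I_c 1, I_c (-1), I_0}"

end

theory Submission
  imports Defs "HOL-Computational_Algebra.Computational_Algebra" "HOL-Computational_Algebra.Field_as_Ring"
begin

text \<open>
  The matrix entries under conjugation form an \<open>SL\<^sub>2\<close>-representation. Killing the nontrivial isotypic parts with
  the Casimir operator, whose action on a tensor network is a sum of contractions, shows that every invariant
  is congruent to a polynomial in traces of words; the polarised Cayley-Hamilton identity reduces these to the seven traces.

  Write \<open>a\<close>, \<open>b\<close>, \<open>c\<close> for the vector parts of the generators in quaternion coordinates. The vector part of \<open>[b, c\<^sup>-\<^sup>1]\<close>
  is a combination of \<open>b\<close>, \<open>c\<close>, \<open>b \<times> c\<close>, and the first relator says that its cross product with \<open>a\<close> is zero; likewise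
  for the others. Pairing these equations with the vectors gives elements of the kernel \<open>K\<close> of the trace map
  \<open>\<complex>[t] \<rightarrow> B(\<Gamma>)\<close>. Conversely each of the eight varieties contains a dense set of characters of representations,
  so \<open>K \<subseteq> I\<^sub>B\<^sub>o\<^sub>r\<close>.

  For \<open>I\<^sub>B\<^sub>o\<^sub>r \<subseteq> K\<close>, twice an element of \<open>I\<^sub>0\<close> is, modulo \<open>K\<close>, a combination \<open>h\<^sub>3 g\<^sub>3 + h\<^sub>4 g\<^sub>4 + h\<^sub>5 g\<^sub>5\<close> of three of its generators.
  On the other seven components \<open>(g\<^sub>3, g\<^sub>4, g\<^sub>5) = - (u, v, w)\<close> with \<open>u = t\<^sub>b t\<^sub>c - 2 t\<^sub>b\<^sub>c\<close> etc., so \<open>h\<^sub>3 u + h\<^sub>4 v + h\<^sub>5 w\<close> lies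
  in their intersection. This forces \<open>h\<close> to be a combination of Koszul syzygies of \<open>(u, v, w)\<close>, of syzygies coming from
  cofactors of the Gram matrix, and of multiples of \<open>2 t\<^sub>a\<^sub>b\<^sub>c - p\<close> and of the Gram determinant, all of which
  take \<open>h\<^sub>3 g\<^sub>3 + h\<^sub>4 g\<^sub>4 + h\<^sub>5 g\<^sub>5\<close> into \<open>K\<close>.

  \<open>I\<^sub>0\<close> is the preimage, under a monomial substitution, of a principal ideal whose generator is irreducible by
  Eisenstein's criterion, and \<open>I\<^sub>n\<^sub>s\<close> is the vanishing ideal of the image of a torus. An intersection of primes
  is radical, and eight points separate the components.
\<close>

\<comment> \<open>\<^const>\<open>divide\<close> on \<^typ>\<open>complex\<close> is also a Euclidean division in Field_as_Ring; these rules for Euclidean division loop with \<open>field_simps\<close>.\<close>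
declare div_mult_self1 [simp del] div_mult_self2 [simp del] div_mult_self3 [simp del] div_mult_self4 [simp del]

section \<open>Ring homomorphisms out of polynomial rings\<close>

text \<open>Points see only radicals, and whether the quotient of \<open>xvar mpoly\<close> by
  \<open>J_Bor\<close> is reduced is part of the question. So evaluation at representations can show
  only that the kernel of the trace map lies in the eight ideals. The reverse inclusion needs
  identities that hold in the quotient itself, a ring that may have zero divisors. This is why the
  quaternion and Gram computations are made over an arbitrary commutative ring with a half and a
  square root of -1, why relations appear as explicit linear combinations, and why only nonzero
  numbers are cancelled there. Elements of \<open>B_Bor\<close> are invariant only modulo
  \<open>J_Bor\<close>, so invariant theory cannot be applied to the polynomial directly. The
  Casimir operator does act on polynomials, and it sends a representative of an invariant class into
  the ideal. Hence a polynomial in this operator with constant term 1 does not change the class,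
  while it turns any polynomial into one congruent to a polynomial in traces.\<close>

definition rhom :: "('a::comm_ring_1 \<Rightarrow> 'b::comm_ring_1) \<Rightarrow> bool" where
  "rhom f \<longleftrightarrow> f 1 = 1 \<and> (\<forall>a b. f (a + b) = f a + f b) \<and> (\<forall>a b. f (a * b) = f a * f b)"

lemma rhom_one: "rhom f \<Longrightarrow> f 1 = 1"
  and rhom_add: "rhom f \<Longrightarrow> f (a + b) = f a + f b"
  and rhom_mult: "rhom f \<Longrightarrow> f (a * b) = f a * f b"
  by (auto simp: rhom_def)

lemma rhom_zero: "rhom f \<Longrightarrow> f 0 = 0"
  using rhom_add[of f 0 0] by simp

lemma rhom_uminus: "rhom f \<Longrightarrow> f (- a) = - f a"
  using rhom_add[of f a "- a"] rhom_zero[of f] by (simp add: eq_neg_iff_add_eq_0 add.commute)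

lemma rhom_diff: "rhom f \<Longrightarrow> f (a - b) = f a - f b"
  using rhom_add[of f a "- b"] rhom_uminus[of f b] by simp

lemma rhom_power: "rhom f \<Longrightarrow> f (a ^ n) = f a ^ n"
  by (induction n) (simp_all add: rhom_one rhom_mult)

lemma rhom_of_nat: "rhom f \<Longrightarrow> f (of_nat n) = of_nat n"
  by (induction n) (simp_all add: rhom_zero rhom_one rhom_add)

lemma rhom_numeral: "rhom f \<Longrightarrow> f (numeral n) = numeral n"
  using rhom_of_nat[of f "numeral n"] by simp

lemma rhom_sum: "rhom f \<Longrightarrow> f (sum g A) = (\<Sum>x\<in>A. f (g x))"
  by (induction A rule: infinite_finite_induct) (simp_all add: rhom_zero rhom_add)

lemmas rhom_simps = rhom_zero rhom_one rhom_add rhom_mult rhom_uminus rhom_diff rhom_power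
  rhom_numeral rhom_of_nat

lemma rhom_comp: "rhom f \<Longrightarrow> rhom g \<Longrightarrow> rhom (\<lambda>x. f (g x))"
  by (simp add: rhom_def)

lemma rhom_id: "rhom (\<lambda>x. x)"
  by (simp add: rhom_def)

lemma rhom_mConst: "rhom mConst"
  by (simp add: rhom_def mConst_def single_add mult_single)

lemma rhom_pCons: "rhom c \<Longrightarrow> rhom (\<lambda>a. [:c a:])"
  by (simp add: rhom_def one_pCons)

lemma rhom_poly_at: "rhom (\<lambda>p. poly p x)"
  by (simp add: rhom_def)

lemmas mConst_simps = rhom_simps[OF rhom_mConst]

text \<open>Coefficients and variables are mapped separately, so that \<open>msubst\<close>,
  evaluation at a complex point, restriction to a line and maps into iterated univariate polynomials
  are all instances.\<close>

definition meval :: "(complex \<Rightarrow> 'r) \<Rightarrow> ('v \<Rightarrow> 'r) \<Rightarrow> 'v mpoly \<Rightarrow> 'r::comm_ring_1" where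
  "meval c \<sigma> p = (\<Sum>\<mu>\<in>Poly_Mapping.keys p. c (Poly_Mapping.lookup p \<mu>) *
     (\<Prod>v\<in>Poly_Mapping.keys \<mu>. \<sigma> v ^ Poly_Mapping.lookup \<mu> v))"

lemma msubst_meval: "msubst \<sigma> = meval mConst \<sigma>"
  by (simp add: fun_eq_iff msubst_def meval_def)

definition mono_eval :: "('v \<Rightarrow> 'r) \<Rightarrow> ('v \<Rightarrow>\<^sub>0 nat) \<Rightarrow> 'r::comm_ring_1" where
  "mono_eval \<sigma> \<mu> = (\<Prod>v\<in>Poly_Mapping.keys \<mu>. \<sigma> v ^ Poly_Mapping.lookup \<mu> v)"

lemma mono_eval_superset:
  assumes "finite V" "Poly_Mapping.keys \<mu> \<subseteq> V"
  shows "mono_eval \<sigma> \<mu> = (\<Prod>v\<in>V. \<sigma> v ^ Poly_Mapping.lookup \<mu> v)"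
  unfolding mono_eval_def
  using assms by (intro prod.mono_neutral_left) (auto simp: in_keys_iff)

lemma mono_eval_add: "mono_eval \<sigma> (\<mu> + \<nu>) = mono_eval \<sigma> \<mu> * mono_eval \<sigma> \<nu>"
proof -
  let ?V = "Poly_Mapping.keys \<mu> \<union> Poly_Mapping.keys \<nu>"
  have "mono_eval \<sigma> (\<mu> + \<nu>) = (\<Prod>v\<in>?V. \<sigma> v ^ Poly_Mapping.lookup (\<mu> + \<nu>) v)"
    by (rule mono_eval_superset) (use keys_add[of \<mu> \<nu>] in auto)
  also have "\<dots> = (\<Prod>v\<in>?V. \<sigma> v ^ Poly_Mapping.lookup \<mu> v) * (\<Prod>v\<in>?V. \<sigma> v ^ Poly_Mapping.lookup \<nu> v)"
    by (simp add: lookup_add power_add prod.distrib)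
  also have "\<dots> = mono_eval \<sigma> \<mu> * mono_eval \<sigma> \<nu>"
    by (simp add: mono_eval_superset[of ?V])
  finally show ?thesis .
qed

lemma mono_eval_zero [simp]: "mono_eval \<sigma> 0 = 1"
  by (simp add: mono_eval_def)

lemma mono_eval_single [simp]: "mono_eval \<sigma> (Poly_Mapping.single v n) = \<sigma> v ^ n"
  by (simp add: mono_eval_def)

lemma meval_superset:
  assumes "rhom c" "finite S" "Poly_Mapping.keys p \<subseteq> S"
  shows "meval c \<sigma> p = (\<Sum>\<mu>\<in>S. c (Poly_Mapping.lookup p \<mu>) * mono_eval \<sigma> \<mu>)"
  unfolding meval_def mono_eval_def[symmetric]
  using assms by (intro sum.mono_neutral_left) (auto simp: in_keys_iff rhom_zero)

lemma meval_add:
  assumes "rhom c"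
  shows "meval c \<sigma> (p + q) = meval c \<sigma> p + meval c \<sigma> q"
proof -
  let ?S = "Poly_Mapping.keys p \<union> Poly_Mapping.keys q"
  have "meval c \<sigma> (p + q) = (\<Sum>\<mu>\<in>?S. c (Poly_Mapping.lookup (p + q) \<mu>) * mono_eval \<sigma> \<mu>)"
    by (rule meval_superset) (use keys_add[of p q] assms in auto)
  also have "\<dots> = (\<Sum>\<mu>\<in>?S. c (Poly_Mapping.lookup p \<mu>) * mono_eval \<sigma> \<mu>)
      + (\<Sum>\<mu>\<in>?S. c (Poly_Mapping.lookup q \<mu>) * mono_eval \<sigma> \<mu>)"
    by (simp add: lookup_add rhom_add[OF assms] distrib_right sum.distrib)
  also have "\<dots> = meval c \<sigma> p + meval c \<sigma> q"
    by (simp add: meval_superset[OF assms, of ?S])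
  finally show ?thesis .
qed

lemma meval_single:
  assumes "rhom c"
  shows "meval c \<sigma> (Poly_Mapping.single \<mu> a) = c a * mono_eval \<sigma> \<mu>"
  using meval_superset[OF assms, of "{\<mu>}" "Poly_Mapping.single \<mu> a"] by simp

lemma mpoly_add_induct [case_names single add]:
  fixes p :: "'v mpoly"
  assumes "\<And>\<mu> a. P (Poly_Mapping.single \<mu> a)" "\<And>p q. P p \<Longrightarrow> P q \<Longrightarrow> P (p + q)"
  shows "P p"
proof -
  have "p = (\<Sum>\<mu>\<in>Poly_Mapping.keys p. Poly_Mapping.single \<mu> (Poly_Mapping.lookup p \<mu>))"
    by (rule poly_mapping_eqI)
      (auto simp: lookup_sum lookup_single when_def in_keys_iff)
  moreover have "P (\<Sum>\<mu>\<in>S. Poly_Mapping.single \<mu> (Poly_Mapping.lookup p \<mu>))" if "finite S" for S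
    using that
  proof (induction S)
    case empty
    show ?case using assms(1)[of 0 0] by simp
  next
    case (insert x S)
    then show ?case using assms by simp
  qed
  ultimately show ?thesis by (metis finite_keys)
qed

lemma rhom_meval:
  assumes c: "rhom c"
  shows "rhom (meval c \<sigma>)"
proof -
  have "meval c \<sigma> (p * q) = meval c \<sigma> p * meval c \<sigma> q" for p q
  proof (induction p rule: mpoly_add_induct)
    case (single \<mu> a)
    show ?case
    proof (induction q rule: mpoly_add_induct)
      case (single \<nu> b)
      show ?case
        by (simp add: mult_single meval_single[OF c] mono_eval_add rhom_mult[OF c] mult_ac)
    next
      case (add q q')
      then show ?case by (simp add: distrib_left meval_add[OF c])
    qed
  next
    case (add p p')
    then show ?case by (simp add: distrib_right meval_add[OF c])
  qed
  moreover have "meval c \<sigma> 1 = 1"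
    using meval_single[OF c, of \<sigma> 0 1] by (simp add: rhom_one[OF c])
  ultimately show ?thesis by (simp add: rhom_def meval_add[OF c])
qed

lemma meval_mConst: "rhom c \<Longrightarrow> meval c \<sigma> (mConst a) = c a"
  by (simp add: mConst_def meval_single)

lemma meval_mVar: "rhom c \<Longrightarrow> meval c \<sigma> (mVar v) = \<sigma> v"
  by (simp add: mVar_def meval_single rhom_one)

lemma single_conv_mono_eval: "Poly_Mapping.single \<mu> a = mConst a * mono_eval mVar \<mu>"
proof -
  have "mVar v ^ n = Poly_Mapping.single (Poly_Mapping.single v n) 1" for v :: 'a and n
    by (induction n) (simp_all add: mVar_def mult_single single_add[symmetric])
  moreover have "(\<Prod>v\<in>V. Poly_Mapping.single (Poly_Mapping.single v (Poly_Mapping.lookup \<mu> v)) (1::complex)) =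
    Poly_Mapping.single (\<Sum>v\<in>V. Poly_Mapping.single v (Poly_Mapping.lookup \<mu> v)) 1" if "finite V" for V
    using that by (induction V) (simp_all add: mult_single)
  moreover have "(\<Sum>v\<in>Poly_Mapping.keys \<mu>. Poly_Mapping.single v (Poly_Mapping.lookup \<mu> v)) = \<mu>"
    by (rule poly_mapping_eqI)
      (auto simp: lookup_sum lookup_single when_def in_keys_iff)
  ultimately show ?thesis
    by (simp add: mono_eval_def mConst_def mult_single)
qed

lemma mpoly_induct [case_names const var add mult]:
  fixes p :: "'v mpoly"
  assumes "\<And>a. P (mConst a)" "\<And>v. P (mVar v)"
    and "\<And>p q. P p \<Longrightarrow> P q \<Longrightarrow> P (p + q)" "\<And>p q. P p \<Longrightarrow> P q \<Longrightarrow> P (p * q)"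
  shows "P p"
proof (induction p rule: mpoly_add_induct)
  case (single \<mu> a)
  have one: "P 1" using assms(1)[of 1] by (simp add: mConst_simps)
  have pow: "P (mVar v ^ n)" for v n
    by (induction n) (simp_all add: one assms)
  have "P (\<Prod>v\<in>V. mVar v ^ Poly_Mapping.lookup \<mu> v)" if "finite V" for V
    using that by (induction V) (simp_all add: one pow assms)
  then show ?case
    unfolding single_conv_mono_eval mono_eval_def using assms by simp
next
  case (add p q)
  then show ?case using assms by simp
qed

lemma rhom_eqI:
  assumes "rhom f" "rhom g" "\<And>a. f (mConst a) = g (mConst a)" "\<And>v. f (mVar v) = g (mVar v)"
  shows "f p = g p"
  by (induction p rule: mpoly_induct)
    (simp_all add: assms rhom_add[OF assms(1)] rhom_add[OF assms(2)]
      rhom_mult[OF assms(1)] rhom_mult[OF assms(2)])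

lemma rhom_msubst: "rhom (msubst \<sigma>)"
  unfolding msubst_meval by (rule rhom_meval[OF rhom_mConst])

lemma msubst_mConst [simp]: "msubst \<sigma> (mConst a) = mConst a"
  and msubst_mVar [simp]: "msubst \<sigma> (mVar v) = \<sigma> v"
  unfolding msubst_meval by (simp_all add: meval_mConst meval_mVar rhom_mConst)

lemmas msubst_simps = rhom_simps[OF rhom_msubst] msubst_mConst msubst_mVar

abbreviation ev :: "('v \<Rightarrow> complex) \<Rightarrow> 'v mpoly \<Rightarrow> complex" where
  "ev \<equiv> meval (\<lambda>a. a)"

lemma rhom_ev: "rhom (ev \<sigma>)"
  by (rule rhom_meval[OF rhom_id])

lemma ev_mConst [simp]: "ev \<sigma> (mConst a) = a"
  and ev_mVar [simp]: "ev \<sigma> (mVar v) = \<sigma> v"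
  by (simp_all add: meval_mConst meval_mVar rhom_id)

lemmas ev_simps = rhom_simps[OF rhom_ev] ev_mConst ev_mVar

lemma ev_msubst: "ev \<sigma> (msubst \<tau> p) = ev (\<lambda>v. ev \<sigma> (\<tau> v)) p"
  by (rule rhom_eqI[OF rhom_comp[OF rhom_ev rhom_msubst] rhom_ev]) (simp_all add: msubst_simps)

text \<open>Distinct monomials are distinct characters of the torus, hence linearly independent.\<close>

lemma mono_eval_independent:
  fixes a :: "('v \<Rightarrow>\<^sub>0 nat) \<Rightarrow> complex"
  assumes "finite S" "\<And>\<sigma>. (\<Sum>\<mu>\<in>S. a \<mu> * mono_eval \<sigma> \<mu>) = 0" "\<mu> \<in> S"
  shows "a \<mu> = 0"
  using assms
proof (induction "card S" arbitrary: S a \<mu> rule: less_induct)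
  case less
  show ?case
  proof (cases "S = {\<mu>}")
    case True
    then show ?thesis using less.prems(2)[of "\<lambda>_. 1"] by (simp add: mono_eval_def)
  next
    case False
    then obtain \<nu> where \<nu>: "\<nu> \<in> S" "\<nu> \<noteq> \<mu>" using less.prems by blast
    then obtain v where v: "Poly_Mapping.lookup \<nu> v \<noteq> Poly_Mapping.lookup \<mu> v"
      by (metis poly_mapping_eqI)
    define k where "k \<rho> = (2::complex) ^ Poly_Mapping.lookup \<rho> v" for \<rho> :: "'v \<Rightarrow>\<^sub>0 nat"
    have scale: "mono_eval (\<sigma>(v := 2 * \<sigma> v)) \<rho> = k \<rho> * mono_eval \<sigma> \<rho>" for \<sigma> \<rho>
    proof -
      let ?V = "insert v (Poly_Mapping.keys \<rho>)"
      have "mono_eval (\<sigma>(v := 2 * \<sigma> v)) \<rho> = (\<Prod>u\<in>?V. (if u = v then k \<rho> else 1) * \<sigma> u ^ Poly_Mapping.lookup \<rho> u)"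
        unfolding mono_eval_superset[of ?V \<rho>, OF _ subset_insertI, simplified]
        by (rule prod.cong) (auto simp: k_def power_mult_distrib)
      also have "\<dots> = k \<rho> * mono_eval \<sigma> \<rho>"
        unfolding mono_eval_superset[of ?V \<rho>, OF _ subset_insertI, simplified]
        by (simp add: prod.distrib)
      finally show ?thesis .
    qed
    have fin: "finite (S - {\<nu>})" using less.prems by simp
    \<comment> \<open>Doubling the variable v multiplies each monomial by its \<open>k\<close>;
      subtracting \<open>k \<nu>\<close> times the original relation removes the term of
      \<nu>.\<close>
    have "(\<Sum>\<rho>\<in>S - {\<nu>}. (a \<rho> * (k \<rho> - k \<nu>)) * mono_eval \<sigma> \<rho>) = 0" for \<sigma>
    proof -
      have "(\<Sum>\<rho>\<in>S. (a \<rho> * (k \<rho> - k \<nu>)) * mono_eval \<sigma> \<rho>) =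
        (\<Sum>\<rho>\<in>S. a \<rho> * mono_eval (\<sigma>(v := 2 * \<sigma> v)) \<rho>) - k \<nu> * (\<Sum>\<rho>\<in>S. a \<rho> * mono_eval \<sigma> \<rho>)"
        by (simp only: scale sum_distrib_left sum_subtractf[symmetric]) (simp add: algebra_simps)
      also have "\<dots> = 0" by (simp only: less.prems(2)) simp
      finally show ?thesis using \<nu> less.prems(1) by (simp add: sum.remove)
    qed
    moreover have "card (S - {\<nu>}) < card S"
      using \<nu> less.prems(1) by (meson card_Diff1_less)
    moreover have "\<mu> \<in> S - {\<nu>}" using \<nu> less.prems by blast
    ultimately have "a \<mu> * (k \<mu> - k \<nu>) = 0"
      using less.hyps[of "S - {\<nu>}" "\<lambda>\<rho>. a \<rho> * (k \<rho> - k \<nu>)" \<mu>] fin by blast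
    moreover have "k \<mu> \<noteq> k \<nu>"
    proof
      assume "k \<mu> = k \<nu>"
      then have "(2::real) ^ Poly_Mapping.lookup \<mu> v = 2 ^ Poly_Mapping.lookup \<nu> v"
        unfolding k_def by (metis norm_power norm_numeral)
      with v show False by simp
    qed
    ultimately show ?thesis by simp
  qed
qed

lemma ev_all_zero_imp_zero:
  assumes "\<And>\<sigma>. ev \<sigma> p = 0"
  shows "p = 0"
proof (rule poly_mapping_eqI)
  fix \<mu>
  show "Poly_Mapping.lookup p \<mu> = Poly_Mapping.lookup 0 \<mu>"
    using mono_eval_independent[of "Poly_Mapping.keys p" "Poly_Mapping.lookup p" \<mu>] assms
    by (cases "\<mu> \<in> Poly_Mapping.keys p")
       (auto simp: meval_def mono_eval_def in_keys_iff)
qed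

text \<open>Two nonzero polynomials stay nonzero on the line joining two of their nonzeros.\<close>

lemma mpoly_no_zero_divisors:
  fixes p q :: "'v mpoly"
  assumes "p * q = 0"
  shows "p = 0 \<or> q = 0"
proof (rule ccontr)
  assume "\<not> ?thesis"
  then obtain a b where a: "ev a p \<noteq> 0" and b: "ev b q \<noteq> 0"
    using ev_all_zero_imp_zero by metis
  let ?c = "\<lambda>a::complex. [:a:]"
  let ?L = "meval ?c (\<lambda>v. [:a v, b v - a v:])"
  have c: "rhom ?c" by (rule rhom_pCons[OF rhom_id])
  have line: "poly (?L f) t = ev (\<lambda>v. a v + t * (b v - a v)) f" for f :: "'v mpoly" and t
    by (rule rhom_eqI[OF rhom_comp[OF rhom_poly_at rhom_meval[OF c]] rhom_ev])
      (simp_all add: meval_mConst[OF c] meval_mVar[OF c])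
  have "?L p * ?L q = 0"
    using assms rhom_mult[OF rhom_meval[OF c]] rhom_zero[OF rhom_meval[OF c]] by metis
  then have "?L p = 0 \<or> ?L q = 0" by simp
  then show False
    using line[of p 0] line[of q 1] a b by auto
qed

section \<open>Ideals\<close>

lemma is_idealD:
  assumes "is_ideal I"
  shows is_ideal_zero: "0 \<in> I" and is_ideal_add: "a \<in> I \<Longrightarrow> b \<in> I \<Longrightarrow> a + b \<in> I"
    and is_ideal_mult: "a \<in> I \<Longrightarrow> r * a \<in> I" and is_ideal_mult_right: "a \<in> I \<Longrightarrow> a * r \<in> I"
  using assms unfolding is_ideal_def by (auto simp: mult.commute[of a r])

lemma is_ideal_uminus: "is_ideal I \<Longrightarrow> a \<in> I \<Longrightarrow> - a \<in> I"
  using is_ideal_mult[of I a "- 1"] by simp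

lemma is_ideal_diff: "is_ideal I \<Longrightarrow> a \<in> I \<Longrightarrow> b \<in> I \<Longrightarrow> a - b \<in> I"
  using is_ideal_add[of I a "- b"] is_ideal_uminus by fastforce

lemma is_ideal_mConst_cancel:
  assumes "is_ideal I" "mConst c * f \<in> I" "c \<noteq> 0"
  shows "f \<in> I"
proof -
  have "mConst (inverse c) * (mConst c * f) \<in> I" by (rule is_ideal_mult[OF assms(1,2)])
  also have "mConst (inverse c) * (mConst c * f) = f"
    using assms(3) by (simp add: mult.assoc[symmetric] rhom_mult[OF rhom_mConst, symmetric] mConst_simps)
  finally show ?thesis .
qed

lemma is_ideal_numeral_cancel:
  fixes f :: "'v mpoly"
  assumes "is_ideal I" "numeral n * f \<in> I"
  shows "f \<in> I"
  using is_ideal_mConst_cancel[OF assms(1), of "numeral n" f] assms(2) by (simp add: mConst_simps)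

lemma is_ideal_gen_ideal: "is_ideal (gen_ideal S)"
  unfolding is_ideal_def gen_ideal_def by auto

lemma gen_ideal_superset: "S \<subseteq> gen_ideal S"
  unfolding gen_ideal_def by auto

lemma gen_ideal_mem: "a \<in> S \<Longrightarrow> a \<in> gen_ideal S"
  using gen_ideal_superset by blast

lemma gen_ideal_least: "is_ideal I \<Longrightarrow> S \<subseteq> I \<Longrightarrow> gen_ideal S \<subseteq> I"
  unfolding gen_ideal_def by auto

lemma gen_ideal_empty: "gen_ideal {} = {0::'a::comm_ring_1}"
proof -
  have "is_ideal {0::'a}" by (auto simp: is_ideal_def)
  then show ?thesis using gen_ideal_least[of "{0::'a}" "{}"] is_ideal_zero[OF is_ideal_gen_ideal] by blast
qed

text \<open>Peels off one generator. Iterated down to \<open>gen_ideal_empty\<close>, it turns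
  membership in a finitely generated ideal into explicit cofactors.\<close>

lemma gen_ideal_insert:
  "x \<in> gen_ideal (insert g S) \<longleftrightarrow> (\<exists>r. x - r * g \<in> gen_ideal S)"
proof
  let ?I = "{x. \<exists>r. x - r * g \<in> gen_ideal S}"
  note i = is_ideal_gen_ideal[of S]
  have "is_ideal ?I"
    unfolding is_ideal_def
  proof (intro conjI allI ballI)
    show "0 \<in> ?I" using is_ideal_zero[OF i] by (auto intro: exI[of _ 0])
  next
    fix a b assume "a \<in> ?I" "b \<in> ?I"
    then obtain r r' where "a - r * g \<in> gen_ideal S" "b - r' * g \<in> gen_ideal S" by blast
    then have "(a - r * g) + (b - r' * g) \<in> gen_ideal S" by (rule is_ideal_add[OF i])
    then show "a + b \<in> ?I" by (auto simp: algebra_simps intro!: exI[of _ "r + r'"])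
  next
    fix c a assume "a \<in> ?I"
    then obtain r where "a - r * g \<in> gen_ideal S" by blast
    then have "c * (a - r * g) \<in> gen_ideal S" by (rule is_ideal_mult[OF i])
    then show "c * a \<in> ?I" by (auto simp: algebra_simps intro!: exI[of _ "c * r"])
  qed
  moreover have "insert g S \<subseteq> ?I"
  proof -
    have "g \<in> ?I" using is_ideal_zero[OF i] by (auto intro: exI[of _ 1])
    moreover have "S \<subseteq> ?I" using gen_ideal_superset[of S] by (auto intro!: exI[of _ 0])
    ultimately show ?thesis by blast
  qed
  ultimately show "x \<in> gen_ideal (insert g S) \<Longrightarrow> \<exists>r. x - r * g \<in> gen_ideal S"
    using gen_ideal_least by blast
next
  assume "\<exists>r. x - r * g \<in> gen_ideal S"
  then obtain r where r: "x - r * g \<in> gen_ideal S" by blast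
  have "gen_ideal S \<subseteq> gen_ideal (insert g S)"
    by (rule gen_ideal_least[OF is_ideal_gen_ideal]) (use gen_ideal_superset[of "insert g S"] in auto)
  moreover have "r * g \<in> gen_ideal (insert g S)"
    by (rule is_ideal_mult[OF is_ideal_gen_ideal]) (simp add: gen_ideal_mem)
  ultimately have "(x - r * g) + r * g \<in> gen_ideal (insert g S)"
    using r by (intro is_ideal_add[OF is_ideal_gen_ideal]) auto
  then show "x \<in> gen_ideal (insert g S)" by simp
qed

lemma is_ideal_vimage: "rhom f \<Longrightarrow> is_ideal I \<Longrightarrow> is_ideal {x. f x \<in> I}"
  unfolding is_ideal_def by (simp add: rhom_simps)

lemma is_ideal_kernel: "rhom f \<Longrightarrow> is_ideal {x. f x = 0}"
  unfolding is_ideal_def by (simp add: rhom_simps)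

text \<open>Used with one map the identity and the other a reduction to normal form: that the
  reduction moves polynomials only inside the ideal is then a check on variables.\<close>

lemma rhom_cong_mod_ideal:
  assumes "is_ideal I" "rhom f" "rhom g" "\<And>a. f (mConst a) = g (mConst a)"
    and "\<And>v. f (mVar v) - g (mVar v) \<in> I"
  shows "f p - g p \<in> I"
proof (induction p rule: mpoly_induct)
  case (const a)
  show ?case by (simp add: assms(4) is_ideal_zero[OF assms(1)])
next
  case (var v)
  show ?case by (rule assms(5))
next
  case (add p q)
  have "f (p + q) - g (p + q) = (f p - g p) + (f q - g q)"
    by (simp add: rhom_add[OF assms(2)] rhom_add[OF assms(3)])
  then show ?case using is_ideal_add[OF assms(1) add] by simp
next
  case (mult p q)
  have "f (p * q) - g (p * q) = f p * (f q - g q) + g q * (f p - g p)"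
    by (simp add: rhom_mult[OF assms(2)] rhom_mult[OF assms(3)] algebra_simps)
  then show ?case using is_ideal_add[OF assms(1) is_ideal_mult[OF assms(1) mult(2)] is_ideal_mult[OF assms(1) mult(1)]] by simp
qed

lemma is_prime_ideal_vimage:
  assumes "rhom f" "\<And>a b. f a * f b \<in> I \<Longrightarrow> f a \<in> I \<or> f b \<in> I" "is_ideal I" "1 \<notin> I"
  shows "is_prime_ideal {x. f x \<in> I}"
  unfolding is_prime_ideal_def using is_ideal_vimage[OF assms(1,3)] assms
  by (auto simp: rhom_simps)

section \<open>Two-by-two matrices\<close>

definition mmap :: "('a \<Rightarrow> 'b) \<Rightarrow> 'a mat2 \<Rightarrow> 'b mat2" where
  "mmap f A = (\<lambda>i j. f (A i j))"

lemma mmap_mmul: "rhom f \<Longrightarrow> mmap f (mmul A B) = mmul (mmap f A) (mmap f B)"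
  and mmap_madj: "rhom f \<Longrightarrow> mmap f (madj A) = madj (mmap f A)"
  and mmap_mid: "rhom f \<Longrightarrow> mmap f mid = mid"
  and mtr_mmap: "rhom f \<Longrightarrow> mtr (mmap f A) = f (mtr A)"
  and mdet_mmap: "rhom f \<Longrightarrow> mdet (mmap f A) = f (mdet A)"
  by (auto simp: mmap_def mmul_def madj_def mid_def mtr_def mdet_def rhom_simps fun_eq_iff)

lemma mmap_mcomm: "rhom f \<Longrightarrow> mmap f (mcomm A B) = mcomm (mmap f A) (mmap f B)"
  by (simp add: mcomm_def mmap_mmul mmap_madj)

lemma mmul_assoc: "mmul (mmul A B) C = mmul A (mmul B C)"
  by (simp add: mmul_def fun_eq_iff algebra_simps)

lemma mmul_mid [simp]: "mmul A mid = A" "mmul mid A = A"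
  by (auto simp: mmul_def mid_def fun_eq_iff)

lemma madj_mmul: "madj (mmul A B) = mmul (madj B) (madj A)"
  by (auto simp: mmul_def madj_def fun_eq_iff algebra_simps)

lemma mdet_mmul: "mdet (mmul A B) = mdet A * mdet B"
  by (simp add: mmul_def mdet_def algebra_simps)

lemma mdet_madj [simp]: "mdet (madj A) = mdet A"
  by (simp add: madj_def mdet_def algebra_simps)

lemma mmul_madj: "mdet A = 1 \<Longrightarrow> mmul A (madj A) = mid" "mdet A = 1 \<Longrightarrow> mmul (madj A) A = mid"
  by (auto simp: mmul_def madj_def mdet_def mid_def fun_eq_iff algebra_simps)

lemma mcomm_eq_mid_iff:
  assumes "mdet A = 1" "mdet B = 1"
  shows "mcomm A B = mid \<longleftrightarrow> mmul A B = mmul B A"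
proof
  assume "mcomm A B = mid"
  then have "mmul (mcomm A B) (mmul B A) = mmul B A" by simp
  also have "mmul (mcomm A B) (mmul B A) = mmul A (mmul B (mmul (madj A) (mmul (mmul (madj B) B) A)))"
    unfolding mcomm_def by (simp only: mmul_assoc)
  finally show "mmul A B = mmul B A" using assms by (simp add: mmul_madj)
next
  assume "mmul A B = mmul B A"
  then have "mcomm A B = mmul B (mmul (mmul A (madj A)) (madj B))"
    unfolding mcomm_def by (simp only: mmul_assoc)
  then show "mcomm A B = mid" using assms by (simp add: mmul_madj)
qed

lemma mdet_mcomm: "mdet A = 1 \<Longrightarrow> mdet B = 1 \<Longrightarrow> mdet (mcomm A B) = 1"
  by (simp add: mcomm_def mdet_mmul)

text \<open>The universal property of the representation scheme: a triple of matrices of determinant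
  1 satisfying the relators factors through the quotient by \<open>J_Bor\<close>.\<close>

lemma J_Bor_kernel:
  assumes f: "rhom f" and det: "\<And>g. mdet (mmap f (Xm g)) = 1"
    and rel: "mcomm (mmap f (Xm GA)) (mcomm (mmap f (Xm GB)) (madj (mmap f (Xm GC)))) = mid"
      "mcomm (mmap f (Xm GB)) (mcomm (mmap f (Xm GC)) (madj (mmap f (Xm GA)))) = mid"
      "mcomm (mmap f (Xm GC)) (mcomm (mmap f (Xm GA)) (madj (mmap f (Xm GB)))) = mid"
    and p: "p \<in> J_Bor"
  shows "f p = 0"
proof -
  have "f (R i j - mid i j) = 0" if "R \<in> bor_relators" for R i j
  proof -
    have "mmap f R = mid"
      using that rel by (auto simp: bor_relators_def mmap_mcomm[OF f] mmap_madj[OF f])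
    then have "mmap f R = mmap f mid" by (simp add: mmap_mid[OF f])
    then show ?thesis by (simp add: mmap_def fun_eq_iff rhom_simps[OF f])
  qed
  moreover have "f (mdet (Xm g) - 1) = 0" for g
    using det[of g] by (simp add: mdet_mmap[OF f] rhom_simps[OF f])
  ultimately have "J_Bor \<subseteq> {p. f p = 0}"
    unfolding J_Bor_def by (intro gen_ideal_least[OF is_ideal_kernel[OF f]]) auto
  with p show ?thesis by blast
qed

lemma mcomm_mid [simp]: "mcomm mid mid = mid"
proof -
  have "madj mid = (mid :: 'a mat2)" by (auto simp: madj_def mid_def fun_eq_iff)
  then show ?thesis by (simp add: mcomm_def)
qed

text \<open>The trivial representation is a point of the scheme. This supplies the axiom that 0 and
  1 differ in the class \<open>comm_ring_1\<close>.\<close>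

lemma one_notin_J_Bor: "1 \<notin> J_Bor"
proof
  let ?f = "ev (\<lambda>(g :: gen, i, j). mid i j)"
  assume "1 \<in> J_Bor"
  moreover have "mmap ?f (Xm g) = mid" for g
    by (simp add: mmap_def Xm_def)
  moreover have "madj mid = (mid :: complex mat2)" "mdet mid = (1 :: complex)"
    by (auto simp: madj_def mid_def mdet_def fun_eq_iff)
  ultimately have "?f 1 = 0"
    by (intro J_Bor_kernel[OF rhom_ev]) simp_all
  then show False by (simp add: ev_simps)
qed

section \<open>The quotient ring\<close>

lemma is_ideal_J: "is_ideal J_Bor"
  unfolding J_Bor_def by (rule is_ideal_gen_ideal)

\<comment> \<open>As a type of class \<open>comm_ring_1\<close>, the quotient can serve as the entry
  ring of matrices, so the general matrix and quaternion lemmas apply to the universal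
  representation.\<close>
quotient_type borq = "xvar mpoly" / "\<lambda>f g. f - g \<in> J_Bor"
  morphisms rep_borq proj
proof (rule equivpI)
  show "reflp (\<lambda>f g. f - g \<in> J_Bor)"
    by (auto simp: reflp_def is_ideal_zero[OF is_ideal_J])
  show "symp (\<lambda>f g. f - g \<in> J_Bor)"
    by (auto simp: symp_def dest: is_ideal_uminus[OF is_ideal_J])
  show "transp (\<lambda>f g. f - g \<in> J_Bor)"
  proof (rule transpI)
    fix f g h assume "f - g \<in> J_Bor" "g - h \<in> J_Bor"
    then show "f - h \<in> J_Bor" using is_ideal_add[OF is_ideal_J, of "f - g" "g - h"] by simp
  qed
qed

instantiation borq :: comm_ring_1
begin

lift_definition zero_borq :: borq is 0 .
lift_definition one_borq :: borq is 1 .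
lift_definition uminus_borq :: "borq \<Rightarrow> borq" is uminus
proof -
  fix f g :: "xvar mpoly" assume "f - g \<in> J_Bor"
  then show "- f - - g \<in> J_Bor" using is_ideal_uminus[OF is_ideal_J, of "f - g"] by simp
qed
lift_definition plus_borq :: "borq \<Rightarrow> borq \<Rightarrow> borq" is "(+)"
proof -
  fix f g f' g' :: "xvar mpoly" assume "f - g \<in> J_Bor" "f' - g' \<in> J_Bor"
  then have "(f - g) + (f' - g') \<in> J_Bor" by (rule is_ideal_add[OF is_ideal_J])
  then show "f + f' - (g + g') \<in> J_Bor" by (simp add: algebra_simps)
qed
lift_definition minus_borq :: "borq \<Rightarrow> borq \<Rightarrow> borq" is "(-)"
proof -
  fix f g f' g' :: "xvar mpoly" assume "f - g \<in> J_Bor" "f' - g' \<in> J_Bor"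
  then have "(f - g) - (f' - g') \<in> J_Bor" by (rule is_ideal_diff[OF is_ideal_J])
  then show "f - f' - (g - g') \<in> J_Bor" by (simp add: algebra_simps)
qed
lift_definition times_borq :: "borq \<Rightarrow> borq \<Rightarrow> borq" is "(*)"
proof -
  fix f g f' g' :: "xvar mpoly" assume *: "f - g \<in> J_Bor" "f' - g' \<in> J_Bor"
  have "f * (f' - g') + g' * (f - g) \<in> J_Bor"
    by (intro is_ideal_add[OF is_ideal_J] is_ideal_mult[OF is_ideal_J] *)
  then show "f * f' - g * g' \<in> J_Bor" by (simp add: algebra_simps)
qed

instance
proof
  have e: "f - g \<in> J_Bor" if "f = g" for f g
    using that is_ideal_zero[OF is_ideal_J] by simp
  fix a b c :: borq
  show "a * b * c = a * (b * c)" by transfer (rule e, simp add: algebra_simps)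
  show "a * b = b * a" by transfer (rule e, simp add: algebra_simps)
  show "1 * a = a" by transfer (rule e, simp)
  show "(a + b) * c = a * c + b * c" by transfer (rule e, simp add: algebra_simps)
  show "a + b + c = a + (b + c)" by transfer (rule e, simp add: algebra_simps)
  show "a + b = b + a" by transfer (rule e, simp add: algebra_simps)
  show "0 + a = a" by transfer (rule e, simp)
  show "- a + a = 0" by transfer (rule e, simp)
  show "a - b = a + - b" by transfer (rule e, simp)
  show "(0::borq) \<noteq> 1"
  proof
    assume "(0::borq) = 1"
    then have "1 \<in> J_Bor"
      by transfer (drule is_ideal_uminus[OF is_ideal_J], simp)
    with one_notin_J_Bor show False by blast
  qed
qed

end

lemma rhom_proj: "rhom proj"
  unfolding rhom_def by (auto simp: one_borq.abs_eq plus_borq.abs_eq times_borq.abs_eq)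

lemmas proj_simps = rhom_simps[OF rhom_proj]

lemma proj_eq_iff: "proj f = proj g \<longleftrightarrow> f - g \<in> J_Bor"
  by (rule borq.abs_eq_iff)

lemma proj_eq_zero_iff: "proj f = 0 \<longleftrightarrow> f \<in> J_Bor"
  using proj_eq_iff[of f 0] by (simp add: proj_simps)

definition kap :: "complex \<Rightarrow> borq" where
  "kap a = proj (mConst a)"

lemma rhom_kap: "rhom kap"
  unfolding kap_def by (rule rhom_comp[OF rhom_proj rhom_mConst])

lemmas kap_simps = rhom_simps[OF rhom_kap]

definition tproj :: "tvar mpoly \<Rightarrow> borq" where
  "tproj p = proj (msubst trace_map p)"

lemma rhom_tproj: "rhom tproj"
  unfolding tproj_def by (rule rhom_comp[OF rhom_proj rhom_msubst])

lemma tproj_mConst: "tproj (mConst a) = kap a"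
  by (simp add: tproj_def kap_def)

lemmas tproj_simps = rhom_simps[OF rhom_tproj] tproj_mConst

definition Xq :: "gen \<Rightarrow> borq mat2" where
  "Xq g = mmap proj (Xm g)"

lemma mdet_Xq [simp]: "mdet (Xq g) = 1"
proof -
  have "mdet (Xm g) - 1 \<in> J_Bor" unfolding J_Bor_def by (rule gen_ideal_mem) blast
  then have "proj (mdet (Xm g)) = proj 1" by (simp add: proj_eq_iff)
  then show ?thesis by (simp add: Xq_def mdet_mmap[OF rhom_proj] proj_simps)
qed

lemma relators_Xq:
  "mcomm (Xq GA) (mcomm (Xq GB) (madj (Xq GC))) = mid"
  "mcomm (Xq GB) (mcomm (Xq GC) (madj (Xq GA))) = mid"
  "mcomm (Xq GC) (mcomm (Xq GA) (madj (Xq GB))) = mid"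
proof -
  have "mmap proj R = mid" if "R \<in> bor_relators" for R
  proof -
    have "R i j - mid i j \<in> J_Bor" for i j
      unfolding J_Bor_def by (rule gen_ideal_mem) (use that in blast)
    then have "mmap proj R = mmap proj mid" by (simp add: mmap_def proj_eq_iff fun_eq_iff)
    then show ?thesis by (simp add: mmap_mid[OF rhom_proj])
  qed
  then show
  "mcomm (Xq GA) (mcomm (Xq GB) (madj (Xq GC))) = mid"
  "mcomm (Xq GB) (mcomm (Xq GC) (madj (Xq GA))) = mid"
  "mcomm (Xq GC) (mcomm (Xq GA) (madj (Xq GB))) = mid"
    by (simp_all add: bor_relators_def Xq_def mmap_mcomm[OF rhom_proj, symmetric] mmap_madj[OF rhom_proj, symmetric])
qed

lemma tproj_traces:
  "tproj ta = mtr (Xq GA)" "tproj tb = mtr (Xq GB)" "tproj tc = mtr (Xq GC)"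
  "tproj tab = mtr (mmul (Xq GA) (Xq GB))" "tproj tac = mtr (mmul (Xq GA) (Xq GC))"
  "tproj tbc = mtr (mmul (Xq GB) (Xq GC))"
  "tproj tabc = mtr (mmul (mmul (Xq GA) (Xq GB)) (Xq GC))"
  by (simp_all add: tproj_def trace_map_def Xq_def mmap_mmul[OF rhom_proj, symmetric] mtr_mmap[OF rhom_proj])

section \<open>Traces of words\<close>

text \<open>The module over the ring of trace polynomials spanned by the eight words 1, a, b, c, ab,
  ac, bc, abc with increasing letters. It turns out to be closed under products, so traces of all
  words are polynomials in the seven traces.\<close>

definition lincomb :: "borq mat2 set" where
  "lincomb = {M. \<exists>p0 p1 p2 p3 p4 p5 p6 p7. \<forall>i j. M i j =
     tproj p0 * mid i j + tproj p1 * Xq GA i j + tproj p2 * Xq GB i j + tproj p3 * Xq GC i j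
     + tproj p4 * mmul (Xq GA) (Xq GB) i j + tproj p5 * mmul (Xq GA) (Xq GC) i j
     + tproj p6 * mmul (Xq GB) (Xq GC) i j + tproj p7 * mmul (mmul (Xq GA) (Xq GB)) (Xq GC) i j}"

lemma lincombI:
  assumes "\<And>i j. M i j =
     tproj p0 * mid i j + tproj p1 * Xq GA i j + tproj p2 * Xq GB i j + tproj p3 * Xq GC i j
     + tproj p4 * mmul (Xq GA) (Xq GB) i j + tproj p5 * mmul (Xq GA) (Xq GC) i j
     + tproj p6 * mmul (Xq GB) (Xq GC) i j + tproj p7 * mmul (mmul (Xq GA) (Xq GB)) (Xq GC) i j"
  shows "M \<in> lincomb"
  unfolding lincomb_def using assms by blast

lemma lincomb_add:
  assumes "M \<in> lincomb" "N \<in> lincomb"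
  shows "(\<lambda>i j. M i j + N i j) \<in> lincomb"
proof -
  obtain p0 p1 p2 p3 p4 p5 p6 p7 where p: "\<And>i j. M i j =
     tproj p0 * mid i j + tproj p1 * Xq GA i j + tproj p2 * Xq GB i j + tproj p3 * Xq GC i j
     + tproj p4 * mmul (Xq GA) (Xq GB) i j + tproj p5 * mmul (Xq GA) (Xq GC) i j
     + tproj p6 * mmul (Xq GB) (Xq GC) i j + tproj p7 * mmul (mmul (Xq GA) (Xq GB)) (Xq GC) i j"
    using assms(1) unfolding lincomb_def by blast
  obtain q0 q1 q2 q3 q4 q5 q6 q7 where q: "\<And>i j. N i j =
     tproj q0 * mid i j + tproj q1 * Xq GA i j + tproj q2 * Xq GB i j + tproj q3 * Xq GC i j
     + tproj q4 * mmul (Xq GA) (Xq GB) i j + tproj q5 * mmul (Xq GA) (Xq GC) i j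
     + tproj q6 * mmul (Xq GB) (Xq GC) i j + tproj q7 * mmul (mmul (Xq GA) (Xq GB)) (Xq GC) i j"
    using assms(2) unfolding lincomb_def by blast
  show ?thesis
    by (rule lincombI[of _ "p0 + q0" "p1 + q1" "p2 + q2" "p3 + q3" "p4 + q4" "p5 + q5" "p6 + q6" "p7 + q7"])
      (simp add: p q tproj_simps distrib_right)
qed

lemma lincomb_scale:
  assumes "M \<in> lincomb"
  shows "(\<lambda>i j. tproj r * M i j) \<in> lincomb"
proof -
  obtain p0 p1 p2 p3 p4 p5 p6 p7 where p: "\<And>i j. M i j =
     tproj p0 * mid i j + tproj p1 * Xq GA i j + tproj p2 * Xq GB i j + tproj p3 * Xq GC i j
     + tproj p4 * mmul (Xq GA) (Xq GB) i j + tproj p5 * mmul (Xq GA) (Xq GC) i j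
     + tproj p6 * mmul (Xq GB) (Xq GC) i j + tproj p7 * mmul (mmul (Xq GA) (Xq GB)) (Xq GC) i j"
    using assms(1) unfolding lincomb_def by blast
  show ?thesis
    by (rule lincombI[of _ "r * p0" "r * p1" "r * p2" "r * p3" "r * p4" "r * p5" "r * p6" "r * p7"])
      (simp add: p tproj_simps distrib_left mult.assoc)
qed

lemma lincomb_base:
  "mid \<in> lincomb" "Xq g \<in> lincomb"
  "mmul (Xq GA) (Xq GB) \<in> lincomb" "mmul (Xq GA) (Xq GC) \<in> lincomb" "mmul (Xq GB) (Xq GC) \<in> lincomb"
  "mmul (mmul (Xq GA) (Xq GB)) (Xq GC) \<in> lincomb"
proof -
  show "mid \<in> lincomb" by (rule lincombI[of _ 1 0 0 0 0 0 0 0]) (simp add: tproj_simps)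
  show "Xq g \<in> lincomb"
  proof (cases g)
    case GA
    then show ?thesis by (intro lincombI[of _ 0 1 0 0 0 0 0 0]) (simp add: tproj_simps)
  next
    case GB
    then show ?thesis by (intro lincombI[of _ 0 0 1 0 0 0 0 0]) (simp add: tproj_simps)
  next
    case GC
    then show ?thesis by (intro lincombI[of _ 0 0 0 1 0 0 0 0]) (simp add: tproj_simps)
  qed
  show "mmul (Xq GA) (Xq GB) \<in> lincomb" by (rule lincombI[of _ 0 0 0 0 1 0 0 0]) (simp add: tproj_simps)
  show "mmul (Xq GA) (Xq GC) \<in> lincomb" by (rule lincombI[of _ 0 0 0 0 0 1 0 0]) (simp add: tproj_simps)
  show "mmul (Xq GB) (Xq GC) \<in> lincomb" by (rule lincombI[of _ 0 0 0 0 0 0 1 0]) (simp add: tproj_simps)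
  show "mmul (mmul (Xq GA) (Xq GB)) (Xq GC) \<in> lincomb" by (rule lincombI[of _ 0 0 0 0 0 0 0 1]) (simp add: tproj_simps)
qed

lemma lincomb_minus: "M \<in> lincomb \<Longrightarrow> (\<lambda>i j. - M i j) \<in> lincomb"
  using lincomb_scale[of M "-1"] by (simp add: tproj_simps)

lemma mmul_linear:
  "mmul A (\<lambda>i j. M i j + N i j) = (\<lambda>i j. mmul A M i j + mmul A N i j)"
  "mmul A (\<lambda>i j. r * M i j) = (\<lambda>i j. r * mmul A M i j)"
  "mmul (\<lambda>i j. M i j + N i j) A = (\<lambda>i j. mmul M A i j + mmul N A i j)"
  "mmul (\<lambda>i j. r * M i j) A = (\<lambda>i j. r * mmul M A i j)"
  "mmul A (\<lambda>i j. - M i j) = (\<lambda>i j. - mmul A M i j)"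
  "mmul (\<lambda>i j. - M i j) A = (\<lambda>i j. - mmul M A i j)"
  by (simp_all add: mmul_def fun_eq_iff algebra_simps)

lemma lincomb_induct [consumes 1]:
  assumes "M \<in> lincomb" "P mid" "\<And>g. P (Xq g)" "P (mmul (Xq GA) (Xq GB))" "P (mmul (Xq GA) (Xq GC))"
    "P (mmul (Xq GB) (Xq GC))" "P (mmul (mmul (Xq GA) (Xq GB)) (Xq GC))"
    and add: "\<And>M N. P M \<Longrightarrow> P N \<Longrightarrow> P (\<lambda>i j. M i j + N i j)"
    and scale: "\<And>M r. P M \<Longrightarrow> P (\<lambda>i j. tproj r * M i j)"
  shows "P M"
proof -
  obtain p0 p1 p2 p3 p4 p5 p6 p7 where p: "M = (\<lambda>i j.
     tproj p0 * mid i j + tproj p1 * Xq GA i j + tproj p2 * Xq GB i j + tproj p3 * Xq GC i j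
     + tproj p4 * mmul (Xq GA) (Xq GB) i j + tproj p5 * mmul (Xq GA) (Xq GC) i j
     + tproj p6 * mmul (Xq GB) (Xq GC) i j + tproj p7 * mmul (mmul (Xq GA) (Xq GB)) (Xq GC) i j)"
    using assms(1) unfolding lincomb_def by blast
  show ?thesis unfolding p by (intro add scale assms(2-7))
qed

lemma cayley_hamilton: "mdet A = 1 \<Longrightarrow> mmul A A = (\<lambda>i j. mtr A * A i j + - mid i j)"
proof -
  assume "mdet A = 1"
  then have "A False False * A True True = 1 + A False True * A True False" by (simp add: mdet_def algebra_simps)
  then show ?thesis
    by (auto simp: mmul_def mtr_def mid_def fun_eq_iff all_bool_eq algebra_simps)
qed

lemma cayley_hamilton_mult: "mdet A = 1 \<Longrightarrow> mmul A (mmul A M) = (\<lambda>i j. mtr A * mmul A M i j + - M i j)"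
  by (simp only: mmul_assoc[symmetric] cayley_hamilton mmul_linear mmul_mid)

text \<open>Polarised Cayley-Hamilton: \<open>BA = - AB + tr A B + tr B A + (tr AB - tr A tr B)\<close>.\<close>

lemma mmul_swap:
  "mmul B A = (\<lambda>i j. - mmul A B i j + (mtr A * B i j + (mtr B * A i j + (mtr (mmul A B) - mtr A * mtr B) * mid i j)))"
  by (auto simp: mmul_def mtr_def mid_def fun_eq_iff all_bool_eq algebra_simps)

lemma mmul_swap_mult:
  "mmul B (mmul A M) = (\<lambda>i j. - mmul A (mmul B M) i j + (mtr A * mmul B M i j + (mtr B * mmul A M i j
     + (mtr (mmul A B) - mtr A * mtr B) * M i j)))"
  by (simp only: mmul_assoc[symmetric] mmul_swap[of B A] mmul_linear mmul_mid)

lemma lincomb_swap: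
  assumes "mmul A (mmul B M) \<in> lincomb" "mmul B M \<in> lincomb" "mmul A M \<in> lincomb" "M \<in> lincomb"
    and "mtr A = tproj p" "mtr B = tproj q" "mtr (mmul A B) = tproj r"
  shows "mmul B (mmul A M) \<in> lincomb"
proof -
  have "mtr (mmul A B) - mtr A * mtr B = tproj (r - p * q)" by (simp add: assms tproj_simps)
  then show ?thesis unfolding mmul_swap_mult[of B A M] assms(5,6)
    by (simp only:) (intro lincomb_add lincomb_minus lincomb_scale assms)
qed

lemma lincomb_square:
  assumes "mdet A = 1" "mtr A = tproj p" "mmul A M \<in> lincomb" "M \<in> lincomb"
  shows "mmul A (mmul A M) \<in> lincomb"
  unfolding cayley_hamilton_mult[OF assms(1)] assms(2)
  by (intro lincomb_add lincomb_scale lincomb_minus assms)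

text \<open>The letters are treated in the order a, b, c: swapping replaces b a M by a b M and
  shorter words, so closure under left multiplication by b relies on that by a, and the one by c on
  both.\<close>

lemma lincomb_mult_gen:
  assumes "M \<in> lincomb"
  shows "mmul (Xq g) M \<in> lincomb"
proof -
  note base = lincomb_base
  note sq = lincomb_square[OF mdet_Xq tproj_traces(1)[symmetric]]
    lincomb_square[OF mdet_Xq tproj_traces(2)[symmetric]]
    lincomb_square[OF mdet_Xq tproj_traces(3)[symmetric]]
  note swapBA = lincomb_swap[OF _ _ _ _ tproj_traces(1)[symmetric] tproj_traces(2)[symmetric] tproj_traces(4)[symmetric]]
  note swapCA = lincomb_swap[OF _ _ _ _ tproj_traces(1)[symmetric] tproj_traces(3)[symmetric] tproj_traces(5)[symmetric]]
  note swapCB = lincomb_swap[OF _ _ _ _ tproj_traces(2)[symmetric] tproj_traces(3)[symmetric] tproj_traces(6)[symmetric]]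
  have one: "mmul (Xq g) (Xq h) = mmul (Xq g) (mmul (Xq h) mid)" for g h by simp
  have A: "mmul (Xq GA) M \<in> lincomb" if "M \<in> lincomb" for M
    using that
  proof (induction rule: lincomb_induct)
    show "mmul (Xq GA) mid \<in> lincomb" by (simp add: base)
    show "mmul (Xq GA) (Xq h) \<in> lincomb" for h
      by (cases h) (simp_all add: base, subst one, rule sq, simp_all add: base)
    show "mmul (Xq GA) (mmul (Xq GA) (Xq GB)) \<in> lincomb"
      "mmul (Xq GA) (mmul (Xq GA) (Xq GC)) \<in> lincomb"
      by (rule sq; simp add: base)+
    show "mmul (Xq GA) (mmul (Xq GB) (Xq GC)) \<in> lincomb"
      using base(6) by (simp add: mmul_assoc)
    show "mmul (Xq GA) (mmul (mmul (Xq GA) (Xq GB)) (Xq GC)) \<in> lincomb"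
      unfolding mmul_assoc by (rule sq) (use base in \<open>simp_all add: mmul_assoc\<close>)
  qed (simp_all add: mmul_linear lincomb_add lincomb_scale)
  have BB: "mmul (Xq GB) (Xq GB) \<in> lincomb" by (subst one, rule sq) (simp_all add: base)
  have BA: "mmul (Xq GB) (Xq GA) \<in> lincomb" by (subst one, rule swapBA) (simp_all add: base)
  have BBC: "mmul (Xq GB) (mmul (Xq GB) (Xq GC)) \<in> lincomb" by (rule sq) (simp_all add: base)
  have B: "mmul (Xq GB) M \<in> lincomb" if "M \<in> lincomb" for M
    using that
  proof (induction rule: lincomb_induct)
    show "mmul (Xq GB) mid \<in> lincomb" by (simp add: base)
    show "mmul (Xq GB) (Xq h) \<in> lincomb" for h
      by (cases h) (simp_all add: base BB BA)
    show "mmul (Xq GB) (mmul (Xq GA) (Xq GB)) \<in> lincomb"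
      "mmul (Xq GB) (mmul (Xq GA) (Xq GC)) \<in> lincomb"
      by (rule swapBA; simp add: base A BB)+
    show "mmul (Xq GB) (mmul (Xq GB) (Xq GC)) \<in> lincomb" by (rule BBC)
    show "mmul (Xq GB) (mmul (mmul (Xq GA) (Xq GB)) (Xq GC)) \<in> lincomb"
      unfolding mmul_assoc by (rule swapBA) (use base A BBC in \<open>simp_all add: mmul_assoc\<close>)
  qed (simp_all add: mmul_linear lincomb_add lincomb_scale)
  have CC: "mmul (Xq GC) (Xq GC) \<in> lincomb" by (subst one, rule sq) (simp_all add: base)
  have CA: "mmul (Xq GC) (Xq GA) \<in> lincomb" by (subst one, rule swapCA) (simp_all add: base)
  have CB: "mmul (Xq GC) (Xq GB) \<in> lincomb" by (subst one, rule swapCB) (simp_all add: base)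
  have CBC: "mmul (Xq GC) (mmul (Xq GB) (Xq GC)) \<in> lincomb"
    by (rule swapCB) (simp_all add: base B CC)
  have C: "mmul (Xq GC) M \<in> lincomb" if "M \<in> lincomb" for M
    using that
  proof (induction rule: lincomb_induct)
    show "mmul (Xq GC) mid \<in> lincomb" by (simp add: base)
    show "mmul (Xq GC) (Xq h) \<in> lincomb" for h
      by (cases h) (simp_all add: base CA CB CC)
    show "mmul (Xq GC) (mmul (Xq GA) (Xq GB)) \<in> lincomb"
      "mmul (Xq GC) (mmul (Xq GA) (Xq GC)) \<in> lincomb"
      by (rule swapCA; simp add: base A CB CC)+
    show "mmul (Xq GC) (mmul (Xq GB) (Xq GC)) \<in> lincomb" by (rule CBC)
    show "mmul (Xq GC) (mmul (mmul (Xq GA) (Xq GB)) (Xq GC)) \<in> lincomb"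
      unfolding mmul_assoc by (rule swapCA) (use base A CBC in \<open>simp_all add: mmul_assoc\<close>)
  qed (simp_all add: mmul_linear lincomb_add lincomb_scale)
  show ?thesis using A B C assms by (cases g) simp_all
qed

lemma lincomb_mult:
  assumes "M \<in> lincomb" "N \<in> lincomb"
  shows "mmul M N \<in> lincomb"
  using assms(1)
  by (induction rule: lincomb_induct)
    (simp_all add: mmul_linear lincomb_add lincomb_scale mmul_assoc lincomb_mult_gen assms(2))

lemma mtr_lincomb:
  assumes "M \<in> lincomb"
  shows "\<exists>p. mtr M = tproj p"
  using assms
proof (induction rule: lincomb_induct)
  show "\<exists>p. mtr mid = tproj p" by (rule exI[of _ 2]) (simp add: mtr_def mid_def tproj_simps)
  show "\<exists>p. mtr (Xq g) = tproj p" for g by (cases g) (metis tproj_traces)+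
  fix M N :: "borq mat2" assume "\<exists>p. mtr M = tproj p" "\<exists>p. mtr N = tproj p"
  then obtain p q where "mtr M = tproj p" "mtr N = tproj q" by blast
  then have "mtr (\<lambda>i j. M i j + N i j) = tproj (p + q)"
    by (simp add: tproj_simps flip: \<open>mtr M = tproj p\<close> \<open>mtr N = tproj q\<close>) (simp add: mtr_def)
  then show "\<exists>p. mtr (\<lambda>i j. M i j + N i j) = tproj p" ..
next
  fix M r assume "\<exists>p. mtr M = tproj p"
  then obtain p where "mtr M = tproj p" by blast
  then have "mtr (\<lambda>i j. tproj r * M i j) = tproj (r * p)" by (simp add: mtr_def tproj_simps distrib_left[symmetric])
  then show "\<exists>p. mtr (\<lambda>i j. tproj r * M i j) = tproj p" ..
qed (metis tproj_traces)+

lemma lincomb_madj: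
  assumes "M \<in> lincomb"
  shows "madj M \<in> lincomb"
proof -
  obtain p where "mtr M = tproj p" using mtr_lincomb[OF assms] by blast
  moreover have "madj M = (\<lambda>i j. mtr M * mid i j + - M i j)"
    by (auto simp: madj_def mtr_def mid_def fun_eq_iff all_bool_eq)
  ultimately show ?thesis
    by (simp only:) (intro lincomb_add lincomb_scale lincomb_minus lincomb_base assms)
qed

section \<open>The conjugation action and its infinitesimal generators\<close>

definition conjact :: "complex mat2 \<Rightarrow> xvar mpoly \<Rightarrow> xvar mpoly" where
  "conjact M = msubst (conj_subst M)"

lemma rhom_conjact: "rhom (conjact M)"
  unfolding conjact_def by (rule rhom_msubst)

lemma conjact_mConst [simp]: "conjact M (mConst c) = mConst c"
  by (simp add: conjact_def)

lemma conjact_Xm: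
  "mmap (conjact M) (Xm g) = mmul (mmul (mmap mConst M) (Xm g)) (madj (mmap mConst M))"
  unfolding mmap_madj[OF rhom_mConst, symmetric]
  by (simp add: mmap_def Xm_def conjact_def conj_subst_def)

lemma conjact_eqI:
  assumes "rhom f" "\<And>c. f (mConst c) = mConst c"
    and "\<And>g. mmap f (Xm g) = mmul (mmul (mmap mConst M) (Xm g)) (madj (mmap mConst M))"
  shows "f p = conjact M p"
proof (rule rhom_eqI[OF assms(1) rhom_conjact])
  fix v :: xvar
  obtain g i j where v: "v = (g, i, j)" by (cases v)
  have "mmap f (Xm g) i j = mmap (conjact M) (Xm g) i j"
    by (simp only: assms(3) conjact_Xm)
  then show "f (mVar v) = conjact M (mVar v)" by (simp add: v mmap_def Xm_def)
qed (simp_all add: assms(2))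

text \<open>The entries of M are constants for the outer substitution, which therefore acts on the
  inner matrix only; this reverses the order of the factors.\<close>

lemma conjact_comp: "conjact L (conjact M p) = conjact (mmul M L) p"
proof (rule conjact_eqI[OF rhom_comp[OF rhom_conjact rhom_conjact]])
  fix g
  have c: "mmap (conjact L) (mmap mConst M) = mmap mConst M"
    by (simp add: mmap_def)
  have "mmap (\<lambda>x. conjact L (conjact M x)) (Xm g) = mmap (conjact L) (mmap (conjact M) (Xm g))"
    by (simp add: mmap_def)
  also have "\<dots> = mmul (mmul (mmap mConst (mmul M L)) (Xm g)) (madj (mmap mConst (mmul M L)))"
    by (simp only: conjact_Xm mmap_mmul[OF rhom_conjact] mmap_madj[OF rhom_conjact] c
        mmap_mmul[OF rhom_mConst] madj_mmul mmul_assoc)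
  finally show "mmap (\<lambda>x. conjact L (conjact M x)) (Xm g) =
    mmul (mmul (mmap mConst (mmul M L)) (Xm g)) (madj (mmap mConst (mmul M L)))" .
qed simp

lemma conjact_mid: "conjact mid p = p"
proof (rule conjact_eqI[OF rhom_id, symmetric])
  have "madj mid = (mid :: xvar mpoly mat2)" by (auto simp: madj_def mid_def fun_eq_iff)
  then show "mmap (\<lambda>x. x) (Xm g) = mmul (mmul (mmap mConst mid) (Xm g)) (madj (mmap mConst mid))" for g
    by (simp add: mmap_mid[OF rhom_mConst]) (simp add: mmap_def)
qed simp

text \<open>The largest part of \<open>J_Bor\<close> stable under conjugation. Stability holds by
  construction, and the infinitesimal generators inherit it.\<close>

definition J_core :: "xvar mpoly set" where
  "J_core = {f. \<forall>M. mdet M = 1 \<longrightarrow> conjact M f \<in> J_Bor}"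

lemma is_ideal_J_core: "is_ideal J_core"
  unfolding is_ideal_def J_core_def using is_ideal_J unfolding is_ideal_def
  by (simp add: rhom_simps[OF rhom_conjact])

lemma J_core_conjact: "f \<in> J_core \<Longrightarrow> mdet M = 1 \<Longrightarrow> conjact M f \<in> J_core"
  by (simp add: J_core_def conjact_comp mdet_mmul)

lemma J_core_subset: "f \<in> J_core \<Longrightarrow> f \<in> J_Bor"
  unfolding J_core_def using conjact_mid[of f]
  by (auto simp: mdet_def mid_def dest: spec[of _ mid])

text \<open>Cocycle identity: conjugating M f - f by L gives the difference of (ML) f - f and L f -
  f.\<close>

lemma B_Bor_J_core:
  assumes "f \<in> B_Bor" "mdet M = 1"
  shows "conjact M f - f \<in> J_core"
proof -
  have inv: "conjact M f - f \<in> J_Bor" if "mdet M = 1" for M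
    using assms(1) that by (simp add: B_Bor_def conjact_def)
  have "conjact L (conjact M f - f) \<in> J_Bor" if "mdet L = 1" for L
  proof -
    have "(conjact (mmul M L) f - f) - (conjact L f - f) \<in> J_Bor"
      by (intro is_ideal_diff[OF is_ideal_J] inv) (simp_all add: mdet_mmul assms that)
    then show ?thesis by (simp add: rhom_diff[OF rhom_conjact] conjact_comp)
  qed
  then show ?thesis by (simp add: J_core_def)
qed

section \<open>Unipotent one-parameter groups and their derivatives\<close>

definition unip :: "bool \<Rightarrow> 'a \<Rightarrow> 'a::comm_ring_1 mat2" where
  "unip b t = (\<lambda>i j. if i = j then 1 else if i = b then t else 0)"

lemma mdet_unip [simp]: "mdet (unip b t) = 1"
  by (cases b) (simp_all add: unip_def mdet_def)

lemma unip_0 [simp]: "unip b 0 = mid"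
  by (simp add: unip_def mid_def fun_eq_iff)

lemma mmap_unip: "rhom f \<Longrightarrow> mmap f (unip b t) = unip b (f t)"
  by (simp add: mmap_def unip_def fun_eq_iff rhom_simps)

text \<open>The parameter of the group is the indeterminate of the outer polynomial ring, so the
  derivative at 0 is a coefficient.\<close>

definition unip_act :: "bool \<Rightarrow> xvar mpoly \<Rightarrow> xvar mpoly poly" where
  "unip_act b = meval (\<lambda>c. [:mConst c:])
     (\<lambda>(g, i, j). mmul (mmul (unip b [:0, 1:]) (\<lambda>k l. [:Xm g k l:])) (madj (unip b [:0, 1:])) i j)"

lemma rhom_unip_act: "rhom (unip_act b)"
  unfolding unip_act_def by (rule rhom_meval[OF rhom_pCons[OF rhom_mConst]])

lemma unip_act_mConst: "unip_act b (mConst c) = [:mConst c:]"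
  unfolding unip_act_def by (rule meval_mConst[OF rhom_pCons[OF rhom_mConst]])

lemma unip_act_Xm:
  "mmap (unip_act b) (Xm g) = mmul (mmul (unip b [:0, 1:]) (\<lambda>k l. [:Xm g k l:])) (madj (unip b [:0, 1:]))"
  unfolding unip_act_def
  by (simp add: mmap_def meval_mVar[OF rhom_pCons[OF rhom_mConst]] Xm_def[of g])

lemma poly_unip_act: "poly (unip_act b f) (mConst t) = conjact (unip b t) f"
proof (rule conjact_eqI[OF rhom_comp[OF rhom_poly_at rhom_unip_act]])
  fix g
  let ?h = "\<lambda>p. poly p (mConst t)"
  have h: "rhom ?h" by (rule rhom_poly_at)
  have "mmap (\<lambda>x. ?h (unip_act b x)) (Xm g) = mmap ?h (mmap (unip_act b) (Xm g))"
    by (simp add: mmap_def)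
  also have "\<dots> = mmul (mmul (unip b (mConst t)) (mmap ?h (\<lambda>k l. [:Xm g k l:]))) (madj (unip b (mConst t)))"
    by (simp only: unip_act_Xm mmap_mmul[OF h] mmap_madj[OF h] mmap_unip[OF h]) simp
  finally show "mmap (\<lambda>x. ?h (unip_act b x)) (Xm g) =
      mmul (mmul (mmap mConst (unip b t)) (Xm g)) (madj (mmap mConst (unip b t)))"
    by (simp add: mmap_unip[OF rhom_mConst]) (simp add: mmap_def)
qed (simp add: unip_act_mConst)

lemma coeff_0_unip_act: "coeff (unip_act b f) 0 = f"
  using poly_unip_act[of b f 0] by (simp add: conjact_mid mConst_simps poly_0_coeff_0)

text \<open>The action of one of the two nilpotent generators of the Lie algebra of
  \<open>SL_2\<close>, a derivation by \<open>infgen_mult\<close>.\<close>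

definition infgen :: "bool \<Rightarrow> xvar mpoly \<Rightarrow> xvar mpoly" where
  "infgen b f = coeff (unip_act b f) 1"

lemma infgen_add: "infgen b (f + g) = infgen b f + infgen b g"
  and infgen_diff: "infgen b (f - g) = infgen b f - infgen b g"
  and infgen_uminus: "infgen b (- f) = - infgen b f"
  and infgen_zero [simp]: "infgen b 0 = 0"
  by (simp_all add: infgen_def rhom_simps[OF rhom_unip_act])

lemma infgen_mult: "infgen b (f * g) = infgen b f * g + f * infgen b g"
  by (simp add: infgen_def rhom_mult[OF rhom_unip_act] coeff_mult coeff_0_unip_act)

lemma infgen_mConst [simp]: "infgen b (mConst c) = 0"
  by (simp add: infgen_def unip_act_mConst)

lemma infgen_scale: "infgen b (mConst c * f) = mConst c * infgen b f"
  by (simp add: infgen_mult)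

lemma infgen_sum: "infgen b (sum f A) = (\<Sum>x\<in>A. infgen b (f x))"
  by (induction A rule: infinite_finite_induct) (simp_all add: infgen_add)

lemma poly_map_poly_rhom: "rhom h \<Longrightarrow> poly (map_poly h p) (h x) = h (poly p x)"
  by (induction p) (simp_all add: map_poly_pCons rhom_simps)

text \<open>Counting roots fails over a ring with zero divisors, but differences of distinct complex
  constants are units of \<open>borq\<close>, so linear factors at constants can be split off one
  after another.\<close>

lemma poly_kap_zero_aux:
  "finite S \<Longrightarrow> H = 0 \<or> degree H < card S \<Longrightarrow> (\<And>t. t \<in> S \<Longrightarrow> poly H (kap t) = 0) \<Longrightarrow> H = 0"
proof (induction "card S" arbitrary: S H)
  case 0
  then show ?case by simp
next
  case (Suc n)
  show ?case
  proof (rule ccontr)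
    assume H: "H \<noteq> 0"
    obtain s where s: "s \<in> S" using Suc.hyps(2) by fastforce
    let ?g = "synthetic_div H (kap s)"
    have eq: "[:- kap s, 1:] * ?g = H"
      using synthetic_div_correct'[of "kap s" H] Suc.prems(3)[OF s] by simp
    have deg: "degree ?g = degree H - 1" by (rule degree_synthetic_div)
    have "?g = 0"
    proof (rule Suc.hyps(1))
      show "n = card (S - {s})" using Suc.hyps(2) s Suc.prems(1) by simp
      show "finite (S - {s})" using Suc.prems(1) by simp
      show "?g = 0 \<or> degree ?g < card (S - {s})"
      proof (cases "degree H = 0")
        case True
        then obtain c where "H = [:c:]" using degree_eq_zeroE by blast
        then show ?thesis by simp
      next
        case False
        then have "degree H - 1 < card S - 1" using Suc.prems(2) H by linarith
        then show ?thesis using deg s Suc.prems(1) by simp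
      qed
      fix t assume t: "t \<in> S - {s}"
      have "poly H (kap t) = kap (t - s) * poly ?g (kap t)"
        by (subst eq[symmetric]) (simp add: kap_simps algebra_simps)
      then have "kap (inverse (t - s)) * (kap (t - s) * poly ?g (kap t)) = 0"
        using Suc.prems(3) t by simp
      moreover have "kap (inverse (t - s)) * kap (t - s) = 1"
        unfolding rhom_mult[OF rhom_kap, symmetric] using t by (simp add: rhom_one[OF rhom_kap])
      ultimately show "poly ?g (kap t) = 0" by (simp only: mult.assoc[symmetric] mult_1_left)
    qed
    with eq H show False by simp
  qed
qed

lemma poly_kap_zero:
  assumes "\<And>t. poly H (kap t) = 0"
  shows "H = 0"
proof -
  obtain S :: "complex set" where "finite S" "card S = Suc (degree H)"
    using infinite_arbitrarily_large[OF infinite_UNIV_char_0] by blast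
  then show ?thesis using poly_kap_zero_aux[of S H] assms by simp
qed

text \<open>The passage from group to Lie algebra: a polynomial in t all of whose values at
  constants lie in the ideal has its coefficients there.\<close>

lemma J_core_coeff:
  assumes "\<And>t. poly P (mConst t) \<in> J_core"
  shows "coeff P n \<in> J_core"
proof -
  have "conjact L (coeff P n) \<in> J_Bor" if L: "mdet L = 1" for L
  proof -
    let ?h = "\<lambda>f. proj (conjact L f)"
    have h: "rhom ?h" by (rule rhom_comp[OF rhom_proj rhom_conjact])
    have "poly (map_poly ?h P) (kap t) = 0" for t
    proof -
      have "poly (map_poly ?h P) (?h (mConst t)) = ?h (poly P (mConst t))"
        by (rule poly_map_poly_rhom[OF h])
      also have "\<dots> = 0" using assms[of t] L by (simp add: proj_eq_zero_iff J_core_def)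
      finally show ?thesis by (simp add: kap_def)
    qed
    then have "map_poly ?h P = 0" by (rule poly_kap_zero)
    then have "?h (coeff P n) = 0" using coeff_map_poly[of ?h P n] rhom_zero[OF h] by simp
    then show ?thesis by (simp add: proj_eq_zero_iff)
  qed
  then show ?thesis by (simp add: J_core_def)
qed

lemma J_core_infgen: "f \<in> J_core \<Longrightarrow> infgen b f \<in> J_core"
  unfolding infgen_def by (rule J_core_coeff) (simp add: poly_unip_act J_core_conjact)

lemma B_Bor_infgen:
  assumes "f \<in> B_Bor"
  shows "infgen b f \<in> J_core"
proof -
  have "coeff (unip_act b f - [:f:]) 1 \<in> J_core"
    by (rule J_core_coeff) (simp add: poly_unip_act B_Bor_J_core[OF assms])
  then show ?thesis by (simp add: infgen_def)
qed

section \<open>Tensor networks\<close>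

text \<open>\<open>X \<epsilon>\<close> with the symplectic form \<open>\<epsilon>\<close>: both indices then transform like vectors of \<open>\<complex>\<^sup>2\<close>.\<close>

definition Ym :: "gen \<Rightarrow> xvar mpoly mat2" where
  "Ym g = (\<lambda>i j. if j then Xm g i False else - Xm g i True)"

text \<open>The Leibniz action on a tensor with two slots in the standard representation: the
  generator b flips each index equal to b.\<close>

definition covariant2 :: "xvar mpoly mat2 \<Rightarrow> bool" where
  "covariant2 W \<longleftrightarrow> (\<forall>b i j. infgen b (W i j) =
     (if i = b then W (\<not> i) j else 0) + (if j = b then W i (\<not> j) else 0))"

lemma infgen_Xm: "infgen b (Xm g i j) =
  coeff (mmul (mmul (unip b [:0, 1:]) (\<lambda>k l. [:Xm g k l:])) (madj (unip b [:0, 1:])) i j) 1"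
  unfolding infgen_def unip_act_Xm[symmetric] by (simp add: mmap_def)

lemma covariant2_Ym: "covariant2 (Ym g)"
  unfolding covariant2_def
  by (simp add: all_bool_eq Ym_def infgen_uminus infgen_Xm mmul_def madj_def unip_def)

text \<open>Inverse to the passage from \<open>Xm\<close> to \<open>Ym\<close>. Under it
  transposition becomes the adjugate and gluing the matrix product, both up to sign.\<close>

definition unY :: "xvar mpoly mat2 \<Rightarrow> xvar mpoly mat2" where
  "unY W = (\<lambda>i j. if j then - W i False else W i True)"

text \<open>The edges of the networks: covariant tensors whose matrices are congruent to
  combinations of words.\<close>

definition Wset :: "xvar mpoly mat2 set" where
  "Wset = {W. covariant2 W \<and> mmap proj (unY W) \<in> lincomb}"

lemma Ym_Wset: "Ym g \<in> Wset"
proof -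
  have "unY (Ym g) = Xm g" by (auto simp: unY_def Ym_def fun_eq_iff)
  then show ?thesis using lincomb_base(2)[of g] by (simp add: Wset_def covariant2_Ym Xq_def)
qed

lemma Wset_transpose:
  assumes "W \<in> Wset"
  shows "(\<lambda>i j. W j i) \<in> Wset"
proof -
  have "mmap proj (unY (\<lambda>i j. W j i)) = (\<lambda>i j. - madj (mmap proj (unY W)) i j)"
    by (auto simp: unY_def madj_def mmap_def fun_eq_iff proj_simps all_bool_eq)
  moreover have "covariant2 (\<lambda>i j. W j i)"
    using assms unfolding Wset_def covariant2_def by (auto simp: add.commute)
  ultimately show ?thesis using assms by (simp add: Wset_def lincomb_minus lincomb_madj)
qed

definition glue :: "xvar mpoly mat2 \<Rightarrow> xvar mpoly mat2 \<Rightarrow> xvar mpoly mat2" where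
  "glue W W' = (\<lambda>i j. W i False * W' True j - W i True * W' False j)"

lemma Wset_glue:
  assumes "W \<in> Wset" "W' \<in> Wset"
  shows "glue W W' \<in> Wset"
proof -
  have "mmap proj (unY (glue W W')) = (\<lambda>i j. - mmul (mmap proj (unY W)) (mmap proj (unY W')) i j)"
    by (auto simp: unY_def glue_def mmul_def mmap_def fun_eq_iff proj_simps all_bool_eq algebra_simps)
  moreover have "covariant2 (glue W W')"
  proof -
    have c: "covariant2 W" "covariant2 W'" using assms by (simp_all add: Wset_def)
    show ?thesis
      using c unfolding covariant2_def glue_def
      by (simp add: all_bool_eq infgen_mult infgen_diff algebra_simps)
  qed
  ultimately show ?thesis using assms by (simp add: Wset_def lincomb_minus lincomb_mult)
qed

text \<open>The scalars of the networks, which absorb the edges that get closed into traces.\<close>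

definition invtr :: "xvar mpoly set" where
  "invtr = {\<tau>. (\<forall>b. infgen b \<tau> = 0) \<and> (\<exists>p. proj \<tau> = tproj p)}"

lemma invtr_mult: "\<sigma> \<in> invtr \<Longrightarrow> \<tau> \<in> invtr \<Longrightarrow> \<sigma> * \<tau> \<in> invtr"
  unfolding invtr_def by (auto simp: infgen_mult proj_simps tproj_simps[symmetric])

lemma invtr_one: "1 \<in> invtr"
  unfolding invtr_def using infgen_mConst[of _ 1]
  by (auto simp: mConst_simps proj_simps intro!: exI[of _ 1] simp: tproj_simps)

lemma invtr_trace:
  assumes "W \<in> Wset"
  shows "W False True - W True False \<in> invtr"
proof -
  have "proj (W False True - W True False) = mtr (mmap proj (unY W))"
    by (simp add: mtr_def mmap_def unY_def proj_simps)
  moreover have "infgen b (W False True - W True False) = 0" for b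
    using assms by (cases b) (simp_all add: Wset_def covariant2_def infgen_diff)
  ultimately show ?thesis
    using assms mtr_lincomb unfolding invtr_def Wset_def by auto
qed

text \<open>A perfect matching of the slots S by edges, times a scalar; the argument I assigns an
  index to every slot.\<close>

inductive net :: "nat set \<Rightarrow> ((nat \<Rightarrow> bool) \<Rightarrow> xvar mpoly) \<Rightarrow> bool" where
  net_empty: "\<tau> \<in> invtr \<Longrightarrow> net {} (\<lambda>I. \<tau>)"
| net_insert: "net S T \<Longrightarrow> i \<notin> S \<Longrightarrow> j \<notin> S \<Longrightarrow> i \<noteq> j \<Longrightarrow> W \<in> Wset \<Longrightarrow>
    net (insert i (insert j S)) (\<lambda>I. T I * W (I i) (I j))"

lemma net_insert':
  "net S T \<Longrightarrow> i \<notin> S \<Longrightarrow> j \<notin> S \<Longrightarrow> i \<noteq> j \<Longrightarrow> W \<in> Wset \<Longrightarrow>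
    S' = insert i (insert j S) \<Longrightarrow> (\<And>I. T' I = T I * W (I i) (I j)) \<Longrightarrow> net S' T'"
proof -
  assume *: "net S T" "i \<notin> S" "j \<notin> S" "i \<noteq> j" "W \<in> Wset" "S' = insert i (insert j S)"
    "\<And>I. T' I = T I * W (I i) (I j)"
  have "T' = (\<lambda>I. T I * W (I i) (I j))" using *(7) by (rule ext)
  then show ?thesis using net_insert[OF *(1-5)] *(6) by simp
qed

lemma net_scale:
  assumes "net S T" "\<tau> \<in> invtr"
  shows "net S (\<lambda>I. T I * \<tau>)"
  using assms(1)
proof induction
  case (net_empty \<sigma>)
  then show ?case using assms(2) by (simp add: net.net_empty invtr_mult)
next
  case (net_insert S T i j W)
  show ?case by (rule net_insert'[OF net_insert.IH net_insert.hyps(2-5)]) (simp_all add: mult_ac)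
qed

lemma net_local: "net S T \<Longrightarrow> (\<And>k. k \<in> S \<Longrightarrow> I k = I' k) \<Longrightarrow> T I = T I'"
proof (induction rule: net.induct)
  case (net_insert S T i j W)
  then have "T I = T I'" "I i = I' i" "I j = I' j" by blast+
  then show ?case by simp
qed simp

lemma net_finite: "net S T \<Longrightarrow> finite S"
  by (induction rule: net.induct) auto

lemma net_even: "net S T \<Longrightarrow> even (card S)"
  by (induction rule: net.induct) (auto dest: net_finite)

text \<open>The order of the factors is immaterial, so the edge at slot l can be split off; if l is
  its second end, the transposed tensor is taken.\<close>

lemma net_extract:
  assumes "net S T" "l \<in> S"
  shows "\<exists>e T' W. e \<in> S \<and> e \<noteq> l \<and> W \<in> Wset \<and> net (S - {l, e}) T' \<and> (\<forall>I. T I = T' I * W (I l) (I e))"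
  using assms
proof induction
  case (net_empty \<tau>)
  then show ?case by simp
next
  case (net_insert S T i j W)
  consider "l = i" | "l = j" | "l \<in> S" "l \<noteq> i" "l \<noteq> j" using net_insert.prems by blast
  then show ?case
  proof cases
    case 1
    have "insert i (insert j S) - {l, j} = S" using 1 net_insert.hyps by auto
    then show ?thesis using 1 net_insert.hyps by (intro exI[of _ j] exI[of _ T] exI[of _ W]) auto
  next
    case 2
    have "insert i (insert j S) - {l, i} = S" using 2 net_insert.hyps by auto
    then show ?thesis using 2 net_insert.hyps Wset_transpose[of W]
      by (intro exI[of _ i] exI[of _ T] exI[of _ "\<lambda>i j. W j i"]) auto
  next
    case 3
    then obtain e T' V where e: "e \<in> S" "e \<noteq> l" "V \<in> Wset" "net (S - {l, e}) T'"
      "\<And>I. T I = T' I * V (I l) (I e)"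
      using net_insert.IH by blast
    have "net (insert i (insert j S) - {l, e}) (\<lambda>I. T' I * W (I i) (I j))"
      by (rule net_insert'[OF e(4), of i j W]) (use e 3 net_insert.hyps in auto)
    then show ?thesis using e 3 net_insert.hyps
      by (intro exI[of _ e] exI[of _ "\<lambda>I. T' I * W (I i) (I j)"] exI[of _ V]) (auto simp: mult_ac)
  qed
qed

definition contract :: "nat \<Rightarrow> nat \<Rightarrow> ((nat \<Rightarrow> bool) \<Rightarrow> xvar mpoly) \<Rightarrow> (nat \<Rightarrow> bool) \<Rightarrow> xvar mpoly" where
  "contract k l T = (\<lambda>I. T (I(k := False, l := True)) - T (I(k := True, l := False)))"

text \<open>Contracting the two ends of one edge closes it into a trace (\<open>e = k\<close>);
  contracting ends of different edges glues them into a single edge.\<close>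

lemma net_contract:
  assumes "net S T" "k \<in> S" "l \<in> S" "k \<noteq> l"
  shows "net (S - {k, l}) (contract k l T)"
proof -
  obtain e T' W where e: "e \<in> S" "e \<noteq> l" "W \<in> Wset" "net (S - {l, e}) T'"
    "\<And>I. T I = T' I * W (I l) (I e)"
    using net_extract[OF assms(1,3)] by blast
  show ?thesis
  proof (cases "e = k")
    case True
    have loc: "T' (I(k := x, l := y)) = T' I" for I x y
      by (rule net_local[OF e(4)]) (auto simp: True)
    have "contract k l T = (\<lambda>I. T' I * (- (W False True - W True False)))"
      using assms(4) by (auto simp: contract_def e(5) loc True fun_eq_iff algebra_simps)
    moreover have "- (W False True - W True False) = (\<lambda>i j. W j i) False True - (\<lambda>i j. W j i) True False"
      by simp
    moreover have "\<dots> \<in> invtr" by (rule invtr_trace[OF Wset_transpose[OF e(3)]])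
    ultimately show ?thesis using net_scale[OF e(4)] by (simp add: True insert_commute)
  next
    case False
    then have "k \<in> S - {l, e}" using assms by auto
    from net_extract[OF e(4) this] obtain f T'' V where f: "f \<in> S - {l, e}" "f \<noteq> k" "V \<in> Wset"
      "net (S - {l, e} - {k, f}) T''" "\<And>I. T' I = T'' I * V (I k) (I f)" by blast
    have loc: "T'' (I(k := x, l := y)) = T'' I" for I x y
      by (rule net_local[OF f(4)]) auto
    show ?thesis
    proof (rule net_insert'[OF f(4), of f e "glue (\<lambda>i j. V j i) W"])
      show "glue (\<lambda>i j. V j i) W \<in> Wset" by (rule Wset_glue[OF Wset_transpose[OF f(3)] e(3)])
      show "S - {k, l} = insert f (insert e (S - {l, e} - {k, f}))"
        using e f False assms by auto
      show "contract k l T I = T'' I * glue (\<lambda>i j. V j i) W (I f) (I e)" for I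
        using e f False assms by (simp add: contract_def e(5) f(5) loc glue_def algebra_simps)
    qed (use e f in auto)
  qed
qed

lemma net_infgen:
  assumes "net S T"
  shows "infgen b (T I) = (\<Sum>k\<in>S. if I k = b then T (I(k := \<not> b)) else 0)"
  using assms
proof (induction arbitrary: I)
  case (net_empty \<tau>)
  then show ?case by (simp add: invtr_def)
next
  case (net_insert S T i j W)
  have fin: "finite S" using net_insert.hyps(1) by (rule net_finite)
  have loc: "T (I(k := x)) = T I" if "k \<notin> S" for k x
    by (rule net_local[OF net_insert.hyps(1)]) (use that in auto)
  have W: "infgen b (W (I i) (I j)) = (if I i = b then W (\<not> I i) (I j) else 0) + (if I j = b then W (I i) (\<not> I j) else 0)"
    using net_insert.hyps(5) by (simp add: Wset_def covariant2_def)
  have "infgen b (T I * W (I i) (I j)) =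
    (\<Sum>k\<in>S. (if I k = b then T (I(k := \<not> b)) else 0) * W (I i) (I j)) +
    T I * ((if I i = b then W (\<not> I i) (I j) else 0) + (if I j = b then W (I i) (\<not> I j) else 0))"
    by (simp add: infgen_mult W net_insert.IH sum_distrib_right)
  also have "(\<Sum>k\<in>S. (if I k = b then T (I(k := \<not> b)) else 0) * W (I i) (I j)) =
    (\<Sum>k\<in>S. if I k = b then T (I(k := \<not> b)) * W ((I(k := \<not> b)) i) ((I(k := \<not> b)) j) else 0)"
    by (rule sum.cong) (use net_insert.hyps in auto)
  finally show ?case
    using net_insert.hyps fin by (auto simp: loc algebra_simps)
qed

section \<open>The Casimir operator\<close>

definition Hop :: "xvar mpoly \<Rightarrow> xvar mpoly" where
  "Hop f = infgen False (infgen True f) - infgen True (infgen False f)"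

text \<open>With this normalisation the irreducible representation of highest weight m has
  eigenvalue m(m+2)/2.\<close>

definition Cas :: "xvar mpoly \<Rightarrow> xvar mpoly" where
  "Cas f = infgen False (infgen True f) + infgen True (infgen False f) + mConst (1/2) * Hop (Hop f)"

lemma Cas_J_core: "f \<in> J_core \<Longrightarrow> Cas f \<in> J_core"
  unfolding Cas_def Hop_def
  by (intro is_ideal_add[OF is_ideal_J_core] is_ideal_diff[OF is_ideal_J_core] J_core_infgen
      is_ideal_mult[OF is_ideal_J_core])

lemma Cas_B_Bor: "f \<in> B_Bor \<Longrightarrow> Cas f \<in> J_core"
  unfolding Cas_def Hop_def
  by (intro is_ideal_add[OF is_ideal_J_core] is_ideal_diff[OF is_ideal_J_core] J_core_infgen
      B_Bor_infgen is_ideal_mult[OF is_ideal_J_core])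

lemma Hop_add: "Hop (f + g) = Hop f + Hop g" and Hop_scale: "Hop (mConst c * f) = mConst c * Hop f"
  by (simp_all add: Hop_def infgen_add infgen_scale right_diff_distrib)

lemma Cas_add: "Cas (f + g) = Cas f + Cas g" and Cas_scale: "Cas (mConst c * f) = mConst c * Cas f"
  by (simp_all add: Cas_def Hop_add Hop_scale infgen_add infgen_scale distrib_left mult.left_commute)

text \<open>The second operator either undoes the flip at slot k, which returns \<open>T I\<close>,
  or flips another slot l. The first case accounts for the multiple of \<open>T I\<close>.\<close>

lemma net_infgen_twice:
  assumes net: "net S T"
  shows "infgen (\<not> b) (infgen b (T I)) = of_nat (card {k\<in>S. I k = b}) * T I
    + (\<Sum>k\<in>{k\<in>S. I k = b}. \<Sum>l\<in>{l\<in>S. I l = (\<not> b)}. T (I(k := \<not> b, l := b)))"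
proof -
  let ?A = "{k\<in>S. I k = b}" and ?B = "{l\<in>S. I l = (\<not> b)}"
  have fin: "finite S" by (rule net_finite[OF net])
  have one: "infgen b (T I) = (\<Sum>k\<in>{k\<in>S. I k = b}. T (I(k := \<not> b)))" for b I
    by (subst net_infgen[OF net]) (simp add: sum.inter_filter[OF fin])
  have "infgen (\<not> b) (infgen b (T I)) = (\<Sum>k\<in>?A. infgen (\<not> b) (T (I(k := \<not> b))))"
    by (simp add: one infgen_sum)
  also have "\<dots> = (\<Sum>k\<in>?A. T I + (\<Sum>l\<in>?B. T (I(k := \<not> b, l := b))))"
  proof (rule sum.cong[OF refl])
    fix k assume k: "k \<in> ?A"
    have "{l\<in>S. (I(k := \<not> b)) l = (\<not> b)} = insert k ?B" using k by auto
    moreover have "k \<notin> ?B" using k by auto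
    moreover have "I(k := b) = I" using k by auto
    ultimately show "infgen (\<not> b) (T (I(k := \<not> b))) = T I + (\<Sum>l\<in>?B. T (I(k := \<not> b, l := b)))"
      using fin by (simp add: one)
  qed
  finally show ?thesis by (simp add: sum.distrib)
qed

text \<open>On a tensor with \<open>m\<close> slots, the Casimir operator is \<open>m(m+2)/2\<close> minus twice the sum over
  pairs of slots of \<open>1\<close> minus the exchange of the pair, which is a contraction with \<open>\<epsilon>\<close>.\<close>

lemma net_Cas:
  assumes net: "net S T"
  shows "Cas (T I) = mConst (of_nat (card S * (card S + 2)) / 2) * T I
    - 2 * (\<Sum>k\<in>{k\<in>S. \<not> I k}. \<Sum>l\<in>{l\<in>S. I l}. contract k l T I)"
proof -
  let ?S0 = "{k\<in>S. \<not> I k}" and ?S1 = "{k\<in>S. I k}"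
  let ?n0 = "of_nat (card ?S0) :: complex" and ?n1 = "of_nat (card ?S1) :: complex"
  define sw where "sw = (\<Sum>k\<in>?S0. \<Sum>l\<in>?S1. T (I(k := True, l := False)))"
  have fin: "finite S" by (rule net_finite[OF net])
  have c: "of_nat n = mConst (of_nat n)" for n by (simp add: mConst_simps)
  have 10: "infgen True (infgen False (T I)) = mConst ?n0 * T I + sw"
    using net_infgen_twice[OF net, of False I] by (simp add: sw_def c)
  have "(\<Sum>k\<in>?S1. \<Sum>l\<in>?S0. T (I(k := False, l := True))) = sw"
    unfolding sw_def
    by (subst sum.swap) (auto intro!: sum.cong arg_cong[of _ _ T] fun_upd_twist)
  then have 01: "infgen False (infgen True (T I)) = mConst ?n1 * T I + sw"
    using net_infgen_twice[OF net, of True I] by (simp add: c)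
  have H: "Hop (T I) = mConst (?n1 - ?n0) * T I"
    by (simp add: Hop_def 01 10 mConst_simps algebra_simps)
  have C: "Cas (T I) = mConst (?n0 + ?n1 + (?n1 - ?n0)^2 / 2) * T I + 2 * sw"
    unfolding Cas_def H Hop_scale 01 10
    by (simp add: power2_eq_square rhom_mult[OF rhom_mConst, symmetric] mult.assoc[symmetric])
       (simp add: mConst_simps algebra_simps)
  have "contract k l T I = T I - T (I(k := True, l := False))" if "k \<in> ?S0" "l \<in> ?S1" for k l
  proof -
    have "I(k := False, l := True) = I" using that by (auto simp: fun_eq_iff)
    then show ?thesis by (simp add: contract_def)
  qed
  then have sum: "(\<Sum>k\<in>?S0. \<Sum>l\<in>?S1. contract k l T I) = mConst (?n0 * ?n1) * T I - sw"
    unfolding sw_def by (simp add: sum_subtractf mConst_simps mult.assoc)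
  have "card S = card ?S0 + card ?S1"
  proof -
    have "card (?S0 \<union> ?S1) = card ?S0 + card ?S1" by (rule card_Un_disjoint) (use fin in auto)
    moreover have "?S0 \<union> ?S1 = S" by auto
    ultimately show ?thesis by simp
  qed
  \<comment> \<open>With m = n0 + n1 this is m(m+2)/2 = n0 + n1 + (n1 - n0)^2/2 + 2 n0 n1.\<close>
  then have eig: "mConst (of_nat (card S * (card S + 2)) / 2) =
      mConst (?n0 + ?n1 + (?n1 - ?n0)^2 / 2) + 2 * mConst (?n0 * ?n1)"
    unfolding rhom_numeral[OF rhom_mConst, symmetric] rhom_mult[OF rhom_mConst, symmetric]
      rhom_add[OF rhom_mConst, symmetric]
    by (intro arg_cong[of _ _ mConst]) (simp add: power2_eq_square field_simps)
  show ?thesis unfolding C sum eig by (simp add: algebra_simps)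
qed

text \<open>The eigenvalue of the Casimir operator on the top component of \<open>2n + 2\<close> slots is
  \<open>2 (n+1) (n+2)\<close>.\<close>

fun casproj :: "nat \<Rightarrow> xvar mpoly \<Rightarrow> xvar mpoly" where
  "casproj 0 f = f"
| "casproj (Suc n) f = casproj n (f - mConst (1 / of_nat (2 * (n + 1) * (n + 2))) * Cas f)"

lemma casproj_add: "casproj n (f + g) = casproj n f + casproj n g"
proof (induction n arbitrary: f g)
  case (Suc n)
  have "f + g - mConst c * Cas (f + g) = (f - mConst c * Cas f) + (g - mConst c * Cas g)" for c
    by (simp add: Cas_add algebra_simps)
  then show ?case by (simp only: casproj.simps Suc)
qed simp

lemma casproj_scale: "casproj n (mConst c * f) = mConst c * casproj n f"
proof (induction n arbitrary: f)
  case (Suc n)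
  have "mConst c * f - mConst d * Cas (mConst c * f) = mConst c * (f - mConst d * Cas f)" for d
    by (simp add: Cas_scale right_diff_distrib mult.left_commute)
  then show ?case by (simp only: casproj.simps Suc)
qed simp

lemma casproj_uminus: "casproj n (- f) = - casproj n f"
  using casproj_scale[of n "-1" f] by (simp add: mConst_simps)

lemma casproj_sum: "casproj n (sum f A) = (\<Sum>x\<in>A. casproj n (f x))"
proof -
  have "casproj n 0 = 0" using casproj_scale[of n 0 0] by (simp add: mConst_simps)
  then show ?thesis by (induction A rule: infinite_finite_induct) (simp_all add: casproj_add)
qed

lemma casproj_J_core: "f \<in> J_core \<Longrightarrow> casproj n f \<in> J_core"
  by (induction n arbitrary: f)
    (simp_all add: is_ideal_diff[OF is_ideal_J_core] is_ideal_mult[OF is_ideal_J_core] Cas_J_core)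

text \<open>For f invariant modulo \<open>J_Bor\<close> every correction term is a multiple of some
  image of \<open>Cas f\<close>, which stays in \<open>J_core\<close>.\<close>

lemma casproj_B_Bor:
  assumes "f \<in> B_Bor"
  shows "f - casproj n f \<in> J_core"
proof (induction n)
  case 0
  show ?case by (simp add: is_ideal_zero[OF is_ideal_J_core])
next
  case (Suc n)
  let ?c = "mConst (1 / of_nat (2 * (n + 1) * (n + 2))) :: xvar mpoly"
  have "casproj (Suc n) f = casproj n f - ?c * casproj n (Cas f)"
    using casproj_add[of n f "- (?c * Cas f)"] by (simp add: casproj_uminus casproj_scale)
  then have "f - casproj (Suc n) f = (f - casproj n f) + ?c * casproj n (Cas f)" by simp
  then show ?case
    using is_ideal_add[OF is_ideal_J_core Suc is_ideal_mult[OF is_ideal_J_core casproj_J_core[OF Cas_B_Bor[OF assms]]]]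
    by metis
qed

definition trproj :: "xvar mpoly set" where
  "trproj = {f. \<exists>p. proj f = tproj p}"

lemma trproj_add: "f \<in> trproj \<Longrightarrow> g \<in> trproj \<Longrightarrow> f + g \<in> trproj"
  unfolding trproj_def by (auto simp: proj_simps tproj_simps[symmetric])

lemma trproj_scale: "f \<in> trproj \<Longrightarrow> mConst c * f \<in> trproj"
  unfolding trproj_def by (auto simp: proj_simps kap_def[symmetric] tproj_simps(10)[symmetric] tproj_simps(4)[symmetric])

lemma trproj_sum: "(\<And>x. x \<in> A \<Longrightarrow> f x \<in> trproj) \<Longrightarrow> sum f A \<in> trproj"
proof (induction A rule: infinite_finite_induct)
  have 0: "0 \<in> trproj" unfolding trproj_def by (auto intro!: exI[of _ 0] simp: proj_simps tproj_simps)
  then show "sum f {} \<in> trproj" by simp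
  show "sum f A \<in> trproj" if "infinite A" for A using that 0 by simp
qed (simp add: trproj_add)

text \<open>On 2n + 2 slots the first factor cancels the multiple of \<open>T I\<close> and leaves
  contractions, which have two slots fewer. On fewer slots \<open>T I\<close> itself is covered by
  the induction hypothesis.\<close>

lemma trproj_net:
  "net S T \<Longrightarrow> card S \<le> 2 * n \<Longrightarrow> casproj n (T I) \<in> trproj"
proof (induction n arbitrary: S T I)
  case 0
  then have "S = {}" using net_finite[of S T] by simp
  with 0(1) have "\<exists>\<tau>. \<tau> \<in> invtr \<and> T = (\<lambda>I. \<tau>)" by (auto elim: net.cases)
  then show ?case by (auto simp: invtr_def trproj_def)
next
  case (Suc n)
  let ?d = "of_nat (2 * (n + 1) * (n + 2)) :: complex"
  have d: "?d \<noteq> 0" unfolding of_nat_eq_0_iff by simp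
  define K where "K = (\<Sum>k\<in>{k\<in>S. \<not> I k}. \<Sum>l\<in>{l\<in>S. I l}. contract k l T I)"
  define a where "a = (of_nat (card S * (card S + 2)) / 2 :: complex)"
  have eq: "T I - mConst (1 / ?d) * Cas (T I) = mConst (1 - a / ?d) * T I + mConst (2 / ?d) * K"
  proof -
    define e where "e = 1 / ?d"
    have e: "1 / ?d = e" "a / ?d = a * e" "2 / ?d = 2 * e" by (simp_all add: e_def del: of_nat_mult of_nat_add)
    show ?thesis
      unfolding net_Cas[OF Suc.prems(1)] K_def[symmetric] a_def[symmetric] e
      by (simp add: mConst_simps algebra_simps)
  qed
  have contr: "casproj n (contract k l T I) \<in> trproj" if "k \<in> {k\<in>S. \<not> I k}" "l \<in> {l\<in>S. I l}" for k l
  proof (rule Suc.IH)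
    show "net (S - {k, l}) (contract k l T)"
      by (rule net_contract[OF Suc.prems(1)]) (use that in auto)
    have "card (S - {k, l}) = card S - 2"
      using that by (subst card_Diff_subset) (auto simp: card_insert_if)
    then show "card (S - {k, l}) \<le> 2 * n" using Suc.prems(2) by simp
  qed
  have "casproj (Suc n) (T I) = mConst (1 - a / ?d) * casproj n (T I)
      + mConst (2 / ?d) * (\<Sum>k\<in>{k\<in>S. \<not> I k}. \<Sum>l\<in>{l\<in>S. I l}. casproj n (contract k l T I))"
    unfolding casproj.simps eq K_def by (simp only: casproj_add casproj_scale casproj_sum)
  moreover have "mConst (1 - a / ?d) * casproj n (T I) \<in> trproj"
  proof (cases "card S \<le> 2 * n")
    case True
    then show ?thesis by (intro trproj_scale Suc.IH[OF Suc.prems(1)])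
  next
    case False
    then have "card S = 2 * n + 2"
      using Suc.prems(2) net_even[OF Suc.prems(1)] by presburger
    \<comment> \<open>m(m+2)/2 at m = 2n + 2, so the coefficient 1 - a/d vanishes.\<close>
    then have "a = ?d" by (simp add: a_def field_simps)
    then have "mConst (1 - a / ?d) * casproj n (T I) = mConst 0 * casproj n (T I)" using d by simp
    then show ?thesis using trproj_sum[of "{}"] by (simp add: mConst_simps)
  qed
  ultimately show ?case
    using contr by (auto intro!: trproj_add trproj_scale trproj_sum)
qed

text \<open>A coordinate of the representation is, up to sign, an entry of \<open>Ym g\<close> with
  the second index negated, so a monomial of degree k is a component of a network with 2k
  slots.\<close>

lemma net_monomial:
  "\<exists>S T I. net S T \<and> prod_list (map mVar vs) = T I \<and> S = {..<2 * length vs}"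
proof (induction vs)
  case Nil
  show ?case using net_empty[OF invtr_one] by (intro exI[of _ "{}"] exI[of _ "\<lambda>I. 1"] exI[of _ "\<lambda>_. False"]) simp
next
  case (Cons v vs)
  then obtain S T I where net: "net S T" "prod_list (map mVar vs) = T I" "S = {..<2 * length vs}" by blast
  obtain g i j where v: "v = (g, i, j)" by (cases v)
  let ?n = "2 * length vs"
  let ?W = "if j then (\<lambda>k l. mConst (-1) * Ym g k l) else Ym g"
  have neg: "(\<lambda>k l. - Ym g k l) \<in> Wset"
  proof -
    have "mmap proj (unY (\<lambda>k l. - Ym g k l)) = (\<lambda>i j. - mmap proj (unY (Ym g)) i j)"
      by (auto simp: unY_def mmap_def fun_eq_iff proj_simps)
    moreover have "covariant2 (\<lambda>k l. - Ym g k l)"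
      using covariant2_Ym[of g] by (auto simp: covariant2_def infgen_uminus)
    ultimately show ?thesis using Ym_Wset[of g] by (simp add: Wset_def lincomb_minus)
  qed
  obtain W where W: "W \<in> Wset" "mVar v = W i (\<not> j)"
  proof (cases j)
    case True
    then have "mVar v = - Ym g i (\<not> j)" by (simp add: v Ym_def Xm_def)
    then show ?thesis using that[OF neg] by simp
  next
    case False
    then have "mVar v = Ym g i (\<not> j)" by (simp add: v Ym_def Xm_def)
    then show ?thesis using that[OF Ym_Wset] by simp
  qed
  have "net {..<2 * length (v # vs)} (\<lambda>I. T I * W (I ?n) (I (Suc ?n)))"
    by (rule net_insert'[OF net(1), of ?n "Suc ?n" W]) (use net W in auto)
  moreover have "T (I(?n := i, Suc ?n := \<not> j)) = T I"
    by (rule net_local[OF net(1)]) (use net(3) in auto)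
  then have "prod_list (map mVar (v # vs)) =
    (\<lambda>I. T I * W (I ?n) (I (Suc ?n))) (I(?n := i, Suc ?n := \<not> j))"
    by (simp add: net(2)[symmetric] W(2) mult.commute)
  ultimately show ?case by blast
qed

text \<open>Claimed for all large n, so that the bounds of two summands can be combined.\<close>

lemma casproj_trproj: "\<exists>n0. \<forall>n\<ge>n0. casproj n f \<in> trproj"
proof (induction f rule: mpoly_add_induct)
  case (single \<mu> a)
  have "\<exists>vs. mono_eval mVar \<mu> = prod_list (map mVar vs)"
  proof -
    have pow: "mVar v ^ n = prod_list (map mVar (replicate n v))" for v :: xvar and n
      by (induction n) simp_all
    have "\<exists>vs. (\<Prod>v\<in>V. mVar v ^ Poly_Mapping.lookup \<mu> v) = prod_list (map mVar vs)" if "finite V" for V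
      using that
    proof (induction V)
      case empty
      show ?case by (rule exI[of _ "[]"]) simp
    next
      case (insert v V)
      then obtain vs where vs: "(\<Prod>v\<in>V. mVar v ^ Poly_Mapping.lookup \<mu> v) = prod_list (map mVar vs)" by blast
      have "(\<Prod>v\<in>insert v V. mVar v ^ Poly_Mapping.lookup \<mu> v) =
          mVar v ^ Poly_Mapping.lookup \<mu> v * prod_list (map mVar vs)"
        by (simp only: prod.insert[OF insert.hyps] vs)
      also have "\<dots> = prod_list (map mVar (replicate (Poly_Mapping.lookup \<mu> v) v @ vs))"
        unfolding map_append prod_list.append by (simp only: pow)
      finally show ?case by blast
    qed
    then show ?thesis by (simp add: mono_eval_def)
  qed
  then obtain vs where vs: "mono_eval mVar \<mu> = prod_list (map mVar vs)" by blast
  obtain S T I where net: "net S T" "prod_list (map mVar vs) = T I" "S = {..<2 * length vs}"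
    using net_monomial by blast
  have "casproj n (Poly_Mapping.single \<mu> a) \<in> trproj" if "n \<ge> length vs" for n
    unfolding single_conv_mono_eval vs net(2) casproj_scale
    by (intro trproj_scale trproj_net[OF net(1)]) (use that net(3) in simp)
  then show ?case by blast
next
  case (add p q)
  then obtain n1 n2 where "\<forall>n\<ge>n1. casproj n p \<in> trproj" "\<forall>n\<ge>n2. casproj n q \<in> trproj" by blast
  then show ?case by (intro exI[of _ "max n1 n2"]) (simp add: casproj_add trproj_add)
qed

theorem B_Bor_trace_generated:
  assumes "f \<in> B_Bor"
  shows "\<exists>p. f - msubst trace_map p \<in> J_Bor"
proof -
  obtain n where "casproj n f \<in> trproj" using casproj_trproj by blast
  then obtain p where "proj (casproj n f) = tproj p" by (auto simp: trproj_def)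
  moreover have "f - casproj n f \<in> J_Bor" by (rule J_core_subset[OF casproj_B_Bor[OF assms]])
  ultimately have "proj f = tproj p" by (simp add: proj_eq_iff[symmetric])
  then show ?thesis unfolding tproj_def proj_eq_iff by blast
qed

section \<open>Quaternion coordinates on two-by-two matrices\<close>

text \<open>Interpreted twice: in \<open>borq\<close>, where identities yield kernel elements, and
  in the complex numbers, where they yield representations.\<close>

locale quaternion_coords =
  fixes I h :: "'r::comm_ring_1"
  assumes I_sq: "I * I = -1" and two_h: "2 * h = 1"
begin

lemma I_mult: "I * (I * t) = - t"
  using I_sq by (simp add: mult.assoc[symmetric])

lemma I_cancel: "I * s = I * t \<longleftrightarrow> s = t"
proof
  assume "I * s = I * t"
  then have "I * (I * s) = I * (I * t)" by simp
  then show "s = t" by (simp add: I_mult)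
qed simp

lemma two_cancel: "2 * s = 2 * (t::'r) \<longleftrightarrow> s = t"
proof
  have half: "h * (2 * r) = r" for r
  proof -
    have "h * (2 * r) = (2 * h) * r" by (simp only: mult_ac)
    then show ?thesis by (simp only: two_h mult_1_left)
  qed
  assume "2 * s = 2 * t"
  then have "h * (2 * s) = h * (2 * t)" by simp
  then show "s = t" by (simp only: half)
qed simp

text \<open>The quaternion x + a1 i + a2 j + a3 k as a matrix; products are then expressed by dot
  and cross products of vector parts.\<close>

definition qmat :: "'r \<Rightarrow> 'r \<Rightarrow> 'r \<Rightarrow> 'r \<Rightarrow> 'r mat2" where
  "qmat x a1 a2 a3 = (\<lambda>i j. if i then (if j then x - I * a1 else - a2 + I * a3)
     else (if j then a2 + I * a3 else x + I * a1))"

lemma mmul_qmat: "mmul (qmat x a1 a2 a3) (qmat y b1 b2 b3) =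
  qmat (x * y - (a1 * b1 + a2 * b2 + a3 * b3)) (x * b1 + y * a1 + (a2 * b3 - a3 * b2))
    (x * b2 + y * a2 + (a3 * b1 - a1 * b3)) (x * b3 + y * a3 + (a1 * b2 - a2 * b1))"
  by (simp add: mmul_def qmat_def fun_eq_iff all_bool_eq algebra_simps I_mult)

lemma madj_qmat: "madj (qmat x a1 a2 a3) = qmat x (- a1) (- a2) (- a3)"
  by (simp add: madj_def qmat_def fun_eq_iff all_bool_eq algebra_simps)

lemma mtr_qmat: "mtr (qmat x a1 a2 a3) = 2 * x"
  by (simp add: mtr_def qmat_def algebra_simps)

lemma mdet_qmat: "mdet (qmat x a1 a2 a3) = x * x + (a1 * a1 + a2 * a2 + a3 * a3)"
  by (simp add: mdet_def qmat_def algebra_simps I_mult)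

lemma qmat_eq_iff: "qmat x a1 a2 a3 = qmat y b1 b2 b3 \<longleftrightarrow> x = y \<and> a1 = b1 \<and> a2 = b2 \<and> a3 = b3"
proof
  assume "qmat x a1 a2 a3 = qmat y b1 b2 b3"
  then have e: "x + I * a1 = y + I * b1" "x - I * a1 = y - I * b1"
      "a2 + I * a3 = b2 + I * b3" "- a2 + I * a3 = - b2 + I * b3"
    by (simp_all add: qmat_def fun_eq_iff all_bool_eq)
  have "2 * x = 2 * y" using arg_cong2[OF e(1,2), of "(+)"] by simp
  moreover have "2 * (I * a3) = 2 * (I * b3)" using arg_cong2[OF e(3,4), of "(+)"] by simp
  ultimately show "x = y \<and> a1 = b1 \<and> a2 = b2 \<and> a3 = b3"
    using e by (auto simp: two_cancel I_cancel)
qed simp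

lemma qmat_surj: "\<exists>x a1 a2 a3. A = qmat x a1 a2 a3"
proof -
  have hh: "h * t + h * t = t" for t
    using two_h by (metis distrib_right mult_1_left mult_2)
  have hh': "h * t + (h * t + s) = t + s" for s t
    using hh[of t] by (simp add: add.assoc[symmetric])
  have "A = qmat (h * (A False False + A True True)) (- I * (h * (A False False - A True True)))
     (h * (A False True - A True False)) (- I * (h * (A False True + A True False)))"
    by (simp add: qmat_def fun_eq_iff all_bool_eq algebra_simps I_mult hh hh')
  then show ?thesis by blast
qed

text \<open>\<open>[B, C\<^sup>-\<^sup>1] - 1 = -2 (b \<times> c) B\<^sup>-\<^sup>1 C\<close>; this is its vector part up to the factor \<open>-2\<close>.\<close>

definition commvec :: "'r \<Rightarrow> 'r \<Rightarrow> 'r \<Rightarrow> 'r \<Rightarrow> 'r \<Rightarrow> 'r \<Rightarrow> 'r \<Rightarrow> 'r \<Rightarrow> 'r" where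
  "commvec y b1 b2 b3 z c1 c2 c3 =
    (y * z + (b1 * c1 + b2 * c2 + b3 * c3)) * (b2 * c3 - b3 * c2)
    + (z * (b1 * c1 + b2 * c2 + b3 * c3) - y * (c1 * c1 + c2 * c2 + c3 * c3)) * b1
    + (y * (b1 * c1 + b2 * c2 + b3 * c3) - z * (b1 * b1 + b2 * b2 + b3 * b3)) * c1"

lemma mcomm_qmat: "\<exists>w. mcomm (qmat y b1 b2 b3) (madj (qmat z c1 c2 c3)) =
  qmat w (- 2 * commvec y b1 b2 b3 z c1 c2 c3) (- 2 * commvec y b2 b3 b1 z c2 c3 c1)
    (- 2 * commvec y b3 b1 b2 z c3 c1 c2)"
  unfolding mcomm_def madj_qmat mmul_qmat minus_minus qmat_eq_iff
  by (intro exI conjI, rule refl) (simp_all add: commvec_def algebra_simps)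

text \<open>Quaternions commute when the cross product of their vector parts vanishes. The cross
  product occurs here with the factor 4, which is cancelled by means of h.\<close>

lemma qmat_commute_iff: "mmul (qmat x a1 a2 a3) (qmat w (- 2 * w1) (- 2 * w2) (- 2 * w3)) =
   mmul (qmat w (- 2 * w1) (- 2 * w2) (- 2 * w3)) (qmat x a1 a2 a3) \<longleftrightarrow>
   a2 * w3 = a3 * w2 \<and> a3 * w1 = a1 * w3 \<and> a1 * w2 = a2 * w1"
proof -
  have c: "s = t \<longleftrightarrow> r = r'" if "s - t = 2 * (2 * (r' - r))" for s t r r' :: 'r
  proof -
    have "s = t \<longleftrightarrow> 2 * (2 * (r' - r)) = 2 * (2 * 0)" using that by auto
    also have "\<dots> \<longleftrightarrow> r' - r = 0" by (simp only: two_cancel)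
    finally show ?thesis by auto
  qed
  have iff: "(S = S' \<and> X1 = Y1 \<and> X2 = Y2 \<and> X3 = Y3) \<longleftrightarrow> (P \<and> Q \<and> R)"
    if "S = S'" "X1 = Y1 \<longleftrightarrow> P" "X2 = Y2 \<longleftrightarrow> Q" "X3 = Y3 \<longleftrightarrow> R" for S S' X1 Y1 X2 Y2 X3 Y3 :: 'r and P Q R
    using that by simp
  show ?thesis
    unfolding mmul_qmat qmat_eq_iff
    by (rule iff, simp add: algebra_simps) (rule c, simp add: algebra_simps)+
qed

lemma relator_iff:
  assumes "x * x + (a1 * a1 + a2 * a2 + a3 * a3) = 1" "y * y + (b1 * b1 + b2 * b2 + b3 * b3) = 1"
    "z * z + (c1 * c1 + c2 * c2 + c3 * c3) = 1"
  defines "w1 \<equiv> commvec y b1 b2 b3 z c1 c2 c3" and "w2 \<equiv> commvec y b2 b3 b1 z c2 c3 c1"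
    and "w3 \<equiv> commvec y b3 b1 b2 z c3 c1 c2"
  shows "mcomm (qmat x a1 a2 a3) (mcomm (qmat y b1 b2 b3) (madj (qmat z c1 c2 c3))) = mid \<longleftrightarrow>
    a2 * w3 = a3 * w2 \<and> a3 * w1 = a1 * w3 \<and> a1 * w2 = a2 * w1"
proof -
  obtain w where w: "mcomm (qmat y b1 b2 b3) (madj (qmat z c1 c2 c3)) =
     qmat w (- 2 * w1) (- 2 * w2) (- 2 * w3)"
    unfolding w1_def w2_def w3_def using mcomm_qmat by blast
  have "mdet (mcomm (qmat y b1 b2 b3) (madj (qmat z c1 c2 c3))) = 1"
    using assms by (intro mdet_mcomm) (simp_all add: mdet_qmat)
  then show ?thesis
    using assms(1) by (subst mcomm_eq_mid_iff) (simp_all only: mdet_qmat w qmat_commute_iff)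
qed

end

section \<open>Consequences of the relators for Gram matrices\<close>

text \<open>Let l = y*z+u, p = z*u - y*(1-z*z), q = y*u - z*(1-y*y) be the coefficients of the
  vector part of the inner commutator along b x c, b, c. \<open>Eb\<close>, \<open>Ec\<close>,
  \<open>Ebc\<close>, \<open>Eab\<close> are the left-hand sides of \<open>cross_dots\<close> with
  the squares of a, b, c replaced by 1-x*x, 1-y*y, 1-z*z.\<close>

definition Eb :: "'r::comm_ring_1 \<Rightarrow> 'r \<Rightarrow> 'r \<Rightarrow> 'r \<Rightarrow> 'r \<Rightarrow> 'r \<Rightarrow> 'r \<Rightarrow> 'r" where
  "Eb x y z u v w d = (y*z+u)*((1-y*y)*v - u*w) + (y*u - z*(1-y*y))*d"

definition Ec :: "'r::comm_ring_1 \<Rightarrow> 'r \<Rightarrow> 'r \<Rightarrow> 'r \<Rightarrow> 'r \<Rightarrow> 'r \<Rightarrow> 'r \<Rightarrow> 'r" where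
  "Ec x y z u v w d = (y*z+u)*(u*v - (1-z*z)*w) - (z*u - y*(1-z*z))*d"

definition Ebc :: "'r::comm_ring_1 \<Rightarrow> 'r \<Rightarrow> 'r \<Rightarrow> 'r \<Rightarrow> 'r \<Rightarrow> 'r \<Rightarrow> 'r \<Rightarrow> 'r" where
  "Ebc x y z u v w d = (z*u - y*(1-z*z))*(w*u - v*(1-y*y)) + (y*u - z*(1-y*y))*(w*(1-z*z) - v*u)"

definition Eab :: "'r::comm_ring_1 \<Rightarrow> 'r \<Rightarrow> 'r \<Rightarrow> 'r \<Rightarrow> 'r \<Rightarrow> 'r \<Rightarrow> 'r \<Rightarrow> 'r" where
  "Eab x y z u v w d = (y*z+u)*w*d + (z*u - y*(1-z*z))*((1-x*x)*(1-y*y) - w*w)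
     + (y*u - z*(1-y*y))*((1-x*x)*u - w*v)"

definition gram_det :: "'r::comm_ring_1 \<Rightarrow> 'r \<Rightarrow> 'r \<Rightarrow> 'r \<Rightarrow> 'r \<Rightarrow> 'r \<Rightarrow> 'r" where
  "gram_det A B C u v w = A*B*C + 2*u*v*w - A*u*u - B*v*v - C*w*w"

definition det3 :: "'r::comm_ring_1 \<Rightarrow> 'r \<Rightarrow> 'r \<Rightarrow> 'r \<Rightarrow> 'r \<Rightarrow> 'r \<Rightarrow> 'r \<Rightarrow> 'r \<Rightarrow> 'r \<Rightarrow> 'r" where
  "det3 a1 a2 a3 b1 b2 b3 c1 c2 c3 = (a2*b3 - a3*b2)*c1 + (a3*b1 - a1*b3)*c2 + (a1*b2 - a2*b1)*c3"

lemma det3_square: "det3 a1 a2 a3 b1 b2 b3 c1 c2 c3 * det3 a1 a2 a3 b1 b2 b3 c1 c2 c3 =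
  gram_det (a1*a1+a2*a2+a3*a3) (b1*b1+b2*b2+b3*b3) (c1*c1+c2*c2+c3*c3)
   (b1*c1+b2*c2+b3*c3) (a1*c1+a2*c2+a3*c3) (a1*b1+a2*b2+a3*b3)"
  unfolding det3_def gram_det_def by (simp add: algebra_simps)

lemma det3_rotate: "det3 b1 b2 b3 c1 c2 c3 a1 a2 a3 = det3 a1 a2 a3 b1 b2 b3 c1 c2 c3"
  unfolding det3_def by (simp add: algebra_simps)

text \<open>The equations \<open>a \<times> (l (b \<times> c) + p b + q c) = 0\<close> paired with \<open>b\<close>, \<open>c\<close>, \<open>b \<times> c\<close> and \<open>a \<times> b\<close>.\<close>

lemma cross_dots:
  fixes a1 a2 a3 b1 b2 b3 c1 c2 c3 l p q u v w A B C d :: "'r::comm_ring_1"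
  defines "n1 \<equiv> \<lambda>l p q. l*(b2*c3 - b3*c2) + p*b1 + q*c1"
    and "n2 \<equiv> \<lambda>l p q. l*(b3*c1 - b1*c3) + p*b2 + q*c2"
    and "n3 \<equiv> \<lambda>l p q. l*(b1*c2 - b2*c1) + p*b3 + q*c3"
  assumes "a2 * n3 l p q = a3 * n2 l p q" "a3 * n1 l p q = a1 * n3 l p q" "a1 * n2 l p q = a2 * n1 l p q"
    and u: "u = b1*c1+b2*c2+b3*c3" and v: "v = a1*c1+a2*c2+a3*c3" and w: "w = a1*b1+a2*b2+a3*b3"
    and A: "A = a1*a1+a2*a2+a3*a3" and B: "B = b1*b1+b2*b2+b3*b3" and C: "C = c1*c1+c2*c2+c3*c3"
    and d: "d = - det3 a1 a2 a3 b1 b2 b3 c1 c2 c3"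
  shows "l*(B*v - u*w) + q*d = 0" "l*(u*v - C*w) - p*d = 0"
    "p*(w*u - v*B) + q*(w*C - v*u) = 0" "l*w*d + p*(A*B - w*w) + q*(A*u - w*v) = 0"
proof -
  define e1 where "e1 = a2 * n3 l p q - a3 * n2 l p q"
  define e2 where "e2 = a3 * n1 l p q - a1 * n3 l p q"
  define e3 where "e3 = a1 * n2 l p q - a2 * n1 l p q"
  have e: "e1 = 0" "e2 = 0" "e3 = 0" using assms(4-6) by (simp_all add: e1_def e2_def e3_def)
  have "l*(B*v - u*w) + q*d = b1*e1 + b2*e2 + b3*e3"
    unfolding e1_def e2_def e3_def n1_def n2_def n3_def u v w B d det3_def by (simp add: algebra_simps)
  then show "l*(B*v - u*w) + q*d = 0" by (simp add: e)
  have "l*(u*v - C*w) - p*d = c1*e1 + c2*e2 + c3*e3"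
    unfolding e1_def e2_def e3_def n1_def n2_def n3_def u v w C d det3_def by (simp add: algebra_simps)
  then show "l*(u*v - C*w) - p*d = 0" by (simp add: e)
  have "p*(w*u - v*B) + q*(w*C - v*u) = (b2*c3 - b3*c2)*e1 + (b3*c1 - b1*c3)*e2 + (b1*c2 - b2*c1)*e3"
    unfolding e1_def e2_def e3_def n1_def n2_def n3_def u v w B C by (simp add: algebra_simps)
  then show "p*(w*u - v*B) + q*(w*C - v*u) = 0" by (simp add: e)
  have "l*w*d + p*(A*B - w*w) + q*(A*u - w*v) =
      (a2*b3 - a3*b2)*e1 + (a3*b1 - a1*b3)*e2 + (a1*b2 - a2*b1)*e3"
    unfolding e1_def e2_def e3_def n1_def n2_def n3_def u v w A B d det3_def by (simp add: algebra_simps)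
  then show "l*w*d + p*(A*B - w*w) + q*(A*u - w*v) = 0" by (simp add: e)
qed

context quaternion_coords
begin

lemma relator_gram:
  assumes A: "x * x + (a1 * a1 + a2 * a2 + a3 * a3) = 1" and B: "y * y + (b1 * b1 + b2 * b2 + b3 * b3) = 1"
    and C: "z * z + (c1 * c1 + c2 * c2 + c3 * c3) = 1"
    and rel: "mcomm (qmat x a1 a2 a3) (mcomm (qmat y b1 b2 b3) (madj (qmat z c1 c2 c3))) = mid"
    and u: "u = b1*c1+b2*c2+b3*c3" and v: "v = a1*c1+a2*c2+a3*c3" and w: "w = a1*b1+a2*b2+a3*b3"
    and d: "d = - det3 a1 a2 a3 b1 b2 b3 c1 c2 c3"
  shows "Eb x y z u v w d = 0" "Ec x y z u v w d = 0" "Ebc x y z u v w d = 0" "Eab x y z u v w d = 0"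
proof -
  have A': "1 - x * x = a1 * a1 + a2 * a2 + a3 * a3" and B': "1 - y * y = b1 * b1 + b2 * b2 + b3 * b3"
    and C': "1 - z * z = c1 * c1 + c2 * c2 + c3 * c3"
    using A B C by (simp_all add: algebra_simps)
  have cv: "commvec y b1 b2 b3 z c1 c2 c3 =
     (y*z+u)*(b2*c3 - b3*c2) + (z*u - y*(1-z*z))*b1 + (y*u - z*(1-y*y))*c1"
    "commvec y b2 b3 b1 z c2 c3 c1 =
     (y*z+u)*(b3*c1 - b1*c3) + (z*u - y*(1-z*z))*b2 + (y*u - z*(1-y*y))*c2"
    "commvec y b3 b1 b2 z c3 c1 c2 =
     (y*z+u)*(b1*c2 - b2*c1) + (z*u - y*(1-z*z))*b3 + (y*u - z*(1-y*y))*c3"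
    unfolding commvec_def B' C' u by (simp_all add: algebra_simps)
  note dots = cross_dots[OF rel[unfolded relator_iff[OF A B C] cv, THEN conjunct1]
      rel[unfolded relator_iff[OF A B C] cv, THEN conjunct2, THEN conjunct1]
      rel[unfolded relator_iff[OF A B C] cv, THEN conjunct2, THEN conjunct2] u v w A' B' C' d]
  show "Eb x y z u v w d = 0" "Ec x y z u v w d = 0" "Ebc x y z u v w d = 0" "Eab x y z u v w d = 0"
    using dots by (simp_all only: Eb_def Ec_def Ebc_def Eab_def)
qed

end

text \<open>Explicit combinations of the pairings of the three relators, valid over every
  commutative ring. Rotating a, b, c cyclically yields the relations not listed.\<close>

lemma gram_syzygies:
  fixes x y z u v w d :: "'r::comm_ring_1"
  defines "g3 \<equiv> x*(d-x*u)-v*w" and "g4 \<equiv> y*(d-y*v)-u*w" and "g5 \<equiv> z*(d-z*w)-u*v"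
  assumes 1: "Eb x y z u v w d = 0" "Ec x y z u v w d = 0" "Ebc x y z u v w d = 0"
    and 2: "Eb y z x v w u d = 0" "Ec y z x v w u d = 0" "Ebc y z x v w u d = 0"
    and 3: "Ec z x y w u v d = 0" "Eab z x y w u v d = 0"
    and F: "d*d - gram_det (1-x*x) (1-y*y) (1-z*z) u v w = 0"
  shows "x*u - y*v + x*g3 - y*g4 = 0" "d*g3 = 0" "v*g3 - u*g4 = 0"
    "(1-x*x)*g3 - w*g4 = 0" "(1-x*x)*g3 - v*g5 = 0"
proof -
  note defs = g3_def g4_def g5_def Eb_def Ec_def Ebc_def Eab_def gram_det_def
  have "x*u - y*v + x*g3 - y*g4 = - Ebc y z x v w u d - z * Ec y z x v w u d - x * Eb y z x v w u d
     - Ebc x y z u v w d - z * Eb x y z u v w d - y * Ec x y z u v w d"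
    unfolding defs by (simp add: algebra_simps)
  then show "x*u - y*v + x*g3 - y*g4 = 0" by (simp add: 1 2)
  have "d*g3 = (x*y*z + x*u) * Eb y z x v w u d + x * (d*d - gram_det (1-x*x) (1-y*y) (1-z*z) u v w)
     - Eab z x y w u v d + (u + y*z) * Ebc y z x v w u d + (z*u - y + y*z*z) * Ec y z x v w u d
     + z * Ec x y z u v w d"
    unfolding defs by (simp add: algebra_simps)
  then show "d*g3 = 0" by (simp add: 1 2 3 F)
  have "v*g3 - u*g4 = z * Ebc y z x v w u d + (z*z-1) * Ec y z x v w u d + x*z * Eb y z x v w u d
     + z * Ebc x y z u v w d + (z*z-1) * Eb x y z u v w d + y*z * Ec x y z u v w d"
    unfolding defs by (simp add: algebra_simps)
  then show "v*g3 - u*g4 = 0" by (simp add: 1 2)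
  have "(1-x*x)*g3 - w*g4 = x * Ebc y z x v w u d + x*z * Ec y z x v w u d + x*x * Eb y z x v w u d
     + Ec z x y w u v d + x * Ebc x y z u v w d + x*z * Eb x y z u v w d + x*y * Ec x y z u v w d"
    unfolding defs by (simp add: algebra_simps)
  then show "(1-x*x)*g3 - w*g4 = 0" by (simp add: 1 2 3)
  have "(1-x*x)*g3 - v*g5 = x * Ebc y z x v w u d + x*z * Ec y z x v w u d + (x*x-1) * Eb y z x v w u d"
    unfolding defs by (simp add: algebra_simps)
  then show "(1-x*x)*g3 - v*g5 = 0" by (simp add: 2)
qed

section \<open>Elements of the kernel of the trace map\<close>

interpretation bq: quaternion_coords "kap \<i>" "kap (1/2)"
proof
  show "kap \<i> * kap \<i> = -1" "2 * kap (1/2) = 1"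
    by (simp_all only: rhom_mult[OF rhom_kap, symmetric] rhom_numeral[OF rhom_kap, symmetric])
      (simp_all add: kap_simps)
qed

text \<open>In quaternion coordinates \<open>tu\<close>, \<open>tv\<close>, \<open>tw\<close> become
  4 b.c, 4 a.c, 4 a.b and \<open>tE\<close> becomes -4 det(a, b, c), just as 4 - t_a^2 becomes 4
  a.a. The polynomials \<open>g3\<close>, \<open>g4\<close>, \<open>g5\<close> are the last three
  generators of \<open>I_0\<close>.\<close>

definition tu :: "tvar mpoly" where "tu = tb*tc - 2*tbc"
definition tv :: "tvar mpoly" where "tv = ta*tc - 2*tac"
definition tw :: "tvar mpoly" where "tw = ta*tb - 2*tab"
definition tE :: "tvar mpoly" where "tE = 2*tabc - pP"
definition g3 :: "tvar mpoly" where "g3 = ta*tabc - tab*tac"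
definition g4 :: "tvar mpoly" where "g4 = tb*tabc - tab*tbc"
definition g5 :: "tvar mpoly" where "g5 = tc*tabc - tac*tbc"

lemma tproj_kernel:
  "tproj (tabc^2 - pP*tabc + qQ) = 0"
  "tproj (2*(ta*tbc - tb*tac) - (ta*g3 - tb*g4)) = 0"
  "tproj (2*(tb*tac - tc*tab) - (tb*g4 - tc*g5)) = 0"
  "tproj (tE*g3) = 0" "tproj (tE*g4) = 0" "tproj (tE*g5) = 0"
  "tproj (tv*g3 - tu*g4) = 0" "tproj (tw*g3 - tu*g5) = 0" "tproj (tw*g4 - tv*g5) = 0"
  "tproj ((4-ta*ta)*g3 - tw*g4) = 0" "tproj ((4-tb*tb)*g4 - tw*g3) = 0" "tproj ((4-tc*tc)*g5 - tv*g3) = 0"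
proof -
  obtain x a1 a2 a3 where a: "Xq GA = bq.qmat x a1 a2 a3" using bq.qmat_surj by blast
  obtain y b1 b2 b3 where b: "Xq GB = bq.qmat y b1 b2 b3" using bq.qmat_surj by blast
  obtain z c1 c2 c3 where c: "Xq GC = bq.qmat z c1 c2 c3" using bq.qmat_surj by blast
  define u v w d where u: "u = b1*c1+b2*c2+b3*c3" and v: "v = a1*c1+a2*c2+a3*c3"
    and w: "w = a1*b1+a2*b2+a3*b3" and d: "d = - det3 a1 a2 a3 b1 b2 b3 c1 c2 c3"
  have A: "x * x + (a1 * a1 + a2 * a2 + a3 * a3) = 1" and B: "y * y + (b1 * b1 + b2 * b2 + b3 * b3) = 1"
    and C: "z * z + (c1 * c1 + c2 * c2 + c3 * c3) = 1"
    using mdet_Xq[of GA] mdet_Xq[of GB] mdet_Xq[of GC] by (simp_all only: a b c bq.mdet_qmat)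
  have comm: "u = c1*b1+c2*b2+c3*b3" "v = c1*a1+c2*a2+c3*a3" "w = b1*a1+b2*a2+b3*a3"
    by (simp_all add: u v w mult.commute)
  \<comment> \<open>The determinant is invariant under rotation, so the second and third relators
    are the first one for a rotated triple with the same d.\<close>
  have d2: "d = - det3 b1 b2 b3 c1 c2 c3 a1 a2 a3" "d = - det3 c1 c2 c3 a1 a2 a3 b1 b2 b3"
    using d by (simp_all only: det3_rotate)
  note r1 = bq.relator_gram[OF A B C relators_Xq(1)[unfolded a b c] u v w d]
  note r2 = bq.relator_gram[OF B C A relators_Xq(2)[unfolded a b c] comm(2) comm(3) u d2(1)]
  note r3 = bq.relator_gram[OF C A B relators_Xq(3)[unfolded a b c] w comm(1) comm(2) d2(2)]
  have A': "1 - x * x = a1 * a1 + a2 * a2 + a3 * a3" and B': "1 - y * y = b1 * b1 + b2 * b2 + b3 * b3"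
    and C': "1 - z * z = c1 * c1 + c2 * c2 + c3 * c3"
    using A B C by (simp_all add: algebra_simps)
  have F: "d*d - gram_det (1-x*x) (1-y*y) (1-z*z) u v w = 0"
    unfolding A' B' C' d u v w by (simp add: det3_square)
  have F2: "d*d - gram_det (1-y*y) (1-z*z) (1-x*x) v w u = 0" "d*d - gram_det (1-z*z) (1-x*x) (1-y*y) w u v = 0"
    using F by (simp_all add: gram_det_def algebra_simps)
  note s1 = gram_syzygies[OF r1(1,2,3) r2(1,2,3) r3(2,4) F]
  note s2 = gram_syzygies[OF r2(1,2,3) r3(1,2,3) r1(2,4) F2(1)]
  note s3 = gram_syzygies[OF r3(1,2,3) r1(1,2,3) r2(2,4) F2(2)]
  \<comment> \<open>A trace is twice the scalar part of a quaternion; the scalar part of abc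
    contains - det(a, b, c), whence the sign of d.\<close>
  have t: "tproj ta = 2*x" "tproj tb = 2*y" "tproj tc = 2*z" "tproj tab = 2*(x*y-w)"
      "tproj tac = 2*(x*z-v)" "tproj tbc = 2*(y*z-u)" "tproj tabc = 2*(x*y*z - z*w - x*u - y*v + d)"
    unfolding tproj_traces a b c bq.mmul_qmat bq.mtr_qmat u v w d det3_def
    by (simp_all add: algebra_simps)
  have P: "tproj pP = 4*(x*y*z - x*u - y*v - z*w)"
    unfolding pP_def by (simp add: tproj_simps t algebra_simps)
  have T: "tproj tu = 4*u" "tproj tv = 4*v" "tproj tw = 4*w" "tproj tE = 4*d"
    unfolding tu_def tv_def tw_def tE_def by (simp_all add: tproj_simps t P algebra_simps)
  have G: "tproj g3 = 4*(x*(d-x*u)-v*w)" "tproj g4 = 4*(y*(d-y*v)-u*w)" "tproj g5 = 4*(z*(d-z*w)-u*v)"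
    unfolding g3_def g4_def g5_def by (simp_all add: tproj_simps t algebra_simps)
  have "tproj (tabc^2 - pP*tabc + qQ) = 4 * (d*d - gram_det (1-x*x) (1-y*y) (1-z*z) u v w)"
    unfolding qQ_def gram_det_def by (simp add: tproj_simps t P power2_eq_square algebra_simps)
  then show "tproj (tabc^2 - pP*tabc + qQ) = 0" by (simp add: F)
  have "tproj (2*(ta*tbc - tb*tac) - (ta*g3 - tb*g4)) =
      - 8 * (x*u - y*v + x*(x*(d-x*u)-v*w) - y*(y*(d-y*v)-u*w))"
    by (simp add: tproj_simps t G algebra_simps)
  then show "tproj (2*(ta*tbc - tb*tac) - (ta*g3 - tb*g4)) = 0" by (simp only: s1) simp
  have "tproj (2*(tb*tac - tc*tab) - (tb*g4 - tc*g5)) =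
      - 8 * (y*v - z*w + y*(y*(d-y*v)-w*u) - z*(z*(d-z*w)-v*u))"
    by (simp add: tproj_simps t G algebra_simps)
  then show "tproj (2*(tb*tac - tc*tab) - (tb*g4 - tc*g5)) = 0" by (simp only: s2) simp
  have "tproj (tE*g3) = 16 * (d * (x*(d-x*u)-v*w))" "tproj (tE*g4) = 16 * (d * (y*(d-y*v)-w*u))"
    "tproj (tE*g5) = 16 * (d * (z*(d-z*w)-u*v))"
    by (simp_all add: tproj_simps T G algebra_simps)
  then show "tproj (tE*g3) = 0" "tproj (tE*g4) = 0" "tproj (tE*g5) = 0" by (simp_all only: s1 s2 s3) simp_all
  have "tproj (tv*g3 - tu*g4) = 16 * (v*(x*(d-x*u)-v*w) - u*(y*(d-y*v)-u*w))"
    "tproj (tw*g4 - tv*g5) = 16 * (w*(y*(d-y*v)-w*u) - v*(z*(d-z*w)-v*u))"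
    "tproj (tw*g3 - tu*g5) = - 16 * (u*(z*(d-z*w)-u*v) - w*(x*(d-x*u)-w*v))"
    by (simp_all add: tproj_simps T G algebra_simps)
  then show "tproj (tv*g3 - tu*g4) = 0" "tproj (tw*g3 - tu*g5) = 0" "tproj (tw*g4 - tv*g5) = 0"
    by (simp_all only: s1 s2 s3) simp_all
  have "tproj ((4-ta*ta)*g3 - tw*g4) = 16 * ((1-x*x)*(x*(d-x*u)-v*w) - w*(y*(d-y*v)-u*w))"
    "tproj ((4-tb*tb)*g4 - tw*g3) = 16 * ((1-y*y)*(y*(d-y*v)-w*u) - w*(x*(d-x*u)-v*w))"
    "tproj ((4-tc*tc)*g5 - tv*g3) = 16 * ((1-z*z)*(z*(d-z*w)-u*v) - v*(x*(d-x*u)-w*v))"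
    by (simp_all add: tproj_simps t T G algebra_simps)
  then show "tproj ((4-ta*ta)*g3 - tw*g4) = 0" "tproj ((4-tb*tb)*g4 - tw*g3) = 0"
      "tproj ((4-tc*tc)*g5 - tv*g3) = 0"
    using s1(4) s2(5) s3(4) by (simp_all only: mult.commute[of w v] mult.commute[of w u] mult_zero_right)
qed

section \<open>Points of the character scheme\<close>

interpretation cq: quaternion_coords "\<i>" "1/2 :: complex"
  by standard simp_all

text \<open>The character of a triple with scalar parts x, y, z, inner products u = b.c, v = a.c, w
  = a.b and d = - det(a, b, c).\<close>

definition gpt :: "complex \<Rightarrow> complex \<Rightarrow> complex \<Rightarrow> complex \<Rightarrow> complex \<Rightarrow> complex \<Rightarrow> complex \<Rightarrow> tvar \<Rightarrow> complex" where
  "gpt x y z u v w d t = (case t of Ta \<Rightarrow> 2*x | Tb \<Rightarrow> 2*y | Tc \<Rightarrow> 2*z | Tab \<Rightarrow> 2*(x*y-w)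
     | Tac \<Rightarrow> 2*(x*z-v) | Tbc \<Rightarrow> 2*(y*z-u) | Tabc \<Rightarrow> 2*(x*y*z - z*w - x*u - y*v + d))"

lemma gpt_simps [simp]:
  "gpt x y z u v w d Ta = 2*x" "gpt x y z u v w d Tb = 2*y" "gpt x y z u v w d Tc = 2*z"
  "gpt x y z u v w d Tab = 2*(x*y-w)" "gpt x y z u v w d Tac = 2*(x*z-v)" "gpt x y z u v w d Tbc = 2*(y*z-u)"
  "gpt x y z u v w d Tabc = 2*(x*y*z - z*w - x*u - y*v + d)"
  by (simp_all add: gpt_def)

lemma ev_gpt_representation:
  assumes A: "x * x + (a1 * a1 + a2 * a2 + a3 * a3) = 1" and B: "y * y + (b1 * b1 + b2 * b2 + b3 * b3) = 1"
    and C: "z * z + (c1 * c1 + c2 * c2 + c3 * c3) = 1"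
    and r1: "mcomm (cq.qmat x a1 a2 a3) (mcomm (cq.qmat y b1 b2 b3) (madj (cq.qmat z c1 c2 c3))) = mid"
    and r2: "mcomm (cq.qmat y b1 b2 b3) (mcomm (cq.qmat z c1 c2 c3) (madj (cq.qmat x a1 a2 a3))) = mid"
    and r3: "mcomm (cq.qmat z c1 c2 c3) (mcomm (cq.qmat x a1 a2 a3) (madj (cq.qmat y b1 b2 b3))) = mid"
    and p: "tproj p = 0"
  shows "ev (gpt x y z (b1*c1+b2*c2+b3*c3) (a1*c1+a2*c2+a3*c3) (a1*b1+a2*b2+a3*b3)
     (- det3 a1 a2 a3 b1 b2 b3 c1 c2 c3)) p = 0"
proof -
  define M where "M g = (case g of GA \<Rightarrow> cq.qmat x a1 a2 a3 | GB \<Rightarrow> cq.qmat y b1 b2 b3 | GC \<Rightarrow> cq.qmat z c1 c2 c3)" for g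
  have M: "M GA = cq.qmat x a1 a2 a3" "M GB = cq.qmat y b1 b2 b3" "M GC = cq.qmat z c1 c2 c3"
    by (simp_all add: M_def)
  let ?f = "ev (\<lambda>(g, i, j). M g i j)"
  have Xm: "mmap ?f (Xm g) = M g" for g
    by (simp add: mmap_def Xm_def)
  have tr: "?f (trace_map v) = gpt x y z (b1*c1+b2*c2+b3*c3) (a1*c1+a2*c2+a3*c3) (a1*b1+a2*b2+a3*b3)
     (- det3 a1 a2 a3 b1 b2 b3 c1 c2 c3) v" for v
    by (cases v) (simp_all add: trace_map_def mtr_mmap[OF rhom_ev, symmetric] mmap_mmul[OF rhom_ev] Xm M
        cq.mmul_qmat cq.mtr_qmat det3_def algebra_simps)
  have "msubst trace_map p \<in> J_Bor" using p by (simp add: tproj_def proj_eq_zero_iff)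
  moreover have "mdet (M g) = 1" for g
    using A B C by (cases g) (simp_all add: M cq.mdet_qmat)
  ultimately have "?f (msubst trace_map p) = 0"
    using r1 r2 r3 by (intro J_Bor_kernel[OF rhom_ev]) (simp_all add: Xm M)
  then show ?thesis by (simp add: ev_msubst tr)
qed

text \<open>Density of a nonempty principal open set: it is enough to treat generic points, at which
  the denominators that occur do not vanish.\<close>

lemma mpoly_zero_off:
  fixes p q :: "'v mpoly"
  assumes "ev \<tau> q \<noteq> 0" "\<And>\<sigma>. ev \<sigma> q \<noteq> 0 \<Longrightarrow> ev \<sigma> p = 0"
  shows "p = 0"
proof -
  have "ev \<sigma> (p * q) = 0" for \<sigma>
    using assms(2)[of \<sigma>] by (auto simp: rhom_mult[OF rhom_ev])
  then have "p * q = 0" by (rule ev_all_zero_imp_zero)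
  moreover have "q \<noteq> 0" using assms(1) by (auto simp: ev_simps)
  ultimately show ?thesis using mpoly_no_zero_divisors by blast
qed

section \<open>The six components isomorphic to affine space\<close>

text \<open>Modulo the ideal, \<iota> is inverse to \<sigma>, so p is congruent to its image under
  both, and the ideal is the kernel of a surjection onto a polynomial ring, which is a
  domain.\<close>

lemma retract_ideal:
  fixes \<sigma> :: "tvar \<Rightarrow> gen mpoly" and \<iota> :: "gen \<Rightarrow> tvar mpoly"
  assumes "\<And>g. g \<in> S \<Longrightarrow> msubst \<sigma> g = 0" "\<And>v. mVar v - msubst \<iota> (\<sigma> v) \<in> gen_ideal S"
    and \<iota>: "\<And>g. msubst \<sigma> (\<iota> g) = mVar g"
  shows retract_ideal_kernel: "p \<in> gen_ideal S \<longleftrightarrow> msubst \<sigma> p = 0"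
    and retract_ideal_surj: "surj (msubst \<sigma>)"
    and retract_ideal_prime: "is_prime_ideal (gen_ideal S)"
proof -
  have sub: "gen_ideal S \<subseteq> {p. msubst \<sigma> p = 0}"
    by (rule gen_ideal_least[OF is_ideal_kernel[OF rhom_msubst]]) (use assms(1) in auto)
  have "p - msubst \<iota> (msubst \<sigma> p) \<in> gen_ideal S" for p
    by (rule rhom_cong_mod_ideal[OF is_ideal_gen_ideal rhom_id rhom_comp[OF rhom_msubst rhom_msubst]])
      (simp_all add: assms(2))
  from this have iff: "p \<in> gen_ideal S \<longleftrightarrow> msubst \<sigma> p = 0" for p
    using sub by (auto simp: rhom_zero[OF rhom_msubst]) (metis diff_zero rhom_zero[OF rhom_msubst])
  then show "p \<in> gen_ideal S \<longleftrightarrow> msubst \<sigma> p = 0" .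
  have "msubst \<sigma> (msubst \<iota> q) = q" for q
    by (rule rhom_eqI[OF rhom_comp[OF rhom_msubst rhom_msubst] rhom_id]) (simp_all add: \<iota>)
  then show "surj (msubst \<sigma>)" by (metis surjI)
  have "is_prime_ideal {p. msubst \<sigma> p \<in> {0}}"
    by (rule is_prime_ideal_vimage[OF rhom_msubst])
      (auto simp: is_ideal_def dest: mpoly_no_zero_divisors)
  moreover have "{p. msubst \<sigma> p \<in> {0}} = gen_ideal S" using iff by auto
  ultimately show "is_prime_ideal (gen_ideal S)" by simp
qed

text \<open>GA, GB, GC here only label three free coordinates: GA stands for t_bc in
  \<open>sub_a\<close>, GB for t_ac in \<open>sub_b\<close>, GC for t_ab in
  \<open>sub_c\<close>.\<close>

definition sub_a :: "complex \<Rightarrow> tvar \<Rightarrow> gen mpoly" where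
  "sub_a s t = (case t of Ta \<Rightarrow> mConst (2*s) | Tb \<Rightarrow> mVar GB | Tc \<Rightarrow> mVar GC | Tab \<Rightarrow> mConst s * mVar GB
     | Tac \<Rightarrow> mConst s * mVar GC | Tbc \<Rightarrow> mVar GA | Tabc \<Rightarrow> mConst s * mVar GA)"

definition sub_b :: "complex \<Rightarrow> tvar \<Rightarrow> gen mpoly" where
  "sub_b s t = (case t of Ta \<Rightarrow> mVar GA | Tb \<Rightarrow> mConst (2*s) | Tc \<Rightarrow> mVar GC | Tab \<Rightarrow> mConst s * mVar GA
     | Tac \<Rightarrow> mVar GB | Tbc \<Rightarrow> mConst s * mVar GC | Tabc \<Rightarrow> mConst s * mVar GB)"

definition sub_c :: "complex \<Rightarrow> tvar \<Rightarrow> gen mpoly" where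
  "sub_c s t = (case t of Ta \<Rightarrow> mVar GA | Tb \<Rightarrow> mVar GB | Tc \<Rightarrow> mConst (2*s) | Tab \<Rightarrow> mVar GC
     | Tac \<Rightarrow> mConst s * mVar GA | Tbc \<Rightarrow> mConst s * mVar GB | Tabc \<Rightarrow> mConst s * mVar GC)"

lemma I_a_facts:
  shows I_a_iff: "p \<in> I_a s \<longleftrightarrow> msubst (sub_a s) p = 0" and surj_sub_a: "surj (msubst (sub_a s))"
    and I_a_prime: "is_prime_ideal (I_a s)"
proof -
  let ?S = "{ta - mConst (2*s), tab - mConst s * tb, tac - mConst s * tc, tabc - mConst s * tbc}"
  let ?i = "\<lambda>g. case g of GA \<Rightarrow> tbc | GB \<Rightarrow> tb | GC \<Rightarrow> tc"
  have 1: "msubst (sub_a s) g = 0" if "g \<in> ?S" for g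
    using that by (auto simp: msubst_simps sub_a_def)
  have 2: "mVar v - msubst ?i (sub_a s v) \<in> gen_ideal ?S" for v
    by (cases v) (simp_all add: sub_a_def msubst_simps is_ideal_zero[OF is_ideal_gen_ideal] gen_ideal_mem)
  have 3: "msubst (sub_a s) (?i g) = mVar g" for g
    by (cases g) (simp_all add: sub_a_def)
  note r = retract_ideal[where S = ?S and \<iota> = ?i, OF 1 2 3, folded I_a_def]
  show "p \<in> I_a s \<longleftrightarrow> msubst (sub_a s) p = 0" by (rule r(1))
  show "surj (msubst (sub_a s))" by (rule r(2))
  show "is_prime_ideal (I_a s)" by (rule r(3))
qed

lemma I_b_facts:
  shows I_b_iff: "p \<in> I_b s \<longleftrightarrow> msubst (sub_b s) p = 0" and surj_sub_b: "surj (msubst (sub_b s))"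
    and I_b_prime: "is_prime_ideal (I_b s)"
proof -
  let ?S = "{tb - mConst (2*s), tab - mConst s * ta, tbc - mConst s * tc, tabc - mConst s * tac}"
  let ?i = "\<lambda>g. case g of GA \<Rightarrow> ta | GB \<Rightarrow> tac | GC \<Rightarrow> tc"
  have 1: "msubst (sub_b s) g = 0" if "g \<in> ?S" for g
    using that by (auto simp: msubst_simps sub_b_def)
  have 2: "mVar v - msubst ?i (sub_b s v) \<in> gen_ideal ?S" for v
    by (cases v) (simp_all add: sub_b_def msubst_simps is_ideal_zero[OF is_ideal_gen_ideal] gen_ideal_mem)
  have 3: "msubst (sub_b s) (?i g) = mVar g" for g
    by (cases g) (simp_all add: sub_b_def)
  note r = retract_ideal[where S = ?S and \<iota> = ?i, OF 1 2 3, folded I_b_def]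
  show "p \<in> I_b s \<longleftrightarrow> msubst (sub_b s) p = 0" by (rule r(1))
  show "surj (msubst (sub_b s))" by (rule r(2))
  show "is_prime_ideal (I_b s)" by (rule r(3))
qed

lemma I_c_facts:
  shows I_c_iff: "p \<in> I_c s \<longleftrightarrow> msubst (sub_c s) p = 0" and surj_sub_c: "surj (msubst (sub_c s))"
    and I_c_prime: "is_prime_ideal (I_c s)"
proof -
  let ?S = "{tc - mConst (2*s), tac - mConst s * ta, tbc - mConst s * tb, tabc - mConst s * tab}"
  let ?i = "\<lambda>g. case g of GA \<Rightarrow> ta | GB \<Rightarrow> tb | GC \<Rightarrow> tab"
  have 1: "msubst (sub_c s) g = 0" if "g \<in> ?S" for g
    using that by (auto simp: msubst_simps sub_c_def)
  have 2: "mVar v - msubst ?i (sub_c s v) \<in> gen_ideal ?S" for v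
    by (cases v) (simp_all add: sub_c_def msubst_simps is_ideal_zero[OF is_ideal_gen_ideal] gen_ideal_mem)
  have 3: "msubst (sub_c s) (?i g) = mVar g" for g
    by (cases g) (simp_all add: sub_c_def)
  note r = retract_ideal[where S = ?S and \<iota> = ?i, OF 1 2 3, folded I_c_def]
  show "p \<in> I_c s \<longleftrightarrow> msubst (sub_c s) p = 0" by (rule r(1))
  show "surj (msubst (sub_c s))" by (rule r(2))
  show "is_prime_ideal (I_c s)" by (rule r(3))
qed

text \<open>Plane vectors (b1, 0) and (c1, c2) with given squares and inner product. The first must
  not be isotropic, since c1 = u / b1.\<close>

lemma vectors_with_gram2:
  fixes y z u :: complex
  assumes "y * y \<noteq> 1"
  shows "\<exists>b1 c1 c2. b1 * b1 = 1 - y * y \<and> b1 * c1 = u \<and> c1 * c1 + c2 * c2 = 1 - z * z"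
proof -
  define b1 where "b1 = csqrt (1 - y * y)"
  have b: "b1 * b1 = 1 - y * y" using power2_csqrt[of "1 - y * y"] by (simp add: b1_def power2_eq_square)
  then have "b1 \<noteq> 0" using assms by auto
  then have "b1 * (u / b1) = u" by simp
  moreover have "(u / b1) * (u / b1) + csqrt (1 - z * z - (u / b1) * (u / b1)) * csqrt (1 - z * z - (u / b1) * (u / b1)) = 1 - z * z"
    using power2_csqrt[of "1 - z * z - (u / b1) * (u / b1)"] by (simp add: power2_eq_square)
  ultimately show ?thesis using b by blast
qed

lemma square_one: "s = 1 \<or> s = -1 \<Longrightarrow> s * s = (1::complex)"
  by auto

text \<open>If a is sent to the central matrix s, the relators hold for all b and c, and plane
  vectors realise a generic choice of t_b, t_c, t_bc.\<close>

lemma kernel_subset_I_a: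
  assumes "tproj p = 0" "s = 1 \<or> s = -1"
  shows "p \<in> I_a s"
  unfolding I_a_iff
proof (rule mpoly_zero_off)
  show "ev (\<lambda>_. 0) (mVar GB * mVar GB - 4) \<noteq> 0" by (simp add: ev_simps)
  fix \<sigma> :: "gen \<Rightarrow> complex" assume "ev \<sigma> (mVar GB * mVar GB - 4) \<noteq> 0"
  then have "(\<sigma> GB / 2) * (\<sigma> GB / 2) \<noteq> 1" by (simp add: ev_simps)
  from vectors_with_gram2[OF this, of "\<sigma> GB / 2 * (\<sigma> GC / 2) - \<sigma> GA / 2" "\<sigma> GC / 2"]
  obtain b1 c1 c2 where b: "b1 * b1 = 1 - \<sigma> GB / 2 * (\<sigma> GB / 2)"
    "b1 * c1 = \<sigma> GB / 2 * (\<sigma> GC / 2) - \<sigma> GA / 2" "c1 * c1 + c2 * c2 = 1 - \<sigma> GC / 2 * (\<sigma> GC / 2)" by blast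
  have "ev (gpt s (\<sigma> GB / 2) (\<sigma> GC / 2) (b1*c1+0*c2+0*0) (0*c1+0*c2+0*0) (0*b1+0*0+0*0)
     (- det3 0 0 0 b1 0 0 c1 c2 0)) p = 0"
  proof (rule ev_gpt_representation[OF _ _ _ _ _ _ assms(1)])
    show N: "s * s + (0 * 0 + 0 * 0 + 0 * 0) = 1" "\<sigma> GB / 2 * (\<sigma> GB / 2) + (b1 * b1 + 0 * 0 + 0 * 0) = 1"
      "\<sigma> GC / 2 * (\<sigma> GC / 2) + (c1 * c1 + c2 * c2 + 0 * 0) = 1"
      using square_one[OF assms(2)] b by (simp_all add: algebra_simps)
    show "mcomm (cq.qmat s 0 0 0) (mcomm (cq.qmat (\<sigma> GB / 2) b1 0 0) (madj (cq.qmat (\<sigma> GC / 2) c1 c2 0))) = mid"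
      by (simp add: cq.relator_iff[OF N])
    show "mcomm (cq.qmat (\<sigma> GB / 2) b1 0 0) (mcomm (cq.qmat (\<sigma> GC / 2) c1 c2 0) (madj (cq.qmat s 0 0 0))) = mid"
      by (simp add: cq.relator_iff[OF N(2,3,1)] cq.commvec_def)
    show "mcomm (cq.qmat (\<sigma> GC / 2) c1 c2 0) (mcomm (cq.qmat s 0 0 0) (madj (cq.qmat (\<sigma> GB / 2) b1 0 0))) = mid"
      by (simp add: cq.relator_iff[OF N(3,1,2)] cq.commvec_def)
  qed
  moreover have "(\<lambda>v. ev \<sigma> (sub_a s v)) = gpt s (\<sigma> GB / 2) (\<sigma> GC / 2) (b1*c1+0*c2+0*0) (0*c1+0*c2+0*0) (0*b1+0*0+0*0)
     (- det3 0 0 0 b1 0 0 c1 c2 0)"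
  proof
    show "ev \<sigma> (sub_a s v) = gpt s (\<sigma> GB / 2) (\<sigma> GC / 2) (b1*c1+0*c2+0*0) (0*c1+0*c2+0*0) (0*b1+0*0+0*0)
     (- det3 0 0 0 b1 0 0 c1 c2 0) v" for v
      by (cases v) (simp_all add: sub_a_def ev_simps b det3_def algebra_simps)
  qed
  ultimately show "ev \<sigma> (msubst (sub_a s) p) = 0" by (simp only: ev_msubst)
qed

lemma kernel_subset_I_b:
  assumes "tproj p = 0" "s = 1 \<or> s = -1"
  shows "p \<in> I_b s"
  unfolding I_b_iff
proof (rule mpoly_zero_off)
  show "ev (\<lambda>_. 0) (mVar GA * mVar GA - 4) \<noteq> 0" by (simp add: ev_simps)
  fix \<sigma> :: "gen \<Rightarrow> complex" assume "ev \<sigma> (mVar GA * mVar GA - 4) \<noteq> 0"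
  then have "(\<sigma> GA / 2) * (\<sigma> GA / 2) \<noteq> 1" by (simp add: ev_simps)
  from vectors_with_gram2[OF this, of "\<sigma> GA / 2 * (\<sigma> GC / 2) - \<sigma> GB / 2" "\<sigma> GC / 2"]
  obtain a1 c1 c2 where b: "a1 * a1 = 1 - \<sigma> GA / 2 * (\<sigma> GA / 2)"
    "a1 * c1 = \<sigma> GA / 2 * (\<sigma> GC / 2) - \<sigma> GB / 2" "c1 * c1 + c2 * c2 = 1 - \<sigma> GC / 2 * (\<sigma> GC / 2)" by blast
  have "ev (gpt (\<sigma> GA / 2) s (\<sigma> GC / 2) (0*c1+0*c2+0*0) (a1*c1+0*c2+0*0) (a1*0+0*0+0*0)
     (- det3 a1 0 0 0 0 0 c1 c2 0)) p = 0"
  proof (rule ev_gpt_representation[OF _ _ _ _ _ _ assms(1)])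
    show N: "\<sigma> GA / 2 * (\<sigma> GA / 2) + (a1 * a1 + 0 * 0 + 0 * 0) = 1" "s * s + (0 * 0 + 0 * 0 + 0 * 0) = 1"
      "\<sigma> GC / 2 * (\<sigma> GC / 2) + (c1 * c1 + c2 * c2 + 0 * 0) = 1"
      using square_one[OF assms(2)] b by (simp_all add: algebra_simps)
    show "mcomm (cq.qmat (\<sigma> GA / 2) a1 0 0) (mcomm (cq.qmat s 0 0 0) (madj (cq.qmat (\<sigma> GC / 2) c1 c2 0))) = mid"
      by (simp add: cq.relator_iff[OF N] cq.commvec_def)
    show "mcomm (cq.qmat s 0 0 0) (mcomm (cq.qmat (\<sigma> GC / 2) c1 c2 0) (madj (cq.qmat (\<sigma> GA / 2) a1 0 0))) = mid"
      by (simp add: cq.relator_iff[OF N(2,3,1)])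
    show "mcomm (cq.qmat (\<sigma> GC / 2) c1 c2 0) (mcomm (cq.qmat (\<sigma> GA / 2) a1 0 0) (madj (cq.qmat s 0 0 0))) = mid"
      by (simp add: cq.relator_iff[OF N(3,1,2)] cq.commvec_def)
  qed
  moreover have "(\<lambda>v. ev \<sigma> (sub_b s v)) = gpt (\<sigma> GA / 2) s (\<sigma> GC / 2) (0*c1+0*c2+0*0) (a1*c1+0*c2+0*0) (a1*0+0*0+0*0)
     (- det3 a1 0 0 0 0 0 c1 c2 0)"
  proof
    show "ev \<sigma> (sub_b s v) = gpt (\<sigma> GA / 2) s (\<sigma> GC / 2) (0*c1+0*c2+0*0) (a1*c1+0*c2+0*0) (a1*0+0*0+0*0)
     (- det3 a1 0 0 0 0 0 c1 c2 0) v" for v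
      by (cases v) (simp_all add: sub_b_def ev_simps b det3_def algebra_simps)
  qed
  ultimately show "ev \<sigma> (msubst (sub_b s) p) = 0" by (simp only: ev_msubst)
qed

lemma kernel_subset_I_c:
  assumes "tproj p = 0" "s = 1 \<or> s = -1"
  shows "p \<in> I_c s"
  unfolding I_c_iff
proof (rule mpoly_zero_off)
  show "ev (\<lambda>_. 0) (mVar GA * mVar GA - 4) \<noteq> 0" by (simp add: ev_simps)
  fix \<sigma> :: "gen \<Rightarrow> complex" assume "ev \<sigma> (mVar GA * mVar GA - 4) \<noteq> 0"
  then have "(\<sigma> GA / 2) * (\<sigma> GA / 2) \<noteq> 1" by (simp add: ev_simps)
  from vectors_with_gram2[OF this, of "\<sigma> GA / 2 * (\<sigma> GB / 2) - \<sigma> GC / 2" "\<sigma> GB / 2"]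
  obtain a1 b1 b2 where b: "a1 * a1 = 1 - \<sigma> GA / 2 * (\<sigma> GA / 2)"
    "a1 * b1 = \<sigma> GA / 2 * (\<sigma> GB / 2) - \<sigma> GC / 2" "b1 * b1 + b2 * b2 = 1 - \<sigma> GB / 2 * (\<sigma> GB / 2)" by blast
  have "ev (gpt (\<sigma> GA / 2) (\<sigma> GB / 2) s (b1*0+b2*0+0*0) (a1*0+0*0+0*0) (a1*b1+0*b2+0*0)
     (- det3 a1 0 0 b1 b2 0 0 0 0)) p = 0"
  proof (rule ev_gpt_representation[OF _ _ _ _ _ _ assms(1)])
    show N: "\<sigma> GA / 2 * (\<sigma> GA / 2) + (a1 * a1 + 0 * 0 + 0 * 0) = 1"
      "\<sigma> GB / 2 * (\<sigma> GB / 2) + (b1 * b1 + b2 * b2 + 0 * 0) = 1" "s * s + (0 * 0 + 0 * 0 + 0 * 0) = 1"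
      using square_one[OF assms(2)] b by (simp_all add: algebra_simps)
    show "mcomm (cq.qmat (\<sigma> GA / 2) a1 0 0) (mcomm (cq.qmat (\<sigma> GB / 2) b1 b2 0) (madj (cq.qmat s 0 0 0))) = mid"
      by (simp add: cq.relator_iff[OF N] cq.commvec_def)
    show "mcomm (cq.qmat (\<sigma> GB / 2) b1 b2 0) (mcomm (cq.qmat s 0 0 0) (madj (cq.qmat (\<sigma> GA / 2) a1 0 0))) = mid"
      by (simp add: cq.relator_iff[OF N(2,3,1)] cq.commvec_def)
    show "mcomm (cq.qmat s 0 0 0) (mcomm (cq.qmat (\<sigma> GA / 2) a1 0 0) (madj (cq.qmat (\<sigma> GB / 2) b1 b2 0))) = mid"
      by (simp add: cq.relator_iff[OF N(3,1,2)])
  qed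
  moreover have "(\<lambda>v. ev \<sigma> (sub_c s v)) = gpt (\<sigma> GA / 2) (\<sigma> GB / 2) s (b1*0+b2*0+0*0) (a1*0+0*0+0*0) (a1*b1+0*b2+0*0)
     (- det3 a1 0 0 b1 b2 0 0 0 0)"
  proof
    show "ev \<sigma> (sub_c s v) = gpt (\<sigma> GA / 2) (\<sigma> GB / 2) s (b1*0+b2*0+0*0) (a1*0+0*0+0*0) (a1*b1+0*b2+0*0)
     (- det3 a1 0 0 b1 b2 0 0 0 0) v" for v
      by (cases v) (simp_all add: sub_c_def ev_simps b det3_def algebra_simps)
  qed
  ultimately show "ev \<sigma> (msubst (sub_c s) p) = 0" by (simp only: ev_msubst)
qed

section \<open>The component of abelian characters\<close>

text \<open>Three circles, that is, a torus of triples of commuting quaternions x + a i, y + b i, z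
  + c i; \<open>abelpt\<close> is the character of such a triple.\<close>

definition on_torus :: "complex \<Rightarrow> complex \<Rightarrow> complex \<Rightarrow> complex \<Rightarrow> complex \<Rightarrow> complex \<Rightarrow> bool" where
  "on_torus x y z a b c \<longleftrightarrow> x*x + a*a = 1 \<and> y*y + b*b = 1 \<and> z*z + c*c = 1"

definition abelpt :: "complex \<Rightarrow> complex \<Rightarrow> complex \<Rightarrow> complex \<Rightarrow> complex \<Rightarrow> complex \<Rightarrow> tvar \<Rightarrow> complex" where
  "abelpt x y z a b c = gpt x y z (b*c) (a*c) (a*b) 0"

lemma I_ns_subset_vanishing:
  assumes "p \<in> I_ns" "on_torus x y z a b c"
  shows "ev (abelpt x y z a b c) p = 0"
proof -
  have a: "a*a = 1 - x*x" "b*b = 1 - y*y" "c*c = 1 - z*z"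
    using assms(2) by (auto simp: on_torus_def algebra_simps)
  have a': "a*(a*t) = t - x*x*t" "b*(b*t) = t - y*y*t" "c*(c*t) = t - z*z*t" for t
    using a by (simp_all add: mult.assoc[symmetric] left_diff_distrib)
  have "I_ns \<subseteq> {p. ev (abelpt x y z a b c) p = 0}"
    unfolding I_ns_def
    by (rule gen_ideal_least[OF is_ideal_kernel[OF rhom_ev]])
      (simp add: ev_simps abelpt_def pP_def power2_eq_square algebra_simps a a')
  with assms(1) show ?thesis by blast
qed

text \<open>Up to numerical factors, the first six generators are the 2 x 2 minors of the Gram
  matrix with diagonal 4 - t_a^2, 4 - t_b^2, 4 - t_c^2: the vectors a, b, c are parallel.\<close>

lemma I_ns_gram:
  "tE \<in> I_ns"
  "(4-tb*tb)*(4-tc*tc) - tu*tu \<in> I_ns" "(4-ta*ta)*(4-tc*tc) - tv*tv \<in> I_ns" "(4-ta*ta)*(4-tb*tb) - tw*tw \<in> I_ns"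
  "(4-ta*ta)*tu - tv*tw \<in> I_ns" "(4-tb*tb)*tv - tu*tw \<in> I_ns" "(4-tc*tc)*tw - tu*tv \<in> I_ns"
proof -
  note I = is_ideal_gen_ideal[of "{ta^2 + tb^2 + tab^2 - ta*tb*tab - 4,
      ta^2 + tc^2 + tac^2 - ta*tc*tac - 4,
      tb^2 + tc^2 + tbc^2 - tb*tc*tbc - 4,
      ta*pP - 2*tab*tac - 4*tbc + 2*tb*tc,
      tb*pP - 2*tab*tbc - 4*tac + 2*ta*tc,
      tc*pP - 2*tac*tbc - 4*tab + 2*ta*tb,
      2*tabc - pP}", folded I_ns_def]
  have mem: "ta^2 + tb^2 + tab^2 - ta*tb*tab - 4 \<in> I_ns" "ta^2 + tc^2 + tac^2 - ta*tc*tac - 4 \<in> I_ns"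
      "tb^2 + tc^2 + tbc^2 - tb*tc*tbc - 4 \<in> I_ns" "ta*pP - 2*tab*tac - 4*tbc + 2*tb*tc \<in> I_ns"
      "tb*pP - 2*tab*tbc - 4*tac + 2*ta*tc \<in> I_ns" "tc*pP - 2*tac*tbc - 4*tab + 2*ta*tb \<in> I_ns"
      "2*tabc - pP \<in> I_ns"
    unfolding I_ns_def by (rule gen_ideal_mem, simp)+
  note m = mem[THEN is_ideal_mult[OF I]]
  show "tE \<in> I_ns" using mem(7) by (simp add: tE_def)
  show "(4-tb*tb)*(4-tc*tc) - tu*tu \<in> I_ns"
    using m(3)[of "-4"] by (simp add: tu_def power2_eq_square algebra_simps)
  show "(4-ta*ta)*(4-tc*tc) - tv*tv \<in> I_ns"
    using m(2)[of "-4"] by (simp add: tv_def power2_eq_square algebra_simps)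
  show "(4-ta*ta)*(4-tb*tb) - tw*tw \<in> I_ns"
    using m(1)[of "-4"] by (simp add: tw_def power2_eq_square algebra_simps)
  show "(4-ta*ta)*tu - tv*tw \<in> I_ns"
    using m(4)[of 2] by (simp add: tu_def tv_def tw_def pP_def algebra_simps)
  show "(4-tb*tb)*tv - tu*tw \<in> I_ns"
    using m(5)[of 2] by (simp add: tu_def tv_def tw_def pP_def algebra_simps)
  show "(4-tc*tc)*tw - tu*tv \<in> I_ns"
    using m(6)[of 2] by (simp add: tu_def tv_def tw_def pP_def algebra_simps)
qed

lemma is_ideal_I_ns: "is_ideal I_ns"
  unfolding I_ns_def by (rule is_ideal_gen_ideal)

section \<open>Normal forms modulo \<open>I_ns\<close>\<close>

definition emb :: "gen mpoly \<Rightarrow> tvar mpoly" where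
  "emb = msubst (\<lambda>g. case g of GA \<Rightarrow> ta | GB \<Rightarrow> tb | GC \<Rightarrow> tc)"

lemma rhom_emb: "rhom emb"
  unfolding emb_def by (rule rhom_msubst)

lemma emb_simps [simp]: "emb (mVar GA) = ta" "emb (mVar GB) = tb" "emb (mVar GC) = tc" "emb (mConst c) = mConst c"
  by (simp_all add: emb_def)

lemmas emb_rhom = rhom_simps[OF rhom_emb]

text \<open>Modulo \<open>I_ns\<close> everything is a combination of 1, \<open>tu\<close>,
  \<open>tv\<close>, \<open>tw\<close> over the polynomials in t_a, t_b, t_c.\<close>

definition ns_normal :: "tvar mpoly \<Rightarrow> bool" where
  "ns_normal p \<longleftrightarrow> (\<exists>q0 q1 q2 q3. p - (emb q0 + emb q1 * tu + emb q2 * tv + emb q3 * tw) \<in> I_ns)"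

lemma ns_normalI: "p - (emb q0 + emb q1 * tu + emb q2 * tv + emb q3 * tw) \<in> I_ns \<Longrightarrow> ns_normal p"
  unfolding ns_normal_def by blast

lemma ns_normal_all: "ns_normal p"
proof (induction p rule: mpoly_induct)
  case (const a)
  show ?case by (rule ns_normalI[of _ "mConst a" 0 0 0]) (simp add: emb_rhom is_ideal_zero[OF is_ideal_I_ns])
next
  case (var v)
  have half: "mConst (1/2) * (2 * p) = p" for p :: "tvar mpoly"
  proof -
    have "mConst (1/2) * (2 * p) = mConst (1/2) * mConst 2 * p" by (simp add: mConst_simps)
    also have "\<dots> = p" unfolding rhom_mult[OF rhom_mConst, symmetric] by (simp add: mConst_simps)
    finally show ?thesis .
  qed
  have halfd: "mConst (1/2) * (p - 2 * q) = mConst (1/2) * p - q" for p q :: "tvar mpoly"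
    by (simp only: right_diff_distrib half)
  have "4 * mConst (1/4) = (1 :: tvar mpoly)"
    unfolding rhom_numeral[OF rhom_mConst, symmetric] rhom_mult[OF rhom_mConst, symmetric] by (simp add: mConst_simps)
  show ?case
  proof (cases v)
    case Tab
    show ?thesis by (rule ns_normalI[of _ "mConst (1/2) * (mVar GA * mVar GB)" 0 0 "- mConst (1/2)"])
      (simp add: Tab emb_rhom tw_def halfd is_ideal_zero[OF is_ideal_I_ns])
  next
    case Tac
    show ?thesis by (rule ns_normalI[of _ "mConst (1/2) * (mVar GA * mVar GC)" 0 "- mConst (1/2)" 0])
      (simp add: Tac emb_rhom tv_def halfd is_ideal_zero[OF is_ideal_I_ns])
  next
    case Tbc
    show ?thesis by (rule ns_normalI[of _ "mConst (1/2) * (mVar GB * mVar GC)" "- mConst (1/2)" 0 0])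
      (simp add: Tbc emb_rhom tu_def halfd is_ideal_zero[OF is_ideal_I_ns])
  next
    case Tabc
    let ?k = "mConst (1/4)"
    have e: "4 * (tabc - (?k * (ta*tb*tc) + (- (?k * ta)) * tu + (- (?k * tb)) * tv + (- (?k * tc)) * tw)) = 2 * tE"
    proof -
      have "4 * (tabc - (?k * (ta*tb*tc) + (- (?k * ta)) * tu + (- (?k * tb)) * tv + (- (?k * tc)) * tw))
        = 4 * tabc - (4 * ?k) * (ta*tb*tc - ta * tu - tb * tv - tc * tw)"
        by (simp add: algebra_simps)
      then show ?thesis unfolding \<open>4 * mConst (1/4) = 1\<close>
        by (simp add: tE_def pP_def tu_def tv_def tw_def algebra_simps)
    qed
    have "tabc - (?k * (ta*tb*tc) + (- (?k * ta)) * tu + (- (?k * tb)) * tv + (- (?k * tc)) * tw) \<in> I_ns"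
      by (rule is_ideal_numeral_cancel[OF is_ideal_I_ns, of "num.Bit0 (num.Bit0 num.One)"], unfold e,
          rule is_ideal_mult[OF is_ideal_I_ns I_ns_gram(1)])
    then show ?thesis
      by (intro ns_normalI[of _ "?k * (mVar GA * mVar GB * mVar GC)" "- (?k * mVar GA)" "- (?k * mVar GB)" "- (?k * mVar GC)"])
        (simp add: Tabc emb_rhom)
  next
    case Ta
    show ?thesis by (rule ns_normalI[of _ "mVar GA" 0 0 0]) (simp add: Ta emb_rhom is_ideal_zero[OF is_ideal_I_ns])
  next
    case Tb
    show ?thesis by (rule ns_normalI[of _ "mVar GB" 0 0 0]) (simp add: Tb emb_rhom is_ideal_zero[OF is_ideal_I_ns])
  next
    case Tc
    show ?thesis by (rule ns_normalI[of _ "mVar GC" 0 0 0]) (simp add: Tc emb_rhom is_ideal_zero[OF is_ideal_I_ns])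
  qed
next
  case (add p q)
  then obtain q0 q1 q2 q3 r0 r1 r2 r3 where
    *: "p - (emb q0 + emb q1 * tu + emb q2 * tv + emb q3 * tw) \<in> I_ns"
      "q - (emb r0 + emb r1 * tu + emb r2 * tv + emb r3 * tw) \<in> I_ns"
    unfolding ns_normal_def by blast
  show ?case
    by (rule ns_normalI[of _ "q0 + r0" "q1 + r1" "q2 + r2" "q3 + r3"])
      (use is_ideal_add[OF is_ideal_I_ns *] in \<open>simp add: emb_rhom algebra_simps\<close>)
next
  case (mult p q)
  then obtain q0 q1 q2 q3 r0 r1 r2 r3 where
    *: "p - (emb q0 + emb q1 * tu + emb q2 * tv + emb q3 * tw) \<in> I_ns"
      "q - (emb r0 + emb r1 * tu + emb r2 * tv + emb r3 * tw) \<in> I_ns"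
    unfolding ns_normal_def by blast
  let ?p = "emb q0 + emb q1 * tu + emb q2 * tv + emb q3 * tw"
  let ?q = "emb r0 + emb r1 * tu + emb r2 * tv + emb r3 * tw"
  let ?A = "4 - mVar GA * mVar GA" and ?B = "4 - mVar GB * mVar GB" and ?C = "4 - mVar GC * mVar GC"
  let ?A' = "4-ta*ta" and ?B' = "4-tb*tb" and ?C' = "4-tc*tc"
  note m = I_ns_gram[THEN is_ideal_mult[OF is_ideal_I_ns]]
  have "p * q - ?p * ?q \<in> I_ns"
    using is_ideal_add[OF is_ideal_I_ns is_ideal_mult[OF is_ideal_I_ns *(1), of q] is_ideal_mult[OF is_ideal_I_ns *(2), of ?p]]
    by (simp add: algebra_simps)
  moreover
  \<comment> \<open>The vanishing minors are the multiplication table: tu^2 = (4 - t_b^2)(4 -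
    t_c^2), tu tv = (4 - t_c^2) tw, and so on.\<close>
  have "?p * ?q - (emb (q0*r0 + q1*r1*(?B*?C) + q2*r2*(?A*?C) + q3*r3*(?A*?B))
      + emb (q0*r1 + q1*r0 + (q2*r3 + q3*r2)*?A) * tu + emb (q0*r2 + q2*r0 + (q1*r3 + q3*r1)*?B) * tv
      + emb (q0*r3 + q3*r0 + (q1*r2 + q2*r1)*?C) * tw) =
     - (emb q1*emb r1) * (?B'*?C' - tu*tu) + - (emb q2*emb r2) * (?A'*?C' - tv*tv) + - (emb q3*emb r3) * (?A'*?B' - tw*tw)
     + - (emb q2*emb r3 + emb q3*emb r2) * (?A'*tu - tv*tw) + - (emb q1*emb r3 + emb q3*emb r1) * (?B'*tv - tu*tw)
     + - (emb q1*emb r2 + emb q2*emb r1) * (?C'*tw - tu*tv)"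
    by (simp only: emb_rhom emb_simps) (simp add: algebra_simps)
  moreover have "\<dots> \<in> I_ns"
    by (intro is_ideal_add[OF is_ideal_I_ns] m)
  ultimately have "p * q - ?p * ?q + (?p * ?q - (emb (q0*r0 + q1*r1*(?B*?C) + q2*r2*(?A*?C) + q3*r3*(?A*?B))
      + emb (q0*r1 + q1*r0 + (q2*r3 + q3*r2)*?A) * tu + emb (q0*r2 + q2*r0 + (q1*r3 + q3*r1)*?B) * tv
      + emb (q0*r3 + q3*r0 + (q1*r2 + q2*r1)*?C) * tw)) \<in> I_ns"
    by (intro is_ideal_add[OF is_ideal_I_ns]) simp_all
  moreover have "s - t + (t - r) = s - r" for r s t :: "tvar mpoly" by simp
  ultimately show ?case by (intro ns_normalI) (simp only:)
qed

text \<open>Changing the sign of a, b or c fixes x, y, z and acts on the four summands of the normal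
  form by different characters, so each summand vanishes separately. The coefficients then vanish
  where a b c is nonzero, hence everywhere.\<close>

lemma I_ns_iff: "p \<in> I_ns \<longleftrightarrow> (\<forall>x y z a b c. on_torus x y z a b c \<longrightarrow> ev (abelpt x y z a b c) p = 0)"
proof
  assume van: "\<forall>x y z a b c. on_torus x y z a b c \<longrightarrow> ev (abelpt x y z a b c) p = 0"
  obtain q0 q1 q2 q3 where q: "p - (emb q0 + emb q1 * tu + emb q2 * tv + emb q3 * tw) \<in> I_ns"
    using ns_normal_all[of p] unfolding ns_normal_def by blast
  have split: "ev \<sigma> q0 = 0 \<and> b * c * ev \<sigma> q1 = 0 \<and> a * c * ev \<sigma> q2 = 0 \<and> a * b * ev \<sigma> q3 = 0"
    if t: "on_torus (\<sigma> GA / 2) (\<sigma> GB / 2) (\<sigma> GC / 2) a b c" for a b c and \<sigma> :: "gen \<Rightarrow> complex"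
  proof -
    have "ev \<sigma> q0 + 4 * (b' * c') * ev \<sigma> q1 + 4 * (a' * c') * ev \<sigma> q2 + 4 * (a' * b') * ev \<sigma> q3 = 0"
      if t: "on_torus (\<sigma> GA / 2) (\<sigma> GB / 2) (\<sigma> GC / 2) a' b' c'" for a' b' c'
    proof -
      let ?P = "abelpt (\<sigma> GA / 2) (\<sigma> GB / 2) (\<sigma> GC / 2) a' b' c'"
      have e: "ev ?P (emb r) = ev \<sigma> r" for r
        unfolding emb_def ev_msubst
        by (rule rhom_eqI[OF rhom_ev rhom_ev]) (simp_all add: abelpt_def split: gen.splits)
      have "ev ?P tu = 4 * (b' * c')" "ev ?P tv = 4 * (a' * c')" "ev ?P tw = 4 * (a' * b')"
        by (simp_all add: tu_def tv_def tw_def ev_simps abelpt_def algebra_simps)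
      moreover have "ev ?P p = 0" using van t by blast
      then have "ev ?P (emb q0 + emb q1 * tu + emb q2 * tv + emb q3 * tw) = 0"
        using I_ns_subset_vanishing[OF q t] by (simp add: rhom_diff[OF rhom_ev])
      ultimately show ?thesis by (simp add: ev_simps e algebra_simps)
    qed
    note s = this[of a b c] this[of "-a" b c] this[of a "-b" c] this[of a b "-c"]
    have "on_torus (\<sigma> GA / 2) (\<sigma> GB / 2) (\<sigma> GC / 2) (-a) b c" "on_torus (\<sigma> GA / 2) (\<sigma> GB / 2) (\<sigma> GC / 2) a (-b) c"
      "on_torus (\<sigma> GA / 2) (\<sigma> GB / 2) (\<sigma> GC / 2) a b (-c)" using t by (simp_all add: on_torus_def)
    note s = s(1)[OF t] s(2)[OF this(1)] s(3)[OF this(2)] s(4)[OF this(3)]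
    define A0 where "A0 = ev \<sigma> q0"
    define A1 where "A1 = b * c * ev \<sigma> q1"
    define A2 where "A2 = a * c * ev \<sigma> q2"
    define A3 where "A3 = a * b * ev \<sigma> q3"
    note A = A0_def A1_def A2_def A3_def
    have "A0 + 4*A1 + 4*A2 + 4*A3 = 0" by (rule trans[OF _ s(1)]) (simp add: A algebra_simps)
    moreover have "A0 + 4*A1 - 4*A2 - 4*A3 = 0" by (rule trans[OF _ s(2)]) (simp add: A algebra_simps)
    moreover have "A0 - 4*A1 + 4*A2 - 4*A3 = 0" by (rule trans[OF _ s(3)]) (simp add: A algebra_simps)
    moreover have "A0 - 4*A1 - 4*A2 + 4*A3 = 0" by (rule trans[OF _ s(4)]) (simp add: A algebra_simps)
    ultimately have "4 * A0 = 0" "16 * A1 = 0" "16 * A2 = 0" "16 * A3 = 0" by algebra+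
    then show ?thesis by (simp add: A0_def A1_def A2_def A3_def)
  qed
  have ex: "\<exists>a b c. on_torus x y z a b c" for x y z
  proof -
    have "x*x + csqrt (1 - x*x) * csqrt (1 - x*x) = 1" for x
      using power2_csqrt[of "1 - x*x"] by (simp add: power2_eq_square)
    then show ?thesis unfolding on_torus_def by blast
  qed
  let ?N = "(4 - mVar GA * mVar GA) * (4 - mVar GB * mVar GB) * (4 - mVar GC * mVar GC) :: gen mpoly"
  have N0: "ev (\<lambda>_. 0) ?N \<noteq> 0" by (simp add: ev_simps)
  have van: "ev \<sigma> q0 = 0 \<and> ev \<sigma> q1 = 0 \<and> ev \<sigma> q2 = 0 \<and> ev \<sigma> q3 = 0" if "ev \<sigma> ?N \<noteq> 0" for \<sigma>
  proof -
    obtain a b c where t: "on_torus (\<sigma> GA / 2) (\<sigma> GB / 2) (\<sigma> GC / 2) a b c" using ex by blast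
    have "a \<noteq> 0" "b \<noteq> 0" "c \<noteq> 0" using t that by (auto simp: on_torus_def ev_simps)
    then show ?thesis using split[OF t] by simp
  qed
  have "q0 = 0" "q1 = 0" "q2 = 0" "q3 = 0"
    by (rule mpoly_zero_off[OF N0], use van in blast)+
  then show "p \<in> I_ns" using q by (simp add: emb_rhom)
qed (use I_ns_subset_vanishing in blast)

lemma kernel_subset_I_ns:
  assumes "tproj p = 0"
  shows "p \<in> I_ns"
  unfolding I_ns_iff
proof (intro allI impI)
  fix x y z a b c assume t: "on_torus x y z a b c"
  have "ev (gpt x y z (b*c+0*0+0*0) (a*c+0*0+0*0) (a*b+0*0+0*0) (- det3 a 0 0 b 0 0 c 0 0)) p = 0"
  proof (rule ev_gpt_representation[OF _ _ _ _ _ _ assms])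
    show N: "x * x + (a * a + 0 * 0 + 0 * 0) = 1" "y * y + (b * b + 0 * 0 + 0 * 0) = 1" "z * z + (c * c + 0 * 0 + 0 * 0) = 1"
      using t by (simp_all add: on_torus_def)
    show "mcomm (cq.qmat x a 0 0) (mcomm (cq.qmat y b 0 0) (madj (cq.qmat z c 0 0))) = mid"
      "mcomm (cq.qmat y b 0 0) (mcomm (cq.qmat z c 0 0) (madj (cq.qmat x a 0 0))) = mid"
      "mcomm (cq.qmat z c 0 0) (mcomm (cq.qmat x a 0 0) (madj (cq.qmat y b 0 0))) = mid"
      by (simp_all add: cq.relator_iff[OF N] cq.relator_iff[OF N(2,3,1)] cq.relator_iff[OF N(3,1,2)] cq.commvec_def)
  qed
  then show "ev (abelpt x y z a b c) p = 0" by (simp add: abelpt_def det3_def)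
qed

section \<open>Eigenvalue coordinates and primality of \<open>I_ns\<close>\<close>

definition laurent_pt :: "(gen \<Rightarrow> complex) \<Rightarrow> tvar \<Rightarrow> complex" where
  "laurent_pt \<sigma> t = (case t of Ta \<Rightarrow> \<sigma> GA + 1 / \<sigma> GA | Tb \<Rightarrow> \<sigma> GB + 1 / \<sigma> GB | Tc \<Rightarrow> \<sigma> GC + 1 / \<sigma> GC
     | Tab \<Rightarrow> \<sigma> GA * \<sigma> GB + 1 / (\<sigma> GA * \<sigma> GB) | Tac \<Rightarrow> \<sigma> GA * \<sigma> GC + 1 / (\<sigma> GA * \<sigma> GC)
     | Tbc \<Rightarrow> \<sigma> GB * \<sigma> GC + 1 / (\<sigma> GB * \<sigma> GC) | Tabc \<Rightarrow> \<sigma> GA * \<sigma> GB * \<sigma> GC + 1 / (\<sigma> GA * \<sigma> GB * \<sigma> GC))"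

text \<open>The quaternion x + a i has the eigenvalue x + \<i> a; f and k recover x and a from
  it.\<close>

lemma abelpt_laurent_pt:
  assumes "\<sigma> GA \<noteq> 0" "\<sigma> GB \<noteq> 0" "\<sigma> GC \<noteq> 0"
  defines "f \<equiv> \<lambda>g. (\<sigma> g + 1 / \<sigma> g) / 2" and "k \<equiv> \<lambda>g. - \<i> * (\<sigma> g - 1 / \<sigma> g) / 2"
  shows "on_torus (f GA) (f GB) (f GC) (k GA) (k GB) (k GC)"
    and "abelpt (f GA) (f GB) (f GC) (k GA) (k GB) (k GC) = laurent_pt \<sigma>"
proof -
  have kk: "k g * k g' = - ((\<sigma> g - 1 / \<sigma> g) * (\<sigma> g' - 1 / \<sigma> g') / 4)" for g g'
  proof -
    have "(- \<i> * p / 2) * (- \<i> * q / 2) = - (p * q / 4)" for p q :: complex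
      by (simp add: mult.assoc mult.left_commute[of p \<i>] cq.I_mult)
    then show ?thesis unfolding k_def .
  qed
  show "on_torus (f GA) (f GB) (f GC) (k GA) (k GB) (k GC)"
    unfolding on_torus_def kk f_def using assms(1-3) by (simp add: field_simps)
  show "abelpt (f GA) (f GB) (f GC) (k GA) (k GB) (k GC) = laurent_pt \<sigma>"
  proof
    fix v
    show "abelpt (f GA) (f GB) (f GC) (k GA) (k GB) (k GC) v = laurent_pt \<sigma> v"
      unfolding abelpt_def kk f_def using assms(1-3)
      by (cases v) (simp_all add: laurent_pt_def field_simps)
  qed
qed

lemma I_ns_iff_laurent:
  "p \<in> I_ns \<longleftrightarrow> (\<forall>\<sigma>. \<sigma> GA \<noteq> 0 \<longrightarrow> \<sigma> GB \<noteq> 0 \<longrightarrow> \<sigma> GC \<noteq> 0 \<longrightarrow> ev (laurent_pt \<sigma>) p = 0)"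
proof
  assume "p \<in> I_ns"
  then show "\<forall>\<sigma>. \<sigma> GA \<noteq> 0 \<longrightarrow> \<sigma> GB \<noteq> 0 \<longrightarrow> \<sigma> GC \<noteq> 0 \<longrightarrow> ev (laurent_pt \<sigma>) p = 0"
    unfolding I_ns_iff using abelpt_laurent_pt by metis
next
  assume van: "\<forall>\<sigma>. \<sigma> GA \<noteq> 0 \<longrightarrow> \<sigma> GB \<noteq> 0 \<longrightarrow> \<sigma> GC \<noteq> 0 \<longrightarrow> ev (laurent_pt \<sigma>) p = 0"
  show "p \<in> I_ns" unfolding I_ns_iff
  proof (intro allI impI)
    fix x y z a b c assume t: "on_torus x y z a b c"
    have inv: "x + \<i> * a \<noteq> 0 \<and> 1 / (x + \<i> * a) = x - \<i> * a" if "x*x + a*a = 1" for x a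
    proof -
      have e: "(x + \<i> * a) * (x - \<i> * a) = 1" using that by (simp add: algebra_simps)
      then have "x + \<i> * a \<noteq> 0" by auto
      with e show ?thesis by (simp add: field_simps)
    qed
    define \<sigma> where "\<sigma> g = (case g of GA \<Rightarrow> x + \<i> * a | GB \<Rightarrow> y + \<i> * b | GC \<Rightarrow> z + \<i> * c)" for g
    have s: "\<sigma> GA = x + \<i> * a" "\<sigma> GB = y + \<i> * b" "\<sigma> GC = z + \<i> * c" by (simp_all add: \<sigma>_def)
    have i: "1 / \<sigma> GA = x - \<i> * a" "1 / \<sigma> GB = y - \<i> * b" "1 / \<sigma> GC = z - \<i> * c" 
      "\<sigma> GA \<noteq> 0" "\<sigma> GB \<noteq> 0" "\<sigma> GC \<noteq> 0"
      using t inv unfolding s on_torus_def by blast+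
    have "abelpt x y z a b c = laurent_pt \<sigma>"
    proof -
      have "(\<sigma> GA + 1 / \<sigma> GA) / 2 = x" "(\<sigma> GB + 1 / \<sigma> GB) / 2 = y" "(\<sigma> GC + 1 / \<sigma> GC) / 2 = z"
        "- \<i> * (\<sigma> GA - 1 / \<sigma> GA) / 2 = a" "- \<i> * (\<sigma> GB - 1 / \<sigma> GB) / 2 = b" "- \<i> * (\<sigma> GC - 1 / \<sigma> GC) / 2 = c"
        unfolding i(1-3) by (simp_all add: s algebra_simps)
      then show ?thesis using abelpt_laurent_pt(2)[of \<sigma>, OF i(4-6)] by (simp only:)
    qed
    then show "ev (abelpt x y z a b c) p = 0" using van i(4-6) by simp
  qed
qed

text \<open>A substitute for Laurent polynomials: products of functions on the torus become products
  of polynomials, where there are no zero divisors.\<close>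

lemma laurent_clear_denominators:
  "\<exists>N (q :: gen mpoly). \<forall>\<sigma>. \<sigma> GA \<noteq> 0 \<longrightarrow> \<sigma> GB \<noteq> 0 \<longrightarrow> \<sigma> GC \<noteq> 0 \<longrightarrow>
     ev (laurent_pt \<sigma>) p * (\<sigma> GA * \<sigma> GB * \<sigma> GC) ^ N = ev \<sigma> q"
proof (induction p rule: mpoly_induct)
  case (const a)
  show ?case by (intro exI[of _ 0] exI[of _ "mConst a"]) simp
next
  case (var v)
  let ?X = "mVar GA :: gen mpoly" and ?Y = "mVar GB :: gen mpoly" and ?Z = "mVar GC :: gen mpoly"
  have "\<exists>q :: gen mpoly. \<forall>\<sigma>. \<sigma> GA \<noteq> 0 \<longrightarrow> \<sigma> GB \<noteq> 0 \<longrightarrow> \<sigma> GC \<noteq> 0 \<longrightarrow>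
     laurent_pt \<sigma> v * (\<sigma> GA * \<sigma> GB * \<sigma> GC) = ev \<sigma> q"
  proof (cases v)
    case Ta
    show ?thesis by (rule exI[of _ "(?X*?X+1)*?Y*?Z"]) (simp add: Ta laurent_pt_def ev_simps field_simps)
  next
    case Tb
    show ?thesis by (rule exI[of _ "(?Y*?Y+1)*?X*?Z"]) (simp add: Tb laurent_pt_def ev_simps field_simps)
  next
    case Tc
    show ?thesis by (rule exI[of _ "(?Z*?Z+1)*?X*?Y"]) (simp add: Tc laurent_pt_def ev_simps field_simps)
  next
    case Tab
    show ?thesis by (rule exI[of _ "(?X*?Y*?X*?Y+1)*?Z"]) (simp add: Tab laurent_pt_def ev_simps field_simps)
  next
    case Tac
    show ?thesis by (rule exI[of _ "(?X*?Z*?X*?Z+1)*?Y"]) (simp add: Tac laurent_pt_def ev_simps field_simps)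
  next
    case Tbc
    show ?thesis by (rule exI[of _ "(?Y*?Z*?Y*?Z+1)*?X"]) (simp add: Tbc laurent_pt_def ev_simps field_simps)
  next
    case Tabc
    show ?thesis by (rule exI[of _ "?X*?Y*?Z*?X*?Y*?Z+1"]) (simp add: Tabc laurent_pt_def ev_simps field_simps)
  qed
  then obtain q where "\<forall>\<sigma>. \<sigma> GA \<noteq> 0 \<longrightarrow> \<sigma> GB \<noteq> 0 \<longrightarrow> \<sigma> GC \<noteq> 0 \<longrightarrow>
     laurent_pt \<sigma> v * (\<sigma> GA * \<sigma> GB * \<sigma> GC) = ev \<sigma> (q :: gen mpoly)" by blast
  then show ?case by (intro exI[of _ 1] exI[of _ q]) simp
next
  case (add p q)
  then obtain N r M s where
    *: "\<forall>\<sigma>. \<sigma> GA \<noteq> 0 \<longrightarrow> \<sigma> GB \<noteq> 0 \<longrightarrow> \<sigma> GC \<noteq> 0 \<longrightarrow> ev (laurent_pt \<sigma>) p * (\<sigma> GA * \<sigma> GB * \<sigma> GC) ^ N = ev \<sigma> (r :: gen mpoly)"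
    "\<forall>\<sigma>. \<sigma> GA \<noteq> 0 \<longrightarrow> \<sigma> GB \<noteq> 0 \<longrightarrow> \<sigma> GC \<noteq> 0 \<longrightarrow> ev (laurent_pt \<sigma>) q * (\<sigma> GA * \<sigma> GB * \<sigma> GC) ^ M = ev \<sigma> (s :: gen mpoly)"
    by blast
  let ?m = "mVar GA * mVar GB * mVar GC :: gen mpoly"
  have "ev (laurent_pt \<sigma>) (p + q) * (\<sigma> GA * \<sigma> GB * \<sigma> GC) ^ (N + M) = ev \<sigma> (r * ?m ^ M + s * ?m ^ N)"
    if "\<sigma> GA \<noteq> 0" "\<sigma> GB \<noteq> 0" "\<sigma> GC \<noteq> 0" for \<sigma>
  proof -
    have "ev (laurent_pt \<sigma>) (p + q) * (\<sigma> GA * \<sigma> GB * \<sigma> GC) ^ (N + M) =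
      ev (laurent_pt \<sigma>) p * (\<sigma> GA * \<sigma> GB * \<sigma> GC) ^ N * (\<sigma> GA * \<sigma> GB * \<sigma> GC) ^ M
      + ev (laurent_pt \<sigma>) q * (\<sigma> GA * \<sigma> GB * \<sigma> GC) ^ M * (\<sigma> GA * \<sigma> GB * \<sigma> GC) ^ N"
      by (simp add: rhom_add[OF rhom_ev] power_add algebra_simps)
    then show ?thesis using * that by (simp add: ev_simps)
  qed
  then show ?case by blast
next
  case (mult p q)
  then obtain N r M s where
    *: "\<forall>\<sigma>. \<sigma> GA \<noteq> 0 \<longrightarrow> \<sigma> GB \<noteq> 0 \<longrightarrow> \<sigma> GC \<noteq> 0 \<longrightarrow> ev (laurent_pt \<sigma>) p * (\<sigma> GA * \<sigma> GB * \<sigma> GC) ^ N = ev \<sigma> (r :: gen mpoly)"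
    "\<forall>\<sigma>. \<sigma> GA \<noteq> 0 \<longrightarrow> \<sigma> GB \<noteq> 0 \<longrightarrow> \<sigma> GC \<noteq> 0 \<longrightarrow> ev (laurent_pt \<sigma>) q * (\<sigma> GA * \<sigma> GB * \<sigma> GC) ^ M = ev \<sigma> (s :: gen mpoly)"
    by blast
  have "ev (laurent_pt \<sigma>) (p * q) * (\<sigma> GA * \<sigma> GB * \<sigma> GC) ^ (N + M) = ev \<sigma> (r * s)"
    if "\<sigma> GA \<noteq> 0" "\<sigma> GB \<noteq> 0" "\<sigma> GC \<noteq> 0" for \<sigma>
  proof -
    have "ev (laurent_pt \<sigma>) (p * q) * (\<sigma> GA * \<sigma> GB * \<sigma> GC) ^ (N + M) =
      (ev (laurent_pt \<sigma>) p * (\<sigma> GA * \<sigma> GB * \<sigma> GC) ^ N) * (ev (laurent_pt \<sigma>) q * (\<sigma> GA * \<sigma> GB * \<sigma> GC) ^ M)"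
      by (simp only: rhom_mult[OF rhom_ev] power_add mult_ac)
    then show ?thesis using * that by (simp add: ev_simps)
  qed
  then show ?case by blast
qed

lemma I_ns_prime: "is_prime_ideal I_ns"
  unfolding is_prime_ideal_def
proof (intro conjI allI impI)
  show "is_ideal I_ns" by (rule is_ideal_I_ns)
  show "1 \<notin> I_ns" unfolding I_ns_iff_laurent by (auto simp: ev_simps intro!: exI[of _ "\<lambda>_. 1"])
  fix p q assume pq: "p * q \<in> I_ns"
  obtain N r M s where
    *: "\<And>\<sigma>. \<sigma> GA \<noteq> 0 \<Longrightarrow> \<sigma> GB \<noteq> 0 \<Longrightarrow> \<sigma> GC \<noteq> 0 \<Longrightarrow> ev (laurent_pt \<sigma>) p * (\<sigma> GA * \<sigma> GB * \<sigma> GC) ^ N = ev \<sigma> (r :: gen mpoly)"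
    "\<And>\<sigma>. \<sigma> GA \<noteq> 0 \<Longrightarrow> \<sigma> GB \<noteq> 0 \<Longrightarrow> \<sigma> GC \<noteq> 0 \<Longrightarrow> ev (laurent_pt \<sigma>) q * (\<sigma> GA * \<sigma> GB * \<sigma> GC) ^ M = ev \<sigma> (s :: gen mpoly)"
    using laurent_clear_denominators[of p] laurent_clear_denominators[of q] by blast
  let ?m = "mVar GA * mVar GB * mVar GC :: gen mpoly"
  have "r * s = 0"
  proof (rule mpoly_zero_off[of "\<lambda>_. 1" ?m])
    fix \<sigma> :: "gen \<Rightarrow> complex" assume "ev \<sigma> ?m \<noteq> 0"
    then have nz: "\<sigma> GA \<noteq> 0" "\<sigma> GB \<noteq> 0" "\<sigma> GC \<noteq> 0" by (auto simp: ev_simps)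
    have "ev (laurent_pt \<sigma>) p * ev (laurent_pt \<sigma>) q = 0"
      using pq nz unfolding I_ns_iff_laurent by (simp add: ev_simps)
    then show "ev \<sigma> (r * s) = 0" using *[OF nz] by (auto simp: ev_simps)
  qed (simp add: ev_simps)
  then have "r = 0 \<or> s = 0" by (rule mpoly_no_zero_divisors)
  then show "p \<in> I_ns \<or> q \<in> I_ns"
  proof
    assume "r = 0"
    then have "p \<in> I_ns" unfolding I_ns_iff_laurent using *(1) by (auto simp: ev_simps)
    then show ?thesis ..
  next
    assume "s = 0"
    then have "q \<in> I_ns" unfolding I_ns_iff_laurent using *(2) by (auto simp: ev_simps)
    then show ?thesis ..
  qed
qed

section \<open>The toric ideal\<close>

datatype rv = RA | RB | RC | RR

lemma UNIV_rv: "UNIV = {RA, RB, RC, RR}"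
  using rv.exhaust by auto

lemma UNIV_tvar: "UNIV = {Ta, Tb, Tc, Tab, Tac, Tbc, Tabc}"
  using tvar.exhaust by auto

abbreviation "rA \<equiv> (mVar RA :: rv mpoly)"
abbreviation "rB \<equiv> (mVar RB :: rv mpoly)"
abbreviation "rC \<equiv> (mVar RC :: rv mpoly)"
abbreviation "rR \<equiv> (mVar RR :: rv mpoly)"

text \<open>The binomials in \<open>I_0\<close> say that t_ab/(t_a t_b), t_ac/(t_a t_c) and
  t_bc/(t_b t_c) have a common value R and that t_abc = t_a t_b t_c R^2, wherever this makes
  sense.\<close>

definition sub_0 :: "tvar \<Rightarrow> rv mpoly" where
  "sub_0 t = (case t of Ta \<Rightarrow> rA | Tb \<Rightarrow> rB | Tc \<Rightarrow> rC | Tab \<Rightarrow> rA*rB*rR | Tac \<Rightarrow> rA*rC*rR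
     | Tbc \<Rightarrow> rB*rC*rR | Tabc \<Rightarrow> rA*rB*rC*rR*rR)"

definition toric :: "tvar mpoly \<Rightarrow> rv mpoly" where
  "toric = msubst sub_0"

lemma rhom_toric: "rhom toric"
  unfolding toric_def by (rule rhom_msubst)

lemma toric_vars: "toric ta = rA" "toric tb = rB" "toric tc = rC" "toric tab = rA*rB*rR" "toric tac = rA*rC*rR"
  "toric tbc = rB*rC*rR" "toric tabc = rA*rB*rC*rR*rR" "toric (mConst c) = mConst c"
  by (simp_all add: toric_def sub_0_def)

lemmas toric_simps = rhom_simps[OF rhom_toric] toric_vars

definition Bin :: "tvar mpoly set" where
  "Bin = gen_ideal {ta*tbc - tb*tac, tb*tac - tc*tab, ta*tabc - tab*tac, tb*tabc - tab*tbc, tc*tabc - tac*tbc}"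

lemma is_ideal_Bin: "is_ideal Bin"
  unfolding Bin_def by (rule is_ideal_gen_ideal)

text \<open>The quadratic equation for t_abc over the other six traces, satisfied by every triple in
  \<open>SL_2\<close>.\<close>

definition fricke :: "tvar mpoly" where
  "fricke = tabc^2 - pP*tabc + qQ"

lemma I_0_iff_Bin: "p \<in> I_0 \<longleftrightarrow> (\<exists>r. p - r * fricke \<in> Bin)"
  unfolding I_0_def Bin_def fricke_def by (rule gen_ideal_insert)

lemma toric_Bin: "p \<in> Bin \<Longrightarrow> toric p = 0"
proof -
  have "Bin \<subseteq> {p. toric p = 0}" unfolding Bin_def
    by (rule gen_ideal_least[OF is_ideal_kernel[OF rhom_toric]]) (simp add: toric_simps algebra_simps)
  then show "p \<in> Bin \<Longrightarrow> toric p = 0" by blast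
qed

section \<open>Normal monomials modulo the binomials\<close>

definition texp :: "(tvar \<Rightarrow>\<^sub>0 nat) \<Rightarrow> (rv \<Rightarrow>\<^sub>0 nat)" where
  "texp \<mu> = (let n = Poly_Mapping.lookup \<mu> in
     Poly_Mapping.single RA (n Ta + n Tab + n Tac + n Tabc) + Poly_Mapping.single RB (n Tb + n Tab + n Tbc + n Tabc)
     + Poly_Mapping.single RC (n Tc + n Tac + n Tbc + n Tabc) + Poly_Mapping.single RR (n Tab + n Tac + n Tbc + 2 * n Tabc))"

lemma lookup_texp:
  "Poly_Mapping.lookup (texp \<mu>) RA = Poly_Mapping.lookup \<mu> Ta + Poly_Mapping.lookup \<mu> Tab + Poly_Mapping.lookup \<mu> Tac + Poly_Mapping.lookup \<mu> Tabc"
  "Poly_Mapping.lookup (texp \<mu>) RB = Poly_Mapping.lookup \<mu> Tb + Poly_Mapping.lookup \<mu> Tab + Poly_Mapping.lookup \<mu> Tbc + Poly_Mapping.lookup \<mu> Tabc"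
  "Poly_Mapping.lookup (texp \<mu>) RC = Poly_Mapping.lookup \<mu> Tc + Poly_Mapping.lookup \<mu> Tac + Poly_Mapping.lookup \<mu> Tbc + Poly_Mapping.lookup \<mu> Tabc"
  "Poly_Mapping.lookup (texp \<mu>) RR = Poly_Mapping.lookup \<mu> Tab + Poly_Mapping.lookup \<mu> Tac + Poly_Mapping.lookup \<mu> Tbc + 2 * Poly_Mapping.lookup \<mu> Tabc"
  by (simp_all add: texp_def Let_def lookup_add lookup_single)

lemma rv_exp_eqI:
  "Poly_Mapping.lookup e RA = Poly_Mapping.lookup f RA \<Longrightarrow> Poly_Mapping.lookup e RB = Poly_Mapping.lookup f RB \<Longrightarrow>
   Poly_Mapping.lookup e RC = Poly_Mapping.lookup f RC \<Longrightarrow> Poly_Mapping.lookup e RR = Poly_Mapping.lookup f RR \<Longrightarrow> e = f"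
proof (rule poly_mapping_eqI)
  fix k
  assume "Poly_Mapping.lookup e RA = Poly_Mapping.lookup f RA" "Poly_Mapping.lookup e RB = Poly_Mapping.lookup f RB"
   "Poly_Mapping.lookup e RC = Poly_Mapping.lookup f RC" "Poly_Mapping.lookup e RR = Poly_Mapping.lookup f RR"
  then show "Poly_Mapping.lookup e k = Poly_Mapping.lookup f k" by (cases k) simp_all
qed

lemma mono_eval_tvar: "mono_eval \<sigma> \<mu> = (let n = Poly_Mapping.lookup \<mu> in \<sigma> Ta ^ n Ta * (\<sigma> Tb ^ n Tb * (\<sigma> Tc ^ n Tc *
     (\<sigma> Tab ^ n Tab * (\<sigma> Tac ^ n Tac * (\<sigma> Tbc ^ n Tbc * \<sigma> Tabc ^ n Tabc))))))"
proof -
  have k: "Poly_Mapping.keys \<mu> \<subseteq> {Ta, Tb, Tc, Tab, Tac, Tbc, Tabc}" using UNIV_tvar by blast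
  show ?thesis by (simp add: mono_eval_superset[OF _ k] Let_def)
qed

lemma mono_eval_rv: "mono_eval \<sigma> e = (let n = Poly_Mapping.lookup e in \<sigma> RA ^ n RA * (\<sigma> RB ^ n RB * (\<sigma> RC ^ n RC * \<sigma> RR ^ n RR)))"
proof -
  have k: "Poly_Mapping.keys e \<subseteq> {RA, RB, RC, RR}" using UNIV_rv by blast
  show ?thesis by (simp add: mono_eval_superset[OF _ k] Let_def)
qed

lemma toric_single: "toric (Poly_Mapping.single \<mu> a) = Poly_Mapping.single (texp \<mu>) a"
proof -
  have "toric (Poly_Mapping.single \<mu> a) = mConst a * mono_eval sub_0 \<mu>"
    unfolding toric_def msubst_meval by (rule meval_single[OF rhom_mConst])
  also have "mono_eval sub_0 \<mu> = mono_eval mVar (texp \<mu>)"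
    by (simp add: mono_eval_tvar mono_eval_rv Let_def lookup_texp sub_0_def power_add power_mult_distrib
        power2_eq_square power_mult mult_ac)
  finally show ?thesis by (simp only: single_conv_mono_eval[symmetric])
qed

definition tmon :: "nat \<Rightarrow> nat \<Rightarrow> nat \<Rightarrow> nat \<Rightarrow> nat \<Rightarrow> nat \<Rightarrow> nat \<Rightarrow> (tvar \<Rightarrow>\<^sub>0 nat)" where
  "tmon x y z u v w d = Poly_Mapping.single Ta x + Poly_Mapping.single Tb y + Poly_Mapping.single Tc z
     + Poly_Mapping.single Tbc u + Poly_Mapping.single Tac v + Poly_Mapping.single Tab w + Poly_Mapping.single Tabc d"

lemma lookup_tmon [simp]:
  "Poly_Mapping.lookup (tmon x y z u v w d) Ta = x" "Poly_Mapping.lookup (tmon x y z u v w d) Tb = y"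
  "Poly_Mapping.lookup (tmon x y z u v w d) Tc = z" "Poly_Mapping.lookup (tmon x y z u v w d) Tbc = u"
  "Poly_Mapping.lookup (tmon x y z u v w d) Tac = v" "Poly_Mapping.lookup (tmon x y z u v w d) Tab = w"
  "Poly_Mapping.lookup (tmon x y z u v w d) Tabc = d"
  by (simp_all add: tmon_def lookup_add lookup_single)

lemma tmon_lookup: "\<mu> = tmon (Poly_Mapping.lookup \<mu> Ta) (Poly_Mapping.lookup \<mu> Tb) (Poly_Mapping.lookup \<mu> Tc)
   (Poly_Mapping.lookup \<mu> Tbc) (Poly_Mapping.lookup \<mu> Tac) (Poly_Mapping.lookup \<mu> Tab) (Poly_Mapping.lookup \<mu> Tabc)"
proof (rule poly_mapping_eqI)
  show "Poly_Mapping.lookup \<mu> k = Poly_Mapping.lookup (tmon (Poly_Mapping.lookup \<mu> Ta) (Poly_Mapping.lookup \<mu> Tb) (Poly_Mapping.lookup \<mu> Tc)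
   (Poly_Mapping.lookup \<mu> Tbc) (Poly_Mapping.lookup \<mu> Tac) (Poly_Mapping.lookup \<mu> Tab) (Poly_Mapping.lookup \<mu> Tabc)) k" for k
    by (cases k) simp_all
qed

text \<open>The leading terms of the five binomials are the products of non-neighbours in the pentagon
  \<open>t\<^sub>b\<^sub>c - t\<^sub>a\<^sub>b\<^sub>c - t\<^sub>a\<^sub>c - t\<^sub>a - t\<^sub>b - t\<^sub>b\<^sub>c\<close>; a normal monomial lives on one of its edges, besides \<open>t\<^sub>c\<close> and \<open>t\<^sub>a\<^sub>b\<close>.\<close>

definition pentagon :: "(tvar \<Rightarrow>\<^sub>0 nat) \<Rightarrow> bool" where
  "pentagon \<mu> \<longleftrightarrow> (let n = Poly_Mapping.lookup \<mu> in
     (n Ta = 0 \<and> n Tb = 0 \<and> n Tac = 0) \<or> (n Ta = 0 \<and> n Tac = 0 \<and> n Tabc = 0) \<or> (n Tbc = 0 \<and> n Tac = 0 \<and> n Tabc = 0)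
     \<or> (n Tb = 0 \<and> n Tbc = 0 \<and> n Tabc = 0) \<or> (n Ta = 0 \<and> n Tb = 0 \<and> n Tbc = 0))"

text \<open>For each of the 25 pairs of edges the four exponent equations determine the monomial by
  linear arithmetic.\<close>

lemma pentagon_inj:
  assumes "pentagon \<mu>" "pentagon \<nu>" "texp \<mu> = texp \<nu>"
  shows "\<mu> = \<nu>"
proof -
  define x y z u v w d where n: "x = Poly_Mapping.lookup \<mu> Ta" "y = Poly_Mapping.lookup \<mu> Tb" "z = Poly_Mapping.lookup \<mu> Tc"
    "u = Poly_Mapping.lookup \<mu> Tbc" "v = Poly_Mapping.lookup \<mu> Tac" "w = Poly_Mapping.lookup \<mu> Tab" "d = Poly_Mapping.lookup \<mu> Tabc"
  define x' y' z' u' v' w' d' where n': "x' = Poly_Mapping.lookup \<nu> Ta" "y' = Poly_Mapping.lookup \<nu> Tb" "z' = Poly_Mapping.lookup \<nu> Tc"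
    "u' = Poly_Mapping.lookup \<nu> Tbc" "v' = Poly_Mapping.lookup \<nu> Tac" "w' = Poly_Mapping.lookup \<nu> Tab" "d' = Poly_Mapping.lookup \<nu> Tabc"
  have e: "x + w + v + d = x' + w' + v' + d'" "y + w + u + d = y' + w' + u' + d'"
     "z + v + u + d = z' + v' + u' + d'" "w + v + u + 2 * d = w' + v' + u' + 2 * d'"
    using lookup_texp[of \<mu>] lookup_texp[of \<nu>] assms(3) by (simp_all add: n n')
  have p: "(x = 0 \<and> y = 0 \<and> v = 0) \<or> (x = 0 \<and> v = 0 \<and> d = 0) \<or> (u = 0 \<and> v = 0 \<and> d = 0)
      \<or> (y = 0 \<and> u = 0 \<and> d = 0) \<or> (x = 0 \<and> y = 0 \<and> u = 0)"
    using assms(1) by (simp add: pentagon_def Let_def n)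
  have p': "(x' = 0 \<and> y' = 0 \<and> v' = 0) \<or> (x' = 0 \<and> v' = 0 \<and> d' = 0) \<or> (u' = 0 \<and> v' = 0 \<and> d' = 0)
      \<or> (y' = 0 \<and> u' = 0 \<and> d' = 0) \<or> (x' = 0 \<and> y' = 0 \<and> u' = 0)"
    using assms(2) by (simp add: pentagon_def Let_def n')
  from p p' have "x = x' \<and> y = y' \<and> z = z' \<and> u = u' \<and> v = v' \<and> w = w' \<and> d = d'"
    by (elim disjE conjE; use e in \<open>simp, linarith?\<close>)
  then show ?thesis
    using tmon_lookup[of \<mu>] tmon_lookup[of \<nu>] by (simp add: n n')
qed

lemma tmon_binomial:
  assumes "mVar p * mVar q - mVar r * mVar s \<in> Bin"
  shows "Poly_Mapping.single (\<mu> + Poly_Mapping.single p 1 + Poly_Mapping.single q 1) 1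
    - Poly_Mapping.single (\<mu> + Poly_Mapping.single r 1 + Poly_Mapping.single s 1) 1 \<in> Bin"
proof -
  have "Poly_Mapping.single \<mu> 1 * (mVar p * mVar q - mVar r * mVar s) \<in> Bin"
    by (rule is_ideal_mult[OF is_ideal_Bin assms])
  then show ?thesis by (simp add: mVar_def mult_single right_diff_distrib add.assoc)
qed

lemma Bin_binomials: "ta*tbc - tc*tab \<in> Bin" "tb*tac - tc*tab \<in> Bin" "ta*tabc - tab*tac \<in> Bin"
  "tb*tabc - tab*tbc \<in> Bin" "tbc*tac - tc*tabc \<in> Bin"
proof -
  have 5: "ta*tbc - tb*tac \<in> Bin" "tb*tac - tc*tab \<in> Bin" "ta*tabc - tab*tac \<in> Bin"
    "tb*tabc - tab*tbc \<in> Bin" "tc*tabc - tac*tbc \<in> Bin"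
    unfolding Bin_def by (rule gen_ideal_mem, simp)+
  then show "tb*tac - tc*tab \<in> Bin" "ta*tabc - tab*tac \<in> Bin" "tb*tabc - tab*tbc \<in> Bin" by simp_all
  show "ta*tbc - tc*tab \<in> Bin" using is_ideal_add[OF is_ideal_Bin 5(1,2)] by simp
  show "tbc*tac - tc*tabc \<in> Bin" using is_ideal_uminus[OF is_ideal_Bin 5(5)] by (simp add: mult.commute)
qed

text \<open>Every rewriting step replaces a product of two variables other than t_c and t_ab by one
  containing t_c or t_ab. Counting these two once and the others twice makes the weighted degree
  drop.\<close>

lemma pentagon_reduce:
  "\<exists>\<nu>. pentagon \<nu> \<and> Poly_Mapping.single \<mu> 1 - Poly_Mapping.single \<nu> 1 \<in> Bin"
proof (induction "let n = Poly_Mapping.lookup \<mu> in 2 * (n Ta + n Tb + n Tbc + n Tac + n Tabc) + n Tc + n Tab"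
    arbitrary: \<mu> rule: less_induct)
  case less
  let ?n = "Poly_Mapping.lookup \<mu>"
  have step: "\<exists>\<nu>. pentagon \<nu> \<and> Poly_Mapping.single \<mu> 1 - Poly_Mapping.single \<nu> 1 \<in> Bin"
    if b: "mVar p * mVar q - mVar r * mVar s \<in> Bin" and pq: "p \<noteq> q" "?n p > 0" "?n q > 0"
      and lt: "\<And>\<rho> :: tvar \<Rightarrow>\<^sub>0 nat. (let n = Poly_Mapping.lookup (\<rho> + Poly_Mapping.single r 1 + Poly_Mapping.single s 1) in
          2 * (n Ta + n Tb + n Tbc + n Tac + n Tabc) + n Tc + n Tab) <
        (let n = Poly_Mapping.lookup (\<rho> + Poly_Mapping.single p 1 + Poly_Mapping.single q 1) in
          2 * (n Ta + n Tb + n Tbc + n Tac + n Tabc) + n Tc + n Tab)" for p q r s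
  proof -
    define \<rho> where "\<rho> = \<mu> - Poly_Mapping.single p 1 - Poly_Mapping.single q 1"
    have \<mu>: "\<mu> = \<rho> + Poly_Mapping.single p 1 + Poly_Mapping.single q 1"
      using pq by (intro poly_mapping_eqI) (auto simp: \<rho>_def lookup_add lookup_minus lookup_single when_def)
    obtain \<nu> where \<nu>: "pentagon \<nu>"
      "Poly_Mapping.single (\<rho> + Poly_Mapping.single r 1 + Poly_Mapping.single s 1) 1 - Poly_Mapping.single \<nu> 1 \<in> Bin"
      using less[of "\<rho> + Poly_Mapping.single r 1 + Poly_Mapping.single s 1"] lt[of \<rho>] \<mu> by auto
    have "Poly_Mapping.single \<mu> 1 - Poly_Mapping.single \<nu> 1 \<in> Bin"
      using is_ideal_add[OF is_ideal_Bin tmon_binomial[OF b, of \<rho>] \<nu>(2)] \<mu> by simp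
    with \<nu>(1) show ?thesis by blast
  qed
  show ?case
  proof (cases "pentagon \<mu>")
    case True
    then show ?thesis by (intro exI[of _ \<mu>]) (simp add: is_ideal_zero[OF is_ideal_Bin])
  next
    case False
    then consider "?n Ta > 0" "?n Tbc > 0" | "?n Tb > 0" "?n Tac > 0" | "?n Ta > 0" "?n Tabc > 0"
      | "?n Tb > 0" "?n Tabc > 0" | "?n Tbc > 0" "?n Tac > 0"
      unfolding pentagon_def Let_def by fastforce
    then show ?thesis
    proof cases
      case 1
      then show ?thesis by (intro step[OF Bin_binomials(1)]) (simp_all add: Let_def lookup_add lookup_single)
    next
      case 2
      then show ?thesis by (intro step[OF Bin_binomials(2)]) (simp_all add: Let_def lookup_add lookup_single)
    next
      case 3
      then show ?thesis by (intro step[OF Bin_binomials(3)]) (simp_all add: Let_def lookup_add lookup_single)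
    next
      case 4
      then show ?thesis by (intro step[OF Bin_binomials(4)]) (simp_all add: Let_def lookup_add lookup_single)
    next
      case 5
      then show ?thesis by (intro step[OF Bin_binomials(5)]) (simp_all add: Let_def lookup_add lookup_single)
    qed
  qed
qed

text \<open>Normal monomials have pairwise distinct toric images, so nothing can cancel in the image
  of a normal form.\<close>

lemma toric_kernel:
  assumes "toric p = 0"
  shows "p \<in> Bin"
proof -
  have "\<exists>p'. p - p' \<in> Bin \<and> (\<forall>\<mu>\<in>Poly_Mapping.keys p'. pentagon \<mu>)"
  proof (induction p rule: mpoly_add_induct)
    case (single \<mu> a)
    obtain \<nu> where \<nu>: "pentagon \<nu>" "Poly_Mapping.single \<mu> 1 - Poly_Mapping.single \<nu> 1 \<in> Bin"
      using pentagon_reduce by blast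
    have "mConst a * (Poly_Mapping.single \<mu> 1 - Poly_Mapping.single \<nu> 1) \<in> Bin"
      by (rule is_ideal_mult[OF is_ideal_Bin \<nu>(2)])
    then have "Poly_Mapping.single \<mu> a - Poly_Mapping.single \<nu> a \<in> Bin"
      by (simp add: mConst_def right_diff_distrib mult_single)
    with \<nu>(1) show ?case by (intro exI[of _ "Poly_Mapping.single \<nu> a"]) auto
  next
    case (add p q)
    then obtain p' q' where *: "p - p' \<in> Bin" "\<forall>\<mu>\<in>Poly_Mapping.keys p'. pentagon \<mu>"
      "q - q' \<in> Bin" "\<forall>\<mu>\<in>Poly_Mapping.keys q'. pentagon \<mu>" by blast
    have "p + q - (p' + q') \<in> Bin" using is_ideal_add[OF is_ideal_Bin *(1,3)] by (simp add: algebra_simps)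
    moreover have "\<forall>\<mu>\<in>Poly_Mapping.keys (p' + q'). pentagon \<mu>" using keys_add[of p' q'] *(2,4) by blast
    ultimately show ?case by blast
  qed
  then obtain p' where p': "p - p' \<in> Bin" "\<forall>\<mu>\<in>Poly_Mapping.keys p'. pentagon \<mu>" by blast
  have "toric p' = 0" using toric_Bin[OF p'(1)] assms by (simp add: rhom_diff[OF rhom_toric])
  have "p' = (\<Sum>\<mu>\<in>Poly_Mapping.keys p'. Poly_Mapping.single \<mu> (Poly_Mapping.lookup p' \<mu>))"
    by (rule poly_mapping_eqI) (auto simp: lookup_sum lookup_single when_def in_keys_iff)
  then have sum: "toric p' = (\<Sum>\<mu>\<in>Poly_Mapping.keys p'. Poly_Mapping.single (texp \<mu>) (Poly_Mapping.lookup p' \<mu>))"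
    using rhom_sum[OF rhom_toric, of "\<lambda>\<mu>. Poly_Mapping.single \<mu> (Poly_Mapping.lookup p' \<mu>)" "Poly_Mapping.keys p'"]
    by (simp add: toric_single)
  then have zero: "(\<Sum>\<mu>\<in>Poly_Mapping.keys p'. Poly_Mapping.lookup p' \<mu> when texp \<mu> = e) = 0" for e
  proof -
    have "Poly_Mapping.lookup (toric p') e = (\<Sum>\<mu>\<in>Poly_Mapping.keys p'. Poly_Mapping.lookup p' \<mu> when texp \<mu> = e)"
      unfolding sum by (simp add: lookup_sum lookup_single)
    then show ?thesis using \<open>toric p' = 0\<close> by simp
  qed
  have "p' = 0"
  proof (rule ccontr)
    assume "p' \<noteq> 0"
    then obtain \<nu> where \<nu>: "\<nu> \<in> Poly_Mapping.keys p'" by (metis keys_eq_empty all_not_in_conv)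
    have inj: "texp \<mu> = texp \<nu> \<longleftrightarrow> \<mu> = \<nu>" if "\<mu> \<in> Poly_Mapping.keys p'" for \<mu>
      using pentagon_inj[of \<mu> \<nu>] p'(2) \<nu> that by blast
    have "(\<Sum>\<mu>\<in>Poly_Mapping.keys p'. Poly_Mapping.lookup p' \<mu> when texp \<mu> = texp \<nu>) =
        (\<Sum>\<mu>\<in>Poly_Mapping.keys p'. if \<mu> = \<nu> then Poly_Mapping.lookup p' \<mu> else 0)"
      by (rule sum.cong) (simp_all add: inj when_def)
    then show False using zero[of "texp \<nu>"] \<nu> by (simp add: in_keys_iff)
  qed
  then show ?thesis using p'(1) by simp
qed

section \<open>The exponent cone of the toric subring\<close>

definition cone :: "(rv \<Rightarrow>\<^sub>0 nat) \<Rightarrow> bool" where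
  "cone e \<longleftrightarrow> (let n = Poly_Mapping.lookup e in n RR \<le> n RA + n RB \<and> n RR \<le> n RA + n RC \<and> n RR \<le> n RB + n RC)"

text \<open>The inequalities characterise the exponents (i, j, k, l) of the toric subring. If i, j,
  k > 0 and l > 1, a factor t_abc with exponent (1, 1, 1, 2) can be removed; the other cases have
  explicit solutions.\<close>

lemma cone_exponents:
  fixes i j k l :: nat
  assumes "l \<le> i + j" "l \<le> i + k" "l \<le> j + k"
  shows "\<exists>x y z u v w d. i = x + w + v + d \<and> j = y + w + u + d \<and> k = z + v + u + d \<and> l = w + v + u + 2 * d"
  using assms
proof (induction l arbitrary: i j k rule: less_induct)
  case (less l)
  consider "l = 0" | "l > 0" "i = 0" | "l > 0" "j = 0" | "l > 0" "k = 0"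
    | "l = 1" "i > 0" "j > 0" "k > 0" | "l > 1" "i > 0" "j > 0" "k > 0" by linarith
  then show ?case
  proof cases
    case 1
    show ?thesis
      by (rule exI[of _ i], rule exI[of _ j], rule exI[of _ k], rule exI[of _ 0], rule exI[of _ 0], rule exI[of _ 0], rule exI[of _ 0], (use 1 less.prems in simp))
  next
    case 2
    show ?thesis
      by (rule exI[of _ 0], rule exI[of _ "j - l"], rule exI[of _ "k - l"], rule exI[of _ l], rule exI[of _ 0], rule exI[of _ 0], rule exI[of _ 0], (use 2 less.prems in simp))
  next
    case 3
    show ?thesis
      by (rule exI[of _ "i - l"], rule exI[of _ 0], rule exI[of _ "k - l"], rule exI[of _ 0], rule exI[of _ l], rule exI[of _ 0], rule exI[of _ 0], (use 3 less.prems in simp))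
  next
    case 4
    show ?thesis
      by (rule exI[of _ "i - l"], rule exI[of _ "j - l"], rule exI[of _ 0], rule exI[of _ 0], rule exI[of _ 0], rule exI[of _ l], rule exI[of _ 0], (use 4 less.prems in simp))
  next
    case 5
    show ?thesis
      by (rule exI[of _ "i - 1"], rule exI[of _ "j - 1"], rule exI[of _ k], rule exI[of _ 0], rule exI[of _ 0], rule exI[of _ 1], rule exI[of _ 0], (use 5 less.prems in auto))
  next
    case 6
    have "l - 2 < l" "l - 2 \<le> (i - 1) + (j - 1)" "l - 2 \<le> (i - 1) + (k - 1)" "l - 2 \<le> (j - 1) + (k - 1)"
      using 6 less.prems by auto
    from less.IH[OF this] obtain x y z u v w d where e:
      "i - 1 = x + w + v + d" "j - 1 = y + w + u + d" "k - 1 = z + v + u + d" "l - 2 = w + v + u + 2 * d" by blast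
    show ?thesis
      by (rule exI[of _ x], rule exI[of _ y], rule exI[of _ z], rule exI[of _ u], rule exI[of _ v], rule exI[of _ w], rule exI[of _ "Suc d"], (use 6 e in auto))
  qed
qed

lemma toric_image:
  assumes "\<forall>e\<in>Poly_Mapping.keys h. cone e"
  shows "\<exists>q. toric q = h"
proof -
  have "\<forall>e\<in>Poly_Mapping.keys h. \<exists>\<mu>. texp \<mu> = e"
  proof
    fix e assume "e \<in> Poly_Mapping.keys h"
    then have "cone e" using assms by blast
    then obtain x y z u v w d where "Poly_Mapping.lookup e RA = x + w + v + d" "Poly_Mapping.lookup e RB = y + w + u + d"
      "Poly_Mapping.lookup e RC = z + v + u + d" "Poly_Mapping.lookup e RR = w + v + u + 2 * d"
      unfolding cone_def Let_def
      using cone_exponents[of "Poly_Mapping.lookup e RR" "Poly_Mapping.lookup e RA" "Poly_Mapping.lookup e RB" "Poly_Mapping.lookup e RC"] by auto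
    then have "texp (tmon x y z u v w d) = e"
      by (intro rv_exp_eqI) (simp_all add: lookup_texp)
    then show "\<exists>\<mu>. texp \<mu> = e" ..
  qed
  then obtain m where m: "\<And>e. e \<in> Poly_Mapping.keys h \<Longrightarrow> texp (m e) = e" by metis
  have "toric (\<Sum>e\<in>Poly_Mapping.keys h. Poly_Mapping.single (m e) (Poly_Mapping.lookup h e)) =
    (\<Sum>e\<in>Poly_Mapping.keys h. Poly_Mapping.single e (Poly_Mapping.lookup h e))"
    by (simp add: rhom_sum[OF rhom_toric] toric_single m)
  also have "\<dots> = h"
    by (rule poly_mapping_eqI) (auto simp: lookup_sum lookup_single when_def in_keys_iff)
  finally show ?thesis by blast
qed

definition restr :: "('v \<Rightarrow>\<^sub>0 nat) set \<Rightarrow> 'v mpoly \<Rightarrow> 'v mpoly" where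
  "restr S p = (\<Sum>\<mu>\<in>Poly_Mapping.keys p \<inter> S. Poly_Mapping.single \<mu> (Poly_Mapping.lookup p \<mu>))"

lemma lookup_restr: "Poly_Mapping.lookup (restr S p) \<mu> = (if \<mu> \<in> S then Poly_Mapping.lookup p \<mu> else 0)"
  by (auto simp: restr_def lookup_sum lookup_single when_def in_keys_iff)

text \<open>The product of the top-weight parts does not vanish.\<close>

lemma weight_factor:
  fixes wt :: "('v \<Rightarrow>\<^sub>0 nat) \<Rightarrow> int" and F h :: "'v mpoly"
  assumes add: "\<And>\<mu> \<nu>. wt (\<mu> + \<nu>) = wt \<mu> + wt \<nu>"
    and F: "\<And>\<mu>. \<mu> \<in> Poly_Mapping.keys F \<Longrightarrow> wt \<mu> \<le> 0" "\<beta> \<in> Poly_Mapping.keys F" "wt \<beta> = 0"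
    and Fh: "\<And>\<mu>. \<mu> \<in> Poly_Mapping.keys (F * h) \<Longrightarrow> wt \<mu> \<le> 0"
    and \<nu>: "\<nu> \<in> Poly_Mapping.keys h"
  shows "wt \<nu> \<le> 0"
proof (rule ccontr)
  assume neg: "\<not> wt \<nu> \<le> 0"
  define n where "n = Max (wt ` Poly_Mapping.keys h)"
  have n_ge: "wt \<mu> \<le> n" if "\<mu> \<in> Poly_Mapping.keys h" for \<mu>
    unfolding n_def using that by (intro Max_ge) auto
  have "n \<in> wt ` Poly_Mapping.keys h" unfolding n_def using \<nu> by (intro Max_in) auto
  then obtain \<nu>0 where \<nu>0: "\<nu>0 \<in> Poly_Mapping.keys h" "wt \<nu>0 = n" by auto
  have "n > 0" using n_ge[OF \<nu>] neg by simp
  define F0 F1 h0 h1 where "F0 = restr {\<mu>. wt \<mu> = 0} F" and "F1 = restr {\<mu>. wt \<mu> \<noteq> 0} F"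
    and "h0 = restr {\<mu>. wt \<mu> = n} h" and "h1 = restr {\<mu>. wt \<mu> \<noteq> n} h"
  have split: "F = F0 + F1" "h = h0 + h1"
    by (auto intro!: poly_mapping_eqI simp: F0_def F1_def h0_def h1_def lookup_add lookup_restr)
  have "F0 \<noteq> 0"
    using F(2,3) lookup_restr[of "{\<mu>. wt \<mu> = 0}" F \<beta>] by (auto simp: F0_def in_keys_iff)
  moreover have "h0 \<noteq> 0"
    using \<nu>0 lookup_restr[of "{\<mu>. wt \<mu> = n}" h \<nu>0] by (auto simp: h0_def in_keys_iff)
  ultimately have "F0 * h0 \<noteq> 0" using mpoly_no_zero_divisors by blast
  then obtain \<kappa> where \<kappa>: "\<kappa> \<in> Poly_Mapping.keys (F0 * h0)" by (metis keys_eq_empty all_not_in_conv)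
  have kF0: "wt \<mu> = 0" if "\<mu> \<in> Poly_Mapping.keys F0" for \<mu>
    using that by (auto simp: F0_def in_keys_iff lookup_restr split: if_splits)
  have kF1: "wt \<mu> < 0" if "\<mu> \<in> Poly_Mapping.keys F1" for \<mu>
    using that F(1)[of \<mu>] by (auto simp: F1_def in_keys_iff lookup_restr split: if_splits)
  have kh0: "wt \<mu> = n" if "\<mu> \<in> Poly_Mapping.keys h0" for \<mu>
    using that by (auto simp: h0_def in_keys_iff lookup_restr split: if_splits)
  have kh1: "wt \<mu> < n" if "\<mu> \<in> Poly_Mapping.keys h1" for \<mu>
    using that n_ge[of \<mu>] by (auto simp: h1_def in_keys_iff lookup_restr split: if_splits)
  have wk: "wt \<kappa> = n" using keys_mult[of F0 h0] \<kappa> kF0 kh0 by (force simp: add)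
  have "\<kappa> \<notin> Poly_Mapping.keys (F0 * h1)" using keys_mult[of F0 h1] kF0 kh1 wk by (force simp: add)
  moreover have "\<kappa> \<notin> Poly_Mapping.keys (F1 * h)" using keys_mult[of F1 h] kF1 n_ge wk by (force simp: add)
  moreover have "F * h = F0 * h0 + F0 * h1 + F1 * h" using split by (simp add: algebra_simps)
  ultimately have "Poly_Mapping.lookup (F * h) \<kappa> = Poly_Mapping.lookup (F0 * h0) \<kappa>"
    by (simp add: lookup_add in_keys_iff)
  then have "\<kappa> \<in> Poly_Mapping.keys (F * h)" using \<kappa> by (simp add: in_keys_iff)
  then show False using Fh wk \<open>n > 0\<close> by force
qed

lemma cone_texp: "cone (texp \<mu>)"
  by (simp add: cone_def Let_def lookup_texp)

lemma toric_cone: "e \<in> Poly_Mapping.keys (toric p) \<Longrightarrow> cone e"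
proof (induction p arbitrary: e rule: mpoly_add_induct)
  case (single \<mu> a)
  then show ?case by (auto simp: toric_single cone_texp split: if_splits)
next
  case (add p q)
  then show ?case using keys_add[of "toric p" "toric q"] by (auto simp: rhom_add[OF rhom_toric])
qed

definition Fr :: "rv mpoly" where
  "Fr = toric fricke"

text \<open>The constant term puts the exponent 0 into the support of \<open>Fr\<close>, so for each
  of the three linear forms defining the cone the top weight of \<open>Fr\<close> is exactly 0, as
  \<open>weight_factor\<close> demands.\<close>

lemma Fr_const: "Poly_Mapping.lookup Fr 0 = -4"
proof -
  have at0: "ev (\<lambda>_. 0) p = Poly_Mapping.lookup p 0" for p :: "rv mpoly"
  proof (induction p rule: mpoly_add_induct)
    case (single \<mu> a)
    show ?case
    proof (cases "\<mu> = 0")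
      case True
      then show ?thesis by (simp add: meval_single[OF rhom_id])
    next
      case False
      then obtain v where "v \<in> Poly_Mapping.keys \<mu>" by (metis keys_eq_empty all_not_in_conv)
      then have "mono_eval (\<lambda>_. 0 :: complex) \<mu> = 0"
        unfolding mono_eval_def by (intro prod_zero) (auto simp: in_keys_iff intro!: bexI[of _ v])
      then show ?thesis using False by (simp add: meval_single[OF rhom_id] lookup_single)
    qed
  next
    case (add p q)
    then show ?case by (simp add: lookup_add rhom_add[OF rhom_ev])
  qed
  show ?thesis unfolding at0[symmetric]
    by (simp add: Fr_def fricke_def pP_def qQ_def toric_simps ev_simps power2_eq_square)
qed

lemma cone_factor:
  assumes "\<And>e. e \<in> Poly_Mapping.keys (Fr * h) \<Longrightarrow> cone e" "e \<in> Poly_Mapping.keys h"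
  shows "cone e"
proof -
  have "0 \<in> Poly_Mapping.keys Fr" using Fr_const by (simp add: in_keys_iff)
  note w = weight_factor[where F = Fr and h = h and \<beta> = 0 and \<nu> = e, OF _ _ this _ _ assms(2)]
  have F: "\<And>e. e \<in> Poly_Mapping.keys Fr \<Longrightarrow> cone e" unfolding Fr_def by (rule toric_cone)
  have "int (Poly_Mapping.lookup e RR) - int (Poly_Mapping.lookup e RA) - int (Poly_Mapping.lookup e RB) \<le> 0"
    by (rule w) (use F assms(1) in \<open>force simp: lookup_add cone_def Let_def\<close>)+
  moreover have "int (Poly_Mapping.lookup e RR) - int (Poly_Mapping.lookup e RA) - int (Poly_Mapping.lookup e RC) \<le> 0"
    by (rule w) (use F assms(1) in \<open>force simp: lookup_add cone_def Let_def\<close>)+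
  moreover have "int (Poly_Mapping.lookup e RR) - int (Poly_Mapping.lookup e RB) - int (Poly_Mapping.lookup e RC) \<le> 0"
    by (rule w) (use F assms(1) in \<open>force simp: lookup_add cone_def Let_def\<close>)+
  ultimately show ?thesis by (simp add: cone_def Let_def)
qed

text \<open>If a multiple of \<open>Fr\<close> lies in the toric subring, so does its cofactor, by
  \<open>cone_factor\<close> and \<open>toric_image\<close>. The cofactor lifts, and the remaining
  ambiguity is the kernel \<open>Bin\<close>.\<close>

lemma I_0_iff: "p \<in> I_0 \<longleftrightarrow> Fr dvd toric p"
proof
  assume "p \<in> I_0"
  then obtain r where "p - r * fricke \<in> Bin" unfolding I_0_iff_Bin by blast
  then have "toric p = toric r * Fr"
    using toric_Bin by (fastforce simp: rhom_simps[OF rhom_toric] Fr_def)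
  then show "Fr dvd toric p" by simp
next
  assume "Fr dvd toric p"
  then obtain h where h: "toric p = Fr * h" by blast
  have "\<forall>e\<in>Poly_Mapping.keys h. cone e"
    using cone_factor[of h] toric_cone[of _ p] h by metis
  then obtain q where "toric q = h" using toric_image by blast
  then have "toric (p - q * fricke) = 0" by (simp add: rhom_simps[OF rhom_toric] h Fr_def)
  then have "p - q * fricke \<in> Bin" by (rule toric_kernel)
  then show "p \<in> I_0" unfolding I_0_iff_Bin by blast
qed

section \<open>Irreducibility of the defining polynomial of the toric hypersurface\<close>

lemma degree_less_2_conv: "degree p < 2 \<Longrightarrow> p = [:coeff p 0, coeff p 1:]"
proof (rule poly_eqI)
  fix n assume "degree p < 2"
  then show "coeff p n = coeff [:coeff p 0, coeff p 1:] n"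
    by (cases n; cases "n - 1") (auto simp: coeff_eq_0)
qed

text \<open>Constant factors are units because the coefficients have no common divisor. In (aX +
  b)(cX + d) without linear term, \<pi> dividing b would divide a d but not d, hence a, hence the
  leading coefficient P.\<close>

lemma eisenstein_quadratic:
  fixes P q \<pi> :: "'a::{idom_divide,algebraic_semidom}"
  assumes \<pi>: "prime_elem \<pi>" "\<not> \<pi> dvd P" "\<not> \<pi> dvd q"
    and cop: "\<And>c. c dvd P \<Longrightarrow> c dvd \<pi> * q \<Longrightarrow> is_unit c"
  shows "irreducible [:\<pi> * q, 0, P:]"
proof (rule irreducibleI)
  have P: "P \<noteq> 0" using \<pi>(2) by auto
  show "[:\<pi> * q, 0, P:] \<noteq> 0" using P by simp
  show "\<not> is_unit [:\<pi> * q, 0, P:]" using P by (auto simp: is_unit_poly_iff)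
  fix f g assume fg: "[:\<pi> * q, 0, P:] = f * g"
  then have nz: "f \<noteq> 0" "g \<noteq> 0" using P by auto
  have "degree (f * g) = 2" unfolding fg[symmetric] using P by simp
  then have deg: "degree f + degree g = 2" using nz by (simp add: degree_mult_eq)
  have const: "is_unit f" if "degree f = 0" "[:\<pi> * q, 0, P:] = f * g" for f g
  proof -
    obtain c where c: "f = [:c:]" using \<open>degree f = 0\<close> degree_eq_zeroE by blast
    have "c dvd coeff [:\<pi> * q, 0, P:] n" for n unfolding that(2) c by simp
    from this[of 0] this[of 2] have "is_unit c"
      by (intro cop) (simp_all add: numeral_2_eq_2)
    then show ?thesis by (simp add: c is_unit_const_poly_iff)
  qed
  show "is_unit f \<or> is_unit g"
  proof (rule ccontr)
    assume "\<not> (is_unit f \<or> is_unit g)"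
    then have "degree f \<noteq> 0" "degree g \<noteq> 0" using const[of f g] const[of g f] fg by (auto simp: mult.commute)
    with deg have "degree f = 1" "degree g = 1" by auto
    then obtain a b c d where f: "f = [:b, a:]" and g: "g = [:d, c:]"
      using degree_less_2_conv[of f] degree_less_2_conv[of g] by simp
    have e: "b * d = \<pi> * q" "a * d + b * c = 0" "a * c = P"
      using fg by (simp_all add: f g algebra_simps)
    have "\<pi> dvd b * d" by (simp add: e)
    moreover have False if "\<pi> dvd b" "b * d = \<pi> * q" "a * d + b * c = 0" "a * c = P" for a b c d
    proof -
      obtain b' where b': "b = \<pi> * b'" using \<open>\<pi> dvd b\<close> by blast
      have "\<pi> * (b' * d) = \<pi> * q" using that(2) b' by (simp add: mult.assoc)
      then have "b' * d = q" using \<pi>(1) by (auto simp: prime_elem_def)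
      then have "\<not> \<pi> dvd d" using \<pi>(3) by auto
      moreover have "\<pi> dvd a * d"
      proof -
        have "a * d = \<pi> * (- (b' * c))" using that(3) b' by (simp add: add_eq_0_iff2 mult.assoc)
        then show ?thesis by simp
      qed
      ultimately have "\<pi> dvd a" using \<pi>(1) by (auto simp: prime_elem_dvd_mult_iff)
      then have "\<pi> dvd P" using that(4) by auto
      with \<pi>(2) show False by simp
    qed
    from this[of b d a c] this[of d b c a] have "\<not> \<pi> dvd b" "\<not> \<pi> dvd d"
      using e by (auto simp: algebra_simps)
    ultimately show False using \<pi>(1) by (auto simp: prime_elem_dvd_mult_iff)
  qed
qed

lemma prime_elem_monic_linear:
  fixes a :: "'a::{idom_divide,algebraic_semidom}"
  shows "prime_elem [:- a, 1:]"
proof (rule prime_elemI)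
  show "\<not> is_unit [:- a, 1:]" by (auto simp: is_unit_poly_iff)
  fix f g assume "[:- a, 1:] dvd f * g"
  then show "[:- a, 1:] dvd f \<or> [:- a, 1:] dvd g" by (simp add: poly_eq_0_iff_dvd[symmetric])
qed simp

type_synonym poly3 = "complex poly poly poly"

definition eC :: "complex poly poly" where "eC = [:0, 1:]"
definition eS :: "complex poly" where "eS = [:0, -1, 1:]"

text \<open>With S = R^2 - R, \<open>Fr\<close> is A^2 (1 + S B^2)(1 + S C^2) + (C^2 - 4 + B^2 (1 +
  S C^2)). \<open>F_const\<close> and \<open>F_lead\<close> are its coefficients in A, written as
  polynomials in B over C over R.\<close>

definition F_const :: poly3 where
  "F_const = [:eC * eC - 4, 0, 1 + [:eS:] * (eC * eC):]"

definition F_lead :: poly3 where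
  "F_lead = [:1, 0, [:eS:]:] * [:1 + [:eS:] * (eC * eC):]"

definition F4 :: "poly3 poly" where
  "F4 = [:F_const, 0, F_lead:]"

lemma eS_nonzero: "1 + eS * 4 \<noteq> 0"
proof
  assume "1 + eS * 4 = 0"
  then have "poly (1 + eS * 4) 0 = 0" by simp
  then show False by (simp add: eS_def)
qed

lemma eS_nonzero': "1 + 4 * eS \<noteq> 0"
  using eS_nonzero by (simp add: mult.commute)

lemma irreducible_F_const: "irreducible F_const"
proof -
  \<comment> \<open>Eisenstein in B at the prime C - 2, which divides C^2 - 4 exactly once.\<close>
  let ?\<pi> = "[:- 2, 1:] :: complex poly poly" and ?q = "[:2, 1:] :: complex poly poly"
  let ?P = "1 + [:eS:] * (eC * eC)"
  have P2: "poly ?P 2 = 1 + eS * 4" by (simp add: eC_def)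
  have pq: "?\<pi> * ?q = eC * eC - 4"
    by (simp add: eC_def numeral_poly)
  have "irreducible [:?\<pi> * ?q, 0, ?P:]"
  proof (rule eisenstein_quadratic)
    show "prime_elem ?\<pi>" using prime_elem_monic_linear[of 2] by simp
    show "\<not> ?\<pi> dvd ?P" using P2 eS_nonzero poly_eq_0_iff_dvd[of ?P 2] by auto
    show "\<not> ?\<pi> dvd ?q" using poly_eq_0_iff_dvd[of ?q 2] by auto
    fix c assume c: "c dvd ?P" "c dvd ?\<pi> * ?q"
    \<comment> \<open>Eliminating C^2 leaves 1 + 4S, a nonzero constant in C, so a common divisor is
      free of C; as it divides the monic C^2 - 4, it is a unit.\<close>
    have "c dvd ?P - [:eS:] * (?\<pi> * ?q)" by (rule dvd_diff[OF c(1) dvd_mult[OF c(2)]])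
    also have "?P - [:eS:] * (?\<pi> * ?q) = [:1 + eS * 4:]"
      unfolding pq by (simp add: algebra_simps numeral_poly one_pCons)
    finally have "degree c \<le> 0" using eS_nonzero dvd_imp_degree_le[of c "[:1 + eS * 4:]"] by auto
    then obtain k where k: "c = [:k:]" using degree_eq_zeroE by blast
    have "[:k:] dvd [:- 4, 0, 1:]" using c(2) by (simp add: k)
    then have "k dvd coeff [:- 4, 0, 1:] 2" unfolding const_poly_dvd_iff by blast
    then have "is_unit k" by (simp add: numeral_2_eq_2)
    then show "is_unit c" by (simp add: k is_unit_const_poly_iff)
  qed
  then show ?thesis by (simp only: pq F_const_def)
qed

lemma F_const_not_dvd_F_lead: "\<not> F_const dvd F_lead"
proof
  assume "F_const dvd F_lead"
  then obtain g where "F_lead = F_const * g" by blast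
  \<comment> \<open>At B = 0 and C = 2 the polynomial \<open>F_const\<close> vanishes, while
    \<open>F_lead\<close> takes the value 1 + 4S.\<close>
  then have "poly (poly F_lead 0) 2 = poly (poly (F_const * g) 0) 2"
    by (rule arg_cong[where f = "\<lambda>p. poly (poly p 0) 2"])
  also have "\<dots> = poly (poly F_const 0) 2 * poly (poly g 0) 2" by (simp only: poly_mult)
  finally show False using eS_nonzero eS_nonzero' by (simp add: F_lead_def F_const_def eC_def)
qed

lemma prime_elem_F4: "prime_elem F4"
proof -
  have prime: "prime_elem F_const" by (rule irreducible_imp_prime_elem[OF irreducible_F_const])
  \<comment> \<open>Eisenstein in A, with \<open>F_const\<close> itself as the prime.\<close>
  have "irreducible [:F_const * 1, 0, F_lead:]"
  proof (rule eisenstein_quadratic)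
    show "prime_elem F_const" by (rule prime)
    show "\<not> F_const dvd F_lead" by (rule F_const_not_dvd_F_lead)
    show "\<not> F_const dvd 1" using prime by (auto simp: prime_elem_def)
    fix c assume c: "c dvd F_lead" "c dvd F_const * 1"
    then have "is_unit c \<or> F_const dvd c" using irreducibleD'[OF irreducible_F_const, of c] by auto
    then show "is_unit c" using c(1) F_const_not_dvd_F_lead dvd_trans by blast
  qed
  then have "irreducible F4" by (simp only: F4_def mult_1_right)
  then show ?thesis by (rule irreducible_imp_prime_elem)
qed

section \<open>Points of the toric hypersurface\<close>

definition ev4 :: "complex \<Rightarrow> complex \<Rightarrow> complex \<Rightarrow> complex \<Rightarrow> poly3 poly \<Rightarrow> complex" where
  "ev4 a b c r f = poly (poly (poly (poly f [:[:[:a:]:]:]) [:[:b:]:]) [:c:]) r"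

definition ev3 :: "complex \<Rightarrow> complex \<Rightarrow> complex \<Rightarrow> poly3 \<Rightarrow> complex" where
  "ev3 b c r f = poly (poly (poly f [:[:b:]:]) [:c:]) r"

lemma rhom_ev4: "rhom (ev4 a b c r)" and rhom_ev3: "rhom (ev3 b c r)"
  by (simp_all add: rhom_def ev4_def ev3_def)

lemma poly_nonzero_at:
  fixes p :: "'a::idom poly" and k :: "complex \<Rightarrow> 'a"
  assumes "p \<noteq> 0" "inj k"
  shows "\<exists>t. poly p (k t) \<noteq> 0"
proof (rule ccontr)
  assume "\<not> ?thesis"
  then have "range k \<subseteq> {x. poly p x = 0}" by auto
  moreover have "infinite (range k)" using assms(2) by (simp add: finite_image_iff infinite_UNIV_char_0)
  ultimately show False using poly_roots_finite[OF assms(1)] finite_subset by blast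
qed

lemma ev3_nonzero:
  assumes "f \<noteq> 0"
  shows "\<exists>b c r. ev3 b c r f \<noteq> 0"
proof -
  obtain b where b: "poly f [:[:b:]:] \<noteq> 0"
    using poly_nonzero_at[OF assms, of "\<lambda>t. [:[:t:]:]"] by (auto simp: inj_def)
  obtain c where c: "poly (poly f [:[:b:]:]) [:c:] \<noteq> 0"
    using poly_nonzero_at[OF b, of "\<lambda>t. [:t:]"] by (auto simp: inj_def)
  obtain r where "poly (poly (poly f [:[:b:]:]) [:c:]) r \<noteq> 0"
    using poly_nonzero_at[OF c, of "\<lambda>t. t"] by (auto simp: inj_def)
  then show ?thesis unfolding ev3_def by blast
qed

lemma F_lead_nonzero: "F_lead \<noteq> 0"
  using F_const_not_dvd_F_lead by auto

text \<open>If \<open>F\<close> does not divide \<open>f\<close>, the norm of the remainder of \<open>f\<close> modulo \<open>F\<close> is a nonzero polynomial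
  in the remaining three variables.\<close>

lemma F4_point:
  assumes "\<not> F4 dvd f"
  shows "\<exists>a b c r. ev4 a b c r F4 = 0 \<and> ev4 a b c r f \<noteq> 0"
proof -
  have deg: "degree F4 = 2" and lc: "coeff F4 2 = F_lead" and F4: "F4 \<noteq> 0"
    using F_lead_nonzero by (simp_all add: F4_def numeral_2_eq_2)
  \<comment> \<open>The leading coefficient is not a unit, so division is possible only after
    multiplying f by a power of \<open>F_lead\<close>.\<close>
  obtain q g where qg: "pseudo_divmod f F4 = (q, g)" by (meson surj_pair)
  define n where "n = Suc (degree f) - degree F4"
  have e: "smult (F_lead ^ n) f = F4 * q + g" and g: "g = 0 \<or> degree g < 2"
    using pseudo_divmod[OF F4 qg] unfolding n_def deg lc by blast+
  have small: "\<not> F4 dvd h" if "h \<noteq> 0" "degree h < 2" for h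
    using that dvd_imp_degree_le[of F4 h] deg by auto
  have not_lead: "\<not> F4 dvd [:F_lead ^ n:]" for n
    by (rule small) (use F_lead_nonzero in auto)
  have "g \<noteq> 0"
  proof
    assume "g = 0"
    then have "F4 dvd [:F_lead ^ n:] * f" using e by simp
    then show False using prime_elem_dvd_multD[OF prime_elem_F4] not_lead assms by blast
  qed
  then obtain g0 g1 where g01: "g = [:g0, g1:]"
    using g degree_less_2_conv[of g] by auto
  \<comment> \<open>\<open>F_lead\<close> times the norm (g0 + g1 A)(g0 - g1 A), with A^2 eliminated
    by means of \<open>F4\<close>.\<close>
  define N where "N = F_lead * g0 * g0 + F_const * g1 * g1"
  have "N \<noteq> 0"
  proof
    assume N: "N = 0"
    have "[:F_lead ^ 1:] * (g * [:g0, - g1:]) = F4 * [:- (g1 * g1):] + [:N:]"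
      unfolding g01 F4_def N_def by (simp add: algebra_simps)
    then have "[:F_lead ^ 1:] * (g * [:g0, - g1:]) = F4 * [:- (g1 * g1):]"
      unfolding N pCons_0_0 add_0_right .
    then have "F4 dvd [:F_lead ^ 1:] * (g * [:g0, - g1:])" by (simp only: dvd_triv_left)
    then have "F4 dvd g \<or> F4 dvd [:g0, - g1:]"
      using prime_elem_dvd_multD[OF prime_elem_F4] not_lead[of 1] by blast
    moreover have "[:g0, - g1:] \<noteq> 0" using \<open>g \<noteq> 0\<close> g01 by auto
    ultimately show False using small[of g] small[of "[:g0, - g1:]"] \<open>g \<noteq> 0\<close> g by auto
  qed
  then have "N * F_lead \<noteq> 0" using F_lead_nonzero by simp
  then obtain b c r where "ev3 b c r (N * F_lead) \<noteq> 0" using ev3_nonzero by blast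
  then have nz: "ev3 b c r N \<noteq> 0" "ev3 b c r F_lead \<noteq> 0" by (auto simp: rhom_mult[OF rhom_ev3])
  define a where "a = csqrt (- ev3 b c r F_const / ev3 b c r F_lead)"
  have aa: "a * a * ev3 b c r F_lead + ev3 b c r F_const = 0"
    using power2_csqrt[of "- ev3 b c r F_const / ev3 b c r F_lead"] nz(2) by (simp add: a_def power2_eq_square)
  have ev_pCons: "ev4 a b c r (pCons k p) = ev3 b c r k + a * ev4 a b c r p" for k p
    by (simp add: ev4_def ev3_def)
  have ev_0: "ev4 a b c r 0 = 0" by (simp add: ev4_def)
  have F0: "ev4 a b c r F4 = 0"
    using aa by (simp add: F4_def ev_pCons ev_0 rhom_zero[OF rhom_ev3] algebra_simps)
  have "ev4 a b c r f \<noteq> 0"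
  proof
    assume f0: "ev4 a b c r f = 0"
    have "ev4 a b c r ([:F_lead ^ n:] * f) = ev4 a b c r (F4 * q + g)" using e by simp
    then have "ev4 a b c r g = 0"
      unfolding rhom_add[OF rhom_ev4] rhom_mult[OF rhom_ev4] f0 F0 by simp
    then have "ev3 b c r g0 + a * ev3 b c r g1 = 0" by (simp add: g01 ev_pCons ev_0)
    then have g0: "ev3 b c r g0 = - (a * ev3 b c r g1)" by (simp add: add_eq_0_iff2)
    have "ev3 b c r N = (a * a * ev3 b c r F_lead + ev3 b c r F_const) * (ev3 b c r g1 * ev3 b c r g1)"
      by (simp add: N_def rhom_simps[OF rhom_ev3] g0 algebra_simps)
    with aa nz(1) show False by simp
  qed
  with F0 show ?thesis by blast
qed

text \<open>An isomorphism onto iterated univariate polynomials, with A outermost and R innermost,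
  which transports divisibility in both directions.\<close>

definition nest :: "rv mpoly \<Rightarrow> poly3 poly" where
  "nest = meval (\<lambda>c. [:[:[:[:c:]:]:]:]) (\<lambda>v. case v of RA \<Rightarrow> [:0, 1:] | RB \<Rightarrow> [:[:0, 1:]:] | RC \<Rightarrow> [:[:[:0, 1:]:]:]
     | RR \<Rightarrow> [:[:[:[:0, 1:]:]:]:])"

lemma rhom_const4: "rhom (\<lambda>c::complex. [:[:[:[:c:]:]:]:])"
  by (intro rhom_pCons rhom_id)

lemma rhom_nest: "rhom nest"
  unfolding nest_def by (rule rhom_meval[OF rhom_const4])

lemma nest_vars: "nest (mConst c) = [:[:[:[:c:]:]:]:]" "nest rA = [:0, 1:]" "nest rB = [:[:0, 1:]:]"
  "nest rC = [:[:[:0, 1:]:]:]" "nest rR = [:[:[:[:0, 1:]:]:]:]"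
  by (simp_all add: nest_def meval_mConst[OF rhom_const4] meval_mVar[OF rhom_const4])

lemmas nest_simps = rhom_simps[OF rhom_nest] nest_vars

lemma ev4_nest: "ev4 (\<tau> RA) (\<tau> RB) (\<tau> RC) (\<tau> RR) (nest p) = ev \<tau> p"
proof (rule rhom_eqI[OF rhom_comp[OF rhom_ev4 rhom_nest] rhom_ev])
  show "ev4 (\<tau> RA) (\<tau> RB) (\<tau> RC) (\<tau> RR) (nest (mVar v)) = ev \<tau> (mVar v)" for v
    by (cases v) (simp_all add: nest_vars ev4_def)
qed (simp add: nest_vars ev4_def)

lemma nest_inj: "nest p = nest q \<longleftrightarrow> p = q"
proof
  assume "nest p = nest q"
  then have "ev \<tau> (p - q) = 0" for \<tau>
    unfolding ev4_nest[symmetric] by (simp add: rhom_diff[OF rhom_nest] rhom_zero[OF rhom_ev4])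
  then have "p - q = 0" by (rule ev_all_zero_imp_zero)
  then show "p = q" by simp
qed simp

lemma pCons_split: "pCons a (p :: 'c::comm_ring_1 poly) = [:a:] + [:0, 1:] * p"
  by simp

lemma nest_image_poly:
  fixes f :: "'c::comm_ring_1 poly" and \<phi> :: "'c poly \<Rightarrow> poly3 poly"
  assumes c: "\<And>a. \<exists>p. nest p = \<phi> [:a:]" and x: "\<exists>p. nest p = \<phi> [:0, 1:]" and \<phi>: "rhom \<phi>"
  shows "\<exists>p. nest p = \<phi> f"
proof (induction f)
  case 0
  show ?case by (rule exI[of _ 0]) (simp add: rhom_zero[OF \<phi>] rhom_zero[OF rhom_nest])
next
  case (pCons a f)
  obtain p q s where *: "nest p = \<phi> [:a:]" "nest q = \<phi> [:0, 1:]" "nest s = \<phi> f"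
    using c x pCons.IH by blast
  have "\<phi> (pCons a f) = nest (p + q * s)"
    by (simp only: pCons_split[of a f] rhom_add[OF \<phi>] rhom_mult[OF \<phi>] rhom_add[OF rhom_nest] rhom_mult[OF rhom_nest] *)
  then show ?case by metis
qed

lemma nest_surj: "\<exists>p. nest p = f"
proof -
  have 1: "\<exists>p. nest p = [:[:[:f:]:]:]" for f :: "complex poly"
  proof (rule nest_image_poly[where \<phi> = "\<lambda>f. [:[:[:f:]:]:]"])
    show "rhom (\<lambda>f :: complex poly. [:[:[:f:]:]:])" by (simp add: rhom_def one_pCons)
  qed (use nest_vars in blast)+
  have 2: "\<exists>p. nest p = [:[:f:]:]" for f :: "complex poly poly"
  proof (rule nest_image_poly[where \<phi> = "\<lambda>f. [:[:f:]:]"])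
    show "rhom (\<lambda>f :: complex poly poly. [:[:f:]:])" by (simp add: rhom_def one_pCons)
  qed (use 1 nest_vars in blast)+
  have 3: "\<exists>p. nest p = [:f:]" for f :: "complex poly poly poly"
  proof (rule nest_image_poly[where \<phi> = "\<lambda>f. [:f:]"])
    show "rhom (\<lambda>f :: complex poly poly poly. [:f:])" by (simp add: rhom_def one_pCons)
  qed (use 2 nest_vars in blast)+
  show ?thesis
    by (rule nest_image_poly[where \<phi> = "\<lambda>f. f"]) (use 3 nest_vars rhom_id in blast)+
qed

lemma nest_dvd: "nest p dvd nest q \<longleftrightarrow> p dvd q"
proof
  assume "nest p dvd nest q"
  then obtain k where k: "nest q = nest p * k" by blast
  obtain l where "nest l = k" using nest_surj by blast
  then have "nest q = nest (p * l)" using k by (simp add: rhom_mult[OF rhom_nest])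
  then show "p dvd q" by (simp add: nest_inj)
next
  assume "p dvd q"
  then show "nest p dvd nest q" by (auto simp: rhom_mult[OF rhom_nest] elim!: dvdE)
qed

lemma nest_Fr: "nest Fr = F4"
proof -
  define p1 p2 p3 where "p1 = 1 + (rR*rR - rR)*(rC*rC)" and "p2 = 1 + (rR*rR - rR)*(rB*rB)" and "p3 = rC*rC - 4"
  have Fr: "Fr = rA*rA * (p2 * p1) + (p3 + rB*rB * p1)"
    by (simp add: p1_def p2_def p3_def Fr_def fricke_def pP_def qQ_def toric_simps power2_eq_square algebra_simps)
  have "nest p1 = [:[:1 + [:eS:] * (eC * eC):]:]"
    by (simp add: p1_def nest_simps eS_def eC_def one_pCons)
  moreover have "nest p2 = [:[:1, 0, [:eS:]:]:]"
    by (simp add: p2_def nest_simps eS_def one_pCons)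
  moreover have "nest p3 = [:[:eC * eC - 4:]:]"
    by (simp add: p3_def nest_simps eC_def numeral_poly)
  ultimately have "nest (rA*rA * (p2 * p1) + (p3 + rB*rB * p1)) =
      [:0, 1:] * [:0, 1:] * ([:[:1, 0, [:eS:]:]:] * [:[:1 + [:eS:] * (eC * eC):]:])
      + ([:[:eC * eC - 4:]:] + [:[:0, 1:]:] * [:[:0, 1:]:] * [:[:1 + [:eS:] * (eC * eC):]:])"
    unfolding rhom_add[OF rhom_nest] rhom_mult[OF rhom_nest] nest_vars by (simp only:)
  also have "\<dots> = F4"
    unfolding F4_def F_const_def F_lead_def by simp
  finally show ?thesis unfolding Fr .
qed

lemma Fr_prime: "Fr dvd p * q \<Longrightarrow> Fr dvd p \<or> Fr dvd q"
  using prime_elem_F4 unfolding nest_dvd[symmetric] rhom_mult[OF rhom_nest] nest_Fr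
  by (simp add: prime_elem_dvd_mult_iff)

lemma Fr_not_unit: "\<not> Fr dvd 1"
  using prime_elem_F4 unfolding nest_dvd[symmetric] rhom_one[OF rhom_nest] nest_Fr
  by (simp add: prime_elem_def)

text \<open>The Nullstellensatz for this one hypersurface.\<close>

lemma Fr_point:
  assumes "\<not> Fr dvd p"
  shows "\<exists>\<tau>. ev \<tau> Fr = 0 \<and> ev \<tau> p \<noteq> 0"
proof -
  obtain a b c r where "ev4 a b c r F4 = 0" "ev4 a b c r (nest p) \<noteq> 0"
    using F4_point[of "nest p"] assms unfolding nest_dvd[symmetric] nest_Fr by blast
  then show ?thesis
    using ev4_nest[of "\<lambda>v. case v of RA \<Rightarrow> a | RB \<Rightarrow> b | RC \<Rightarrow> c | RR \<Rightarrow> r"]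
    by (intro exI[of _ "\<lambda>v. case v of RA \<Rightarrow> a | RB \<Rightarrow> b | RC \<Rightarrow> c | RR \<Rightarrow> r"]) (simp flip: nest_Fr)
qed

lemma is_ideal_I_0: "is_ideal I_0"
  unfolding I_0_def by (rule is_ideal_gen_ideal)

lemma I_0_prime: "is_prime_ideal I_0"
  unfolding is_prime_ideal_def
  using is_ideal_I_0 Fr_not_unit Fr_prime by (auto simp: I_0_iff rhom_simps[OF rhom_toric])

section \<open>Irreducible representations in the toric component\<close>

lemma cross_zero:
  fixes a1 :: complex
  assumes "det3 a1 a2 a3 b1 b2 b3 c1 c2 c3 \<noteq> 0" "a1*e1 + a2*e2 + a3*e3 = 0" "b1*e1 + b2*e2 + b3*e3 = 0"
    "c1*e1 + c2*e2 + c3*e3 = 0"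
  shows "e1 = 0 \<and> e2 = 0 \<and> e3 = 0"
proof -
  let ?d = "det3 a1 a2 a3 b1 b2 b3 c1 c2 c3"
  let ?A = "a1*e1 + a2*e2 + a3*e3" and ?B = "b1*e1 + b2*e2 + b3*e3" and ?C = "c1*e1 + c2*e2 + c3*e3"
  have "?d * e1 = (b2*c3 - b3*c2) * ?A + (c2*a3 - c3*a2) * ?B + (a2*b3 - a3*b2) * ?C"
    "?d * e2 = (b3*c1 - b1*c3) * ?A + (c3*a1 - c1*a3) * ?B + (a3*b1 - a1*b3) * ?C"
    "?d * e3 = (b1*c2 - b2*c1) * ?A + (c1*a2 - c2*a1) * ?B + (a1*b2 - a2*b1) * ?C"
    by (simp_all add: det3_def algebra_simps)
  then have "?d * e1 = 0" "?d * e2 = 0" "?d * e3 = 0" by (simp_all only: assms(2-4)) simp_all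
  then show ?thesis using assms(1) by simp
qed

text \<open>If d is nonzero, a, b, c form a basis. A cross product with a pairs to zero with a
  anyway, so it vanishes once its pairings with b and c do.\<close>

lemma relator_of_gram:
  fixes x y z a1 a2 a3 b1 b2 b3 c1 c2 c3 :: complex
  assumes A: "x * x + (a1 * a1 + a2 * a2 + a3 * a3) = 1" and B: "y * y + (b1 * b1 + b2 * b2 + b3 * b3) = 1"
    and C: "z * z + (c1 * c1 + c2 * c2 + c3 * c3) = 1"
    and u: "u = b1*c1+b2*c2+b3*c3" and v: "v = a1*c1+a2*c2+a3*c3" and w: "w = a1*b1+a2*b2+a3*b3"
    and d: "d = - det3 a1 a2 a3 b1 b2 b3 c1 c2 c3" "d \<noteq> 0"
    and e: "Eb x y z u v w d = 0" "Ec x y z u v w d = 0"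
  shows "mcomm (cq.qmat x a1 a2 a3) (mcomm (cq.qmat y b1 b2 b3) (madj (cq.qmat z c1 c2 c3))) = mid"
proof -
  have B': "1 - y * y = b1 * b1 + b2 * b2 + b3 * b3" and C': "1 - z * z = c1 * c1 + c2 * c2 + c3 * c3"
    using B C by (simp_all add: algebra_simps)
  define l p q where "l = y*z+u" and "p = z*u - y*(1-z*z)" and "q = y*u - z*(1-y*y)"
  define w1 w2 w3 where "w1 = l*(b2*c3 - b3*c2) + p*b1 + q*c1" and "w2 = l*(b3*c1 - b1*c3) + p*b2 + q*c2"
    and "w3 = l*(b1*c2 - b2*c1) + p*b3 + q*c3"
  have cv: "cq.commvec y b1 b2 b3 z c1 c2 c3 = w1" "cq.commvec y b2 b3 b1 z c2 c3 c1 = w2"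
    "cq.commvec y b3 b1 b2 z c3 c1 c2 = w3"
    unfolding cq.commvec_def w1_def w2_def w3_def l_def p_def q_def B' C' u by (simp_all add: algebra_simps)
  define e1 e2 e3 where "e1 = a2*w3 - a3*w2" and "e2 = a3*w1 - a1*w3" and "e3 = a1*w2 - a2*w1"
  have "e1 = 0 \<and> e2 = 0 \<and> e3 = 0"
  proof (rule cross_zero)
    show "det3 a1 a2 a3 b1 b2 b3 c1 c2 c3 \<noteq> 0" using d by auto
    show "a1*e1 + a2*e2 + a3*e3 = 0" by (simp add: e1_def e2_def e3_def algebra_simps)
    have "b1*e1 + b2*e2 + b3*e3 = l*((b1*b1+b2*b2+b3*b3)*v - u*w) + q*d"
      unfolding e1_def e2_def e3_def w1_def w2_def w3_def u v w d(1) det3_def by (simp add: algebra_simps)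
    also have "\<dots> = Eb x y z u v w d" unfolding Eb_def B'[symmetric] l_def q_def by simp
    finally show "b1*e1 + b2*e2 + b3*e3 = 0" by (simp add: e)
    have "c1*e1 + c2*e2 + c3*e3 = l*(u*v - (c1*c1+c2*c2+c3*c3)*w) - p*d"
      unfolding e1_def e2_def e3_def w1_def w2_def w3_def u v w d(1) det3_def by (simp add: algebra_simps)
    also have "\<dots> = Ec x y z u v w d" unfolding Ec_def C'[symmetric] l_def p_def by simp
    finally show "c1*e1 + c2*e2 + c3*e3 = 0" by (simp add: e)
  qed
  then show ?thesis
    unfolding cq.relator_iff[OF A B C] cv e1_def e2_def e3_def by simp
qed

lemma csqrt_square: "csqrt z * csqrt z = z"
  using power2_csqrt[of z] by (simp add: power2_eq_square)

text \<open>Realises a prescribed Gram matrix in triangular coordinates a = (a1, 0, 0), b = (b1, b2,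
  0), as in Gram-Schmidt; the first two leading minors must not vanish.\<close>

lemma ev_gpt_irreducible:
  assumes d: "d * d = gram_det (1-x*x) (1-y*y) (1-z*z) u v w" "d \<noteq> 0"
    and nz: "1 - x*x \<noteq> 0" "(1-x*x)*(1-y*y) - w*w \<noteq> 0"
    and e: "Eb x y z u v w d = 0" "Ec x y z u v w d = 0" "Eb y z x v w u d = 0" "Ec y z x v w u d = 0"
      "Eb z x y w u v d = 0" "Ec z x y w u v d = 0"
    and p: "tproj p = 0"
  shows "ev (gpt x y z u v w d) p = 0"
proof -
  define a1 where "a1 = csqrt (1 - x*x)"
  define b1 where "b1 = w / a1"
  define b2 where "b2 = csqrt (1 - y*y - b1*b1)"
  define c1 where "c1 = v / a1"
  define c2 where "c2 = (u - b1*c1) / b2"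
  \<comment> \<open>The determinant a1 b2 c3 has to be - d.\<close>
  define c3 where "c3 = - d / (a1 * b2)"
  have aa: "a1*a1 = 1 - x*x" by (simp add: a1_def csqrt_square)
  then have a0: "a1 \<noteq> 0" using nz(1) by auto
  have bb: "b1*b1 + b2*b2 = 1 - y*y" by (simp add: b2_def csqrt_square)
  have w: "w = a1*b1" using a0 by (simp add: b1_def)
  have v: "v = a1*c1" using a0 by (simp add: c1_def)
  have "a1*a1*(b2*b2) = (1-x*x)*(1-y*y) - w*w"
    unfolding aa[symmetric] bb[symmetric] w by (simp add: algebra_simps)
  then have b0: "b2 \<noteq> 0" using nz(2) by auto
  have u: "u = b1*c1 + b2*c2" using b0 by (simp add: c2_def)
  have det: "d = - det3 a1 0 0 b1 b2 0 c1 c2 c3"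
    using a0 b0 by (simp add: det3_def c3_def)
  have "d * d = det3 a1 0 0 b1 b2 0 c1 c2 c3 * det3 a1 0 0 b1 b2 0 c1 c2 c3" by (simp add: det)
  also have "\<dots> = gram_det (1-x*x) (1-y*y) (c1*c1+c2*c2+c3*c3) u v w"
    unfolding det3_square by (simp add: aa bb u v w)
  finally have "gram_det (1-x*x) (1-y*y) (1-z*z) u v w = gram_det (1-x*x) (1-y*y) (c1*c1+c2*c2+c3*c3) u v w"
    using d(1) by simp
  \<comment> \<open>The Gram determinant is affine in the square of c, with the minor of a and b as
    slope, so equal determinants give c the right square.\<close>
  then have "((1-x*x)*(1-y*y) - w*w) * (1 - z*z) = ((1-x*x)*(1-y*y) - w*w) * (c1*c1+c2*c2+c3*c3)"
    by (simp add: gram_det_def algebra_simps)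
  then have cc: "1 - z*z = c1*c1+c2*c2+c3*c3" using nz(2) by (simp only: mult_cancel_left) simp
  have A: "x * x + (a1 * a1 + 0 * 0 + 0 * 0) = 1" and B: "y * y + (b1 * b1 + b2 * b2 + 0 * 0) = 1"
    and C: "z * z + (c1 * c1 + c2 * c2 + c3 * c3) = 1"
    using aa bb cc by (simp_all add: algebra_simps)
  have g: "u = b1*c1+b2*c2+0*c3" "v = a1*c1+0*c2+0*c3" "w = a1*b1+0*b2+0*0"
    "u = c1*b1+c2*b2+c3*0" "v = c1*a1+c2*0+c3*0" "w = b1*a1+b2*0+0*0"
    by (simp_all add: u v w mult.commute)
  have det': "d = - det3 b1 b2 0 c1 c2 c3 a1 0 0" "d = - det3 c1 c2 c3 a1 0 0 b1 b2 0"
    using det by (simp_all only: det3_rotate)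
  have "ev (gpt x y z (b1*c1+b2*c2+0*c3) (a1*c1+0*c2+0*c3) (a1*b1+0*b2+0*0)
     (- det3 a1 0 0 b1 b2 0 c1 c2 c3)) p = 0"
    by (rule ev_gpt_representation[OF A B C
        relator_of_gram[OF A B C g(1) g(2) g(3) det d(2) e(1,2)]
        relator_of_gram[OF B C A g(5) g(6) g(1) det'(1) d(2) e(3,4)]
        relator_of_gram[OF C A B g(3) g(4) g(5) det'(2) d(2) e(5,6)] p])
  then show ?thesis using g(1-3) det by simp
qed

lemma ev_gpt_fricke: "ev (gpt x y z u v w d) fricke = 4 * (d*d - gram_det (1-x*x) (1-y*y) (1-z*z) u v w)"
  by (simp add: fricke_def pP_def qQ_def ev_simps gram_det_def power2_eq_square algebra_simps)

text \<open>Up to a constant, the product of 1 - x^2, the Gram minor of a and b, and d, which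
  \<open>ev_gpt_irreducible\<close> requires to be nonzero.\<close>

definition generic :: "rv mpoly" where
  "generic = (4 - rA*rA) * (((4 - rA*rA)*(4 - rB*rB) - (rA*rB*(1-2*rR))*(rA*rB*(1-2*rR))) *
     (rA*rB*rC*((2*rR-1)*(rR-1))))"

lemma kernel_at_generic_point:
  assumes p: "tproj p = 0" and F: "ev \<tau> Fr = 0" and g: "ev \<tau> generic \<noteq> 0"
  shows "ev \<tau> (toric p) = 0"
proof -
  \<comment> \<open>\<rho> is the common ratio w/(xy) = v/(xz) = u/(yz). From t_ab = A B R one gets
    \<rho> = 1 - 2R, and then t_abc = A B C R^2 determines d.\<close>
  define x y z \<rho> where "x = \<tau> RA / 2" and "y = \<tau> RB / 2" and "z = \<tau> RC / 2" and "\<rho> = 1 - 2 * \<tau> RR"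
  define u v w d where "u = y*z*\<rho>" and "v = x*z*\<rho>" and "w = x*y*\<rho>" and "d = x*y*z*(\<rho>*(1+\<rho>))"
  have \<tau>: "\<tau> RA = 2*x" "\<tau> RB = 2*y" "\<tau> RC = 2*z" "\<tau> RR = (1 - \<rho>) / 2"
    by (simp_all add: x_def y_def z_def \<rho>_def)
  have pt: "(\<lambda>t. ev \<tau> (sub_0 t)) = gpt x y z u v w d"
  proof
    show "ev \<tau> (sub_0 t) = gpt x y z u v w d t" for t
      by (cases t) (simp_all add: sub_0_def ev_simps \<tau> u_def v_def w_def d_def field_simps)
  qed
  have tor: "ev \<tau> (toric q) = ev (gpt x y z u v w d) q" for q
    unfolding toric_def ev_msubst pt ..
  have "4 * (d*d - gram_det (1-x*x) (1-y*y) (1-z*z) u v w) = 0"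
    using F unfolding Fr_def tor ev_gpt_fricke .
  then have dd: "d * d = gram_det (1-x*x) (1-y*y) (1-z*z) u v w" by simp
  have gen: "ev \<tau> generic = (4*(1-x*x)) * ((16*((1-x*x)*(1-y*y) - w*w)) * (4*d))"
    by (simp add: generic_def ev_simps \<tau> w_def d_def field_simps)
  have "ev (gpt x y z u v w d) p = 0"
  proof (rule ev_gpt_irreducible[OF dd _ _ _ _ _ _ _ _ _ p])
    show "d \<noteq> 0" "1 - x*x \<noteq> 0" "(1-x*x)*(1-y*y) - w*w \<noteq> 0" using g gen by auto
    show "Eb x y z u v w d = 0" "Ec x y z u v w d = 0" "Eb y z x v w u d = 0" "Ec y z x v w u d = 0"
      "Eb z x y w u v d = 0" "Ec z x y w u v d = 0"
      by (simp_all add: Eb_def Ec_def u_def v_def w_def d_def algebra_simps)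
  qed
  then show ?thesis by (simp add: tor)
qed

lemma Fr_not_dvd_generic: "\<not> Fr dvd generic"
proof
  assume "Fr dvd generic"
  then obtain h where h: "generic = Fr * h" by blast
  \<comment> \<open>At B = 1, C = 2, R = -1 one has S = 2, and the equation of the hypersurface
    becomes 27 A^2 + 9 = 0.\<close>
  define k where "k = csqrt (-1/3)"
  have kk: "k * k = -1/3" unfolding k_def by (rule csqrt_square)
  then have k0: "k \<noteq> 0" by auto
  let ?\<tau> = "\<lambda>v. case v of RA \<Rightarrow> k | RB \<Rightarrow> 1 | RC \<Rightarrow> 2 | RR \<Rightarrow> -1"
  have kkt: "k * (k * t) = - t / 3" for t using kk by (simp add: mult.assoc[symmetric])
  have "ev ?\<tau> Fr = 0"
    by (simp add: Fr_def fricke_def pP_def qQ_def toric_simps ev_simps power2_eq_square algebra_simps kk kkt)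
  then have "ev ?\<tau> generic = 0" by (simp add: h rhom_mult[OF rhom_ev])
  then show False using k0
    by (simp add: generic_def ev_simps) (auto simp: algebra_simps kk kkt complex_eq_iff)
qed

text \<open>Since \<open>Fr\<close> is prime, multiplication by \<open>generic\<close> preserves
  non-divisibility, so a point witnessing it can be chosen to be the character of a
  representation.\<close>

lemma kernel_subset_I_0:
  assumes "tproj p = 0"
  shows "p \<in> I_0"
  unfolding I_0_iff
proof (rule ccontr)
  assume "\<not> Fr dvd toric p"
  then have "\<not> Fr dvd toric p * generic" using Fr_prime Fr_not_dvd_generic by blast
  then obtain \<tau> where "ev \<tau> Fr = 0" "ev \<tau> (toric p * generic) \<noteq> 0" using Fr_point by blast
  then have "ev \<tau> Fr = 0" "ev \<tau> (toric p) \<noteq> 0" "ev \<tau> generic \<noteq> 0" by (auto simp: rhom_mult[OF rhom_ev])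
  then show False using kernel_at_generic_point[OF assms] by blast
qed

section \<open>The intersection of the eight ideals\<close>

abbreviation cof_aa :: "tvar mpoly" where "cof_aa \<equiv> (4-tb*tb)*(4-tc*tc) - tu*tu"
abbreviation cof_bb :: "tvar mpoly" where "cof_bb \<equiv> (4-ta*ta)*(4-tc*tc) - tv*tv"
abbreviation cof_cc :: "tvar mpoly" where "cof_cc \<equiv> (4-ta*ta)*(4-tb*tb) - tw*tw"
abbreviation cof_bc :: "tvar mpoly" where "cof_bc \<equiv> (4-ta*ta)*tu - tv*tw"
abbreviation cof_ac :: "tvar mpoly" where "cof_ac \<equiv> (4-tb*tb)*tv - tu*tw"
abbreviation cof_ab :: "tvar mpoly" where "cof_ab \<equiv> (4-tc*tc)*tw - tu*tv"

definition tG :: "tvar mpoly" where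
  "tG = gram_det (4-ta*ta) (4-tb*tb) (4-tc*tc) tu tv tw"

text \<open>The diagonal minors are deliberately absent: removing them is what the conditions at the
  six affine components are for.\<close>

definition cof_ideal :: "tvar mpoly set" where
  "cof_ideal = gen_ideal {tE, tG, cof_bc, cof_ac, cof_ab}"

lemma is_ideal_cof_ideal: "is_ideal cof_ideal"
  unfolding cof_ideal_def by (rule is_ideal_gen_ideal)

lemma cof_ideal_mem: "tE \<in> cof_ideal" "tG \<in> cof_ideal" "cof_bc \<in> cof_ideal" "cof_ac \<in> cof_ideal" "cof_ab \<in> cof_ideal"
  unfolding cof_ideal_def by (rule gen_ideal_mem, simp)+

text \<open>The diagonal of the identity Gram matrix times adjugate = determinant.
  \<open>cofactor_expansions\<close> is its off-diagonal part; off the diagonal the adjugate has the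
  entries - \<open>cof\<close>.\<close>

lemma tG_expansions:
  "(4-ta*ta)*cof_aa = tG + tw*cof_ab + tv*cof_ac"
  "(4-tb*tb)*cof_bb = tG + tw*cof_ab + tu*cof_bc"
  "(4-tc*tc)*cof_cc = tG + tv*cof_ac + tu*cof_bc"
  by (simp_all add: tG_def gram_det_def algebra_simps)

lemma cofactor_expansions:
  "tw*cof_aa = (4-tb*tb)*cof_ab + tu*cof_ac" "tv*cof_aa = tu*cof_ab + (4-tc*tc)*cof_ac"
  "tw*cof_bb = (4-ta*ta)*cof_ab + tv*cof_bc" "tu*cof_bb = tv*cof_ab + (4-tc*tc)*cof_bc"
  "tu*cof_cc = (4-tb*tb)*cof_bc + tw*cof_ac" "tv*cof_cc = tw*cof_bc + (4-ta*ta)*cof_ac"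
  by (simp_all add: algebra_simps)

lemma gen_ideal_4:
  "r \<in> gen_ideal {x, v, w, e} \<longleftrightarrow> (\<exists>\<alpha> \<beta> \<gamma> \<delta>. r = \<alpha>*x + \<beta>*v + \<gamma>*w + \<delta>*e)"
proof -
  have "r - \<alpha>*x - \<beta>*v - \<gamma>*w - \<delta>*e = 0 \<longleftrightarrow> r = \<alpha>*x + \<beta>*v + \<gamma>*w + \<delta>*e" for \<alpha> \<beta> \<gamma> \<delta>
    by (auto simp: algebra_simps)
  then show ?thesis unfolding gen_ideal_insert gen_ideal_empty by simp
qed

lemma gen_ideal_change_generators:
  fixes x y1 y2 y3 v w e :: "'x mpoly"
  assumes "2*y1 = c1*x - w" "2*y2 = c2*x - v" "4*y3 = 2*e + c3*x - d1*v - d2*w" and r: "r \<in> gen_ideal {x, y1, y2, y3}"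
  shows "\<exists>\<alpha> \<beta> \<gamma> \<delta>. r = \<alpha>*x + \<beta>*v + \<gamma>*w + \<delta>*e"
proof -
  note I = is_ideal_gen_ideal[of "{x, v, w, e}"]
  have m: "x \<in> gen_ideal {x, v, w, e}" "v \<in> gen_ideal {x, v, w, e}" "w \<in> gen_ideal {x, v, w, e}" "e \<in> gen_ideal {x, v, w, e}"
    by (rule gen_ideal_mem, simp)+
  have "2*y1 \<in> gen_ideal {x, v, w, e}" "2*y2 \<in> gen_ideal {x, v, w, e}" "4*y3 \<in> gen_ideal {x, v, w, e}"
    unfolding assms(1-3) by (intro is_ideal_add[OF I] is_ideal_diff[OF I] is_ideal_mult[OF I] m)+
  then have "y1 \<in> gen_ideal {x, v, w, e}" "y2 \<in> gen_ideal {x, v, w, e}" "y3 \<in> gen_ideal {x, v, w, e}"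
    by (blast intro: is_ideal_numeral_cancel[OF I])+
  with m(1) have "gen_ideal {x, y1, y2, y3} \<subseteq> gen_ideal {x, v, w, e}"
    by (intro gen_ideal_least[OF I]) blast
  with r show ?thesis unfolding gen_ideal_4[symmetric] by blast
qed

text \<open>Reducing r = \<alpha>(t - 2) + ... modulo the ideal of the opposite sign shows that
  \<alpha> lies in that ideal. So r is in the ideal of 4 - t^2, v, w, \<open>tE\<close>, and n
  multiplies each of these into \<open>cof_ideal\<close>.\<close>

lemma both_signs:
  fixes \<phi> :: "tvar mpoly \<Rightarrow> 'x mpoly"
  assumes hom: "rhom \<phi>" and \<phi>: "\<phi> t = mConst (-2)" "\<phi> v = 0" "\<phi> w = 0" "\<phi> tE = 0" "\<phi> r = 0" "\<And>c. \<phi> (mConst c) = mConst c"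
    and ker: "\<And>q. \<phi> q = 0 \<Longrightarrow> \<exists>\<alpha> \<beta> \<gamma> \<delta>. q = \<alpha>*(t - mConst (2*(-1))) + \<beta>*v + \<gamma>*w + \<delta>*tE"
    and r: "\<exists>\<alpha> \<beta> \<gamma> \<delta>. r = \<alpha>*(t - mConst (2*1)) + \<beta>*v + \<gamma>*w + \<delta>*tE"
    and mem: "(4 - t*t)*n \<in> cof_ideal" "v*n \<in> cof_ideal" "w*n \<in> cof_ideal"
  shows "r * n \<in> cof_ideal"
proof -
  note I = is_ideal_cof_ideal
  obtain \<alpha> \<beta> \<gamma> \<delta> where r: "r = \<alpha>*(t - mConst (2*1)) + \<beta>*v + \<gamma>*w + \<delta>*tE" using r by blast
  have "mConst (-4) * \<phi> \<alpha> = \<phi> r"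
    unfolding r by (simp add: rhom_add[OF hom] rhom_mult[OF hom] rhom_diff[OF hom] rhom_numeral[OF hom] \<phi> mConst_simps mult.commute)
  then have "\<phi> \<alpha> = 0"
    using \<phi>(5) is_ideal_mConst_cancel[of "{0}" "-4" "\<phi> \<alpha>"] by (simp add: is_ideal_def)
  then obtain \<alpha>' \<beta>' \<gamma>' \<delta>' where \<alpha>: "\<alpha> = \<alpha>'*(t - mConst (2*(-1))) + \<beta>'*v + \<gamma>'*w + \<delta>'*tE"
    using ker by blast
  define k where "k = t - mConst (2*1)"
  have k: "(t - mConst (2*(-1))) * k = - (4 - t*t)" by (simp add: k_def mConst_simps algebra_simps)
  have "r * n = \<alpha>' * ((t - mConst (2*(-1))) * k) * n + (\<beta>'*k + \<beta>) * (v*n)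
      + (\<gamma>'*k + \<gamma>) * (w*n) + ((\<delta>'*k + \<delta>)*n) * tE"
    unfolding r \<alpha> k_def[symmetric] by (simp only: distrib_left distrib_right mult_ac add_ac)
  also have "\<alpha>' * ((t - mConst (2*(-1))) * k) * n = (-\<alpha>') * ((4 - t*t)*n)"
    unfolding k by (simp only: mult_minus_left mult_minus_right mult.assoc)
  finally show ?thesis
    by (simp only:) (intro is_ideal_add[OF I] is_ideal_mult[OF I] mem cof_ideal_mem(1))
qed

lemma cof_ideal_expansions:
  "(4-ta*ta)*cof_aa \<in> cof_ideal" "(4-tb*tb)*cof_bb \<in> cof_ideal" "(4-tc*tc)*cof_cc \<in> cof_ideal"
  "tw*cof_aa \<in> cof_ideal" "tv*cof_aa \<in> cof_ideal" "tw*cof_bb \<in> cof_ideal"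
  "tu*cof_bb \<in> cof_ideal" "tu*cof_cc \<in> cof_ideal" "tv*cof_cc \<in> cof_ideal"
  unfolding tG_expansions cofactor_expansions
  by (intro is_ideal_add[OF is_ideal_cof_ideal] is_ideal_mult[OF is_ideal_cof_ideal] cof_ideal_mem)+

lemmas sub_simps = msubst_simps tu_def tv_def tw_def tE_def pP_def g3_def g4_def g5_def mConst_simps

lemma sub_a_vanish:
  assumes "s = 1 \<or> s = -1"
  shows "msubst (sub_a s) tv = 0" "msubst (sub_a s) tw = 0" "msubst (sub_a s) tE = 0"
    "msubst (sub_a s) (g3 + tu) = 0" "msubst (sub_a s) (g4 + tv) = 0" "msubst (sub_a s) (g5 + tw) = 0"
    "msubst (sub_a s) cof_bb = 0" "msubst (sub_a s) cof_cc = 0"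
    "msubst (sub_a s) cof_bc = 0" "msubst (sub_a s) cof_ac = 0" "msubst (sub_a s) cof_ab = 0"
  using assms by (auto simp: sub_simps sub_a_def algebra_simps)

lemma I_a_generators:
  assumes "r \<in> I_a s"
  shows "\<exists>\<alpha> \<beta> \<gamma> \<delta>. r = \<alpha>*(ta - mConst (2*s)) + \<beta>*tv + \<gamma>*tw + \<delta>*tE"
proof (rule gen_ideal_change_generators[OF _ _ _ assms[unfolded I_a_def]])
  have s2: "mConst (2*s) = 2 * mConst s" by (simp add: mConst_simps)
  show "2 * (tab - mConst s * tb) = tb*(ta - mConst (2*s)) - tw"
    "2 * (tac - mConst s * tc) = tc*(ta - mConst (2*s)) - tv"
    "4 * (tabc - mConst s * tbc) = 2*tE + (2*tbc)*(ta - mConst (2*s)) - tb*tv - tc*tw"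
    unfolding s2 by (simp_all add: tu_def tv_def tw_def tE_def pP_def algebra_simps)
qed

lemma I_a_both_signs:
  assumes "r \<in> I_a 1" "r \<in> I_a (-1)"
  shows "r * cof_aa \<in> cof_ideal"
proof (rule both_signs[where \<phi> = "msubst (sub_a (-1))" and t = ta and v = tv and w = tw])
  show "msubst (sub_a (-1)) r = 0" using assms(2) unfolding I_a_iff .
  show "\<exists>\<alpha> \<beta> \<gamma> \<delta>. q = \<alpha>*(ta - mConst (2*(-1))) + \<beta>*tv + \<gamma>*tw + \<delta>*tE"
    if "msubst (sub_a (-1)) q = 0" for q
    using that unfolding I_a_iff[symmetric] by (rule I_a_generators)
  show "\<exists>\<alpha> \<beta> \<gamma> \<delta>. r = \<alpha>*(ta - mConst (2*1)) + \<beta>*tv + \<gamma>*tw + \<delta>*tE"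
    by (rule I_a_generators[OF assms(1)])
  show "msubst (sub_a (-1)) ta = mConst (-2)" by (simp add: sub_a_def)
qed (simp_all only: rhom_msubst sub_a_vanish msubst_simps cof_ideal_expansions simp_thms)

lemma sub_b_vanish:
  assumes "s = 1 \<or> s = -1"
  shows "msubst (sub_b s) tu = 0" "msubst (sub_b s) tw = 0" "msubst (sub_b s) tE = 0"
    "msubst (sub_b s) (g3 + tu) = 0" "msubst (sub_b s) (g4 + tv) = 0" "msubst (sub_b s) (g5 + tw) = 0"
    "msubst (sub_b s) cof_aa = 0" "msubst (sub_b s) cof_cc = 0"
    "msubst (sub_b s) cof_bc = 0" "msubst (sub_b s) cof_ac = 0" "msubst (sub_b s) cof_ab = 0"
  using assms by (auto simp: sub_simps sub_b_def algebra_simps)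

lemma I_b_generators:
  assumes "r \<in> I_b s"
  shows "\<exists>\<alpha> \<beta> \<gamma> \<delta>. r = \<alpha>*(tb - mConst (2*s)) + \<beta>*tu + \<gamma>*tw + \<delta>*tE"
proof (rule gen_ideal_change_generators[OF _ _ _ assms[unfolded I_b_def]])
  have s2: "mConst (2*s) = 2 * mConst s" by (simp add: mConst_simps)
  show "2 * (tab - mConst s * ta) = ta*(tb - mConst (2*s)) - tw"
    "2 * (tbc - mConst s * tc) = tc*(tb - mConst (2*s)) - tu"
    "4 * (tabc - mConst s * tac) = 2*tE + (2*tac)*(tb - mConst (2*s)) - ta*tu - tc*tw"
    unfolding s2 by (simp_all add: tu_def tv_def tw_def tE_def pP_def algebra_simps)
qed

lemma I_b_both_signs:
  assumes "r \<in> I_b 1" "r \<in> I_b (-1)"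
  shows "r * cof_bb \<in> cof_ideal"
proof (rule both_signs[where \<phi> = "msubst (sub_b (-1))" and t = tb and v = tu and w = tw])
  show "msubst (sub_b (-1)) r = 0" using assms(2) unfolding I_b_iff .
  show "\<exists>\<alpha> \<beta> \<gamma> \<delta>. q = \<alpha>*(tb - mConst (2*(-1))) + \<beta>*tu + \<gamma>*tw + \<delta>*tE"
    if "msubst (sub_b (-1)) q = 0" for q
    using that unfolding I_b_iff[symmetric] by (rule I_b_generators)
  show "\<exists>\<alpha> \<beta> \<gamma> \<delta>. r = \<alpha>*(tb - mConst (2*1)) + \<beta>*tu + \<gamma>*tw + \<delta>*tE"
    by (rule I_b_generators[OF assms(1)])
  show "msubst (sub_b (-1)) tb = mConst (-2)" by (simp add: sub_b_def)
qed (simp_all only: rhom_msubst sub_b_vanish msubst_simps cof_ideal_expansions simp_thms)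

lemma sub_c_vanish:
  assumes "s = 1 \<or> s = -1"
  shows "msubst (sub_c s) tu = 0" "msubst (sub_c s) tv = 0" "msubst (sub_c s) tE = 0"
    "msubst (sub_c s) (g3 + tu) = 0" "msubst (sub_c s) (g4 + tv) = 0" "msubst (sub_c s) (g5 + tw) = 0"
    "msubst (sub_c s) cof_aa = 0" "msubst (sub_c s) cof_bb = 0"
    "msubst (sub_c s) cof_bc = 0" "msubst (sub_c s) cof_ac = 0" "msubst (sub_c s) cof_ab = 0"
  using assms by (auto simp: sub_simps sub_c_def algebra_simps)

lemma I_c_generators:
  assumes "r \<in> I_c s"
  shows "\<exists>\<alpha> \<beta> \<gamma> \<delta>. r = \<alpha>*(tc - mConst (2*s)) + \<beta>*tu + \<gamma>*tv + \<delta>*tE"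
proof (rule gen_ideal_change_generators[OF _ _ _ assms[unfolded I_c_def]])
  have s2: "mConst (2*s) = 2 * mConst s" by (simp add: mConst_simps)
  show "2 * (tac - mConst s * ta) = ta*(tc - mConst (2*s)) - tv"
    "2 * (tbc - mConst s * tb) = tb*(tc - mConst (2*s)) - tu"
    "4 * (tabc - mConst s * tab) = 2*tE + (2*tab)*(tc - mConst (2*s)) - ta*tu - tb*tv"
    unfolding s2 by (simp_all add: tu_def tv_def tw_def tE_def pP_def algebra_simps)
qed

lemma I_c_both_signs:
  assumes "r \<in> I_c 1" "r \<in> I_c (-1)"
  shows "r * cof_cc \<in> cof_ideal"
proof (rule both_signs[where \<phi> = "msubst (sub_c (-1))" and t = tc and v = tu and w = tv])
  show "msubst (sub_c (-1)) r = 0" using assms(2) unfolding I_c_iff .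
  show "\<exists>\<alpha> \<beta> \<gamma> \<delta>. q = \<alpha>*(tc - mConst (2*(-1))) + \<beta>*tu + \<gamma>*tv + \<delta>*tE"
    if "msubst (sub_c (-1)) q = 0" for q
    using that unfolding I_c_iff[symmetric] by (rule I_c_generators)
  show "\<exists>\<alpha> \<beta> \<gamma> \<delta>. r = \<alpha>*(tc - mConst (2*1)) + \<beta>*tu + \<gamma>*tv + \<delta>*tE"
    by (rule I_c_generators[OF assms(1)])
  show "msubst (sub_c (-1)) tc = mConst (-2)" by (simp add: sub_c_def)
qed (simp_all only: rhom_msubst sub_c_vanish msubst_simps cof_ideal_expansions simp_thms)

lemma half_simps: "2 * mConst (1/2) = 1" "2 * (mConst (1/2) * p) = p"
proof -
  show 1: "2 * mConst (1/2) = 1"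
    unfolding rhom_numeral[OF rhom_mConst, symmetric] rhom_mult[OF rhom_mConst, symmetric] by (simp add: mConst_simps)
  show "2 * (mConst (1/2) * p) = p" unfolding mult.assoc[symmetric] 1 by simp
qed

lemma rhom_combination:
  "rhom F \<Longrightarrow> F (r1*(- k1) + r2*(- k2) + r3*(- k3) + 2*r4*k4 + 2*r5*k5 + 2*r6*k6 + 4*r7*k7) =
    F r1*(- F k1) + F r2*(- F k2) + F r3*(- F k3) + 2*F r4*F k4 + 2*F r5*F k5 + 2*F r6*F k6 + 4*F r7*F k7"
  by (simp add: rhom_simps)

text \<open>Membership in \<open>I_ns\<close> writes 4n through all minors and \<open>tE\<close>.
  The six other ideals control the coefficients of the three diagonal minors.\<close>

lemma eight_intersection_cofactors:
  assumes ns: "n \<in> I_ns" and a: "n \<in> I_a 1" "n \<in> I_a (-1)" and b: "n \<in> I_b 1" "n \<in> I_b (-1)"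
    and c: "n \<in> I_c 1" "n \<in> I_c (-1)"
  shows "4 * n \<in> cof_ideal"
proof -
  obtain r1 r2 r3 r4 r5 r6 r7 where "n - r1*(ta^2 + tb^2 + tab^2 - ta*tb*tab - 4)
     - r2*(ta^2 + tc^2 + tac^2 - ta*tc*tac - 4) - r3*(tb^2 + tc^2 + tbc^2 - tb*tc*tbc - 4)
     - r4*(ta*pP - 2*tab*tac - 4*tbc + 2*tb*tc) - r5*(tb*pP - 2*tab*tbc - 4*tac + 2*ta*tc)
     - r6*(tc*pP - 2*tac*tbc - 4*tab + 2*ta*tb) - r7*(2*tabc - pP) = 0"
    using ns unfolding I_ns_def gen_ideal_insert gen_ideal_empty by blast
  then have "n = r1*(ta^2 + tb^2 + tab^2 - ta*tb*tab - 4)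
     + r2*(ta^2 + tc^2 + tac^2 - ta*tc*tac - 4) + r3*(tb^2 + tc^2 + tbc^2 - tb*tc*tbc - 4)
     + r4*(ta*pP - 2*tab*tac - 4*tbc + 2*tb*tc) + r5*(tb*pP - 2*tab*tbc - 4*tac + 2*ta*tc)
     + r6*(tc*pP - 2*tac*tbc - 4*tab + 2*ta*tb) + r7*tE" by (simp add: tE_def algebra_simps)
  then have "4 * n = r1*(4*(ta^2 + tb^2 + tab^2 - ta*tb*tab - 4))
     + r2*(4*(ta^2 + tc^2 + tac^2 - ta*tc*tac - 4)) + r3*(4*(tb^2 + tc^2 + tbc^2 - tb*tc*tbc - 4))
     + 2*r4*(2*(ta*pP - 2*tab*tac - 4*tbc + 2*tb*tc)) + 2*r5*(2*(tb*pP - 2*tab*tbc - 4*tac + 2*ta*tc))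
     + 2*r6*(2*(tc*pP - 2*tac*tbc - 4*tab + 2*ta*tb)) + 4*r7*tE" by (simp only:) (simp add: distrib_left mult_ac)
  moreover have "4*(ta^2 + tb^2 + tab^2 - ta*tb*tab - 4) = - cof_cc" "4*(ta^2 + tc^2 + tac^2 - ta*tc*tac - 4) = - cof_bb"
    "4*(tb^2 + tc^2 + tbc^2 - tb*tc*tbc - 4) = - cof_aa" "2*(ta*pP - 2*tab*tac - 4*tbc + 2*tb*tc) = cof_bc"
    "2*(tb*pP - 2*tab*tbc - 4*tac + 2*ta*tc) = cof_ac" "2*(tc*pP - 2*tac*tbc - 4*tab + 2*ta*tb) = cof_ab"
    by (simp_all add: tu_def tv_def tw_def pP_def power2_eq_square algebra_simps)
  ultimately have n: "4 * n = r1*(- cof_cc) + r2*(- cof_bb) + r3*(- cof_aa) + 2*r4*cof_bc + 2*r5*cof_ac + 2*r6*cof_ab + 4*r7*tE"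
    by (simp only:)
  \<comment> \<open>Restricted to this component, \<open>cof_aa\<close> is the only surviving minor
    and is not zero, so its coefficient vanishes there.\<close>
  have "r3 \<in> I_a s" if s: "s = 1 \<or> s = -1" for s
  proof -
    have z: "msubst (sub_a s) n = 0" using a s unfolding I_a_iff by auto
    have "msubst (sub_a s) (4 * n) = msubst (sub_a s) r3 * (- msubst (sub_a s) cof_aa)"
      unfolding n rhom_combination[OF rhom_msubst] sub_a_vanish[OF s] by simp
    then have "msubst (sub_a s) r3 * (- msubst (sub_a s) cof_aa) = 0" using z by (simp add: rhom_simps[OF rhom_msubst])
    moreover have "msubst (sub_a s) cof_aa \<noteq> 0"
    proof
      assume "msubst (sub_a s) cof_aa = 0"
      then have "ev (\<lambda>_. 0) (msubst (sub_a s) cof_aa) = 0" by (simp add: ev_simps)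
      then show False by (simp add: sub_simps sub_a_def ev_simps)
    qed
    ultimately show ?thesis unfolding I_a_iff using mpoly_no_zero_divisors by fastforce
  qed
  then have "r3 * cof_aa \<in> cof_ideal" by (intro I_a_both_signs) simp_all
  have "r2 \<in> I_b s" if s: "s = 1 \<or> s = -1" for s
  proof -
    have z: "msubst (sub_b s) n = 0" using b s unfolding I_b_iff by auto
    have "msubst (sub_b s) (4 * n) = msubst (sub_b s) r2 * (- msubst (sub_b s) cof_bb)"
      unfolding n rhom_combination[OF rhom_msubst] sub_b_vanish[OF s] by simp
    then have "msubst (sub_b s) r2 * (- msubst (sub_b s) cof_bb) = 0" using z by (simp add: rhom_simps[OF rhom_msubst])
    moreover have "msubst (sub_b s) cof_bb \<noteq> 0"
    proof
      assume "msubst (sub_b s) cof_bb = 0"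
      then have "ev (\<lambda>_. 0) (msubst (sub_b s) cof_bb) = 0" by (simp add: ev_simps)
      then show False by (simp add: sub_simps sub_b_def ev_simps)
    qed
    ultimately show ?thesis unfolding I_b_iff using mpoly_no_zero_divisors by fastforce
  qed
  then have "r2 * cof_bb \<in> cof_ideal" by (intro I_b_both_signs) simp_all
  have "r1 \<in> I_c s" if s: "s = 1 \<or> s = -1" for s
  proof -
    have z: "msubst (sub_c s) n = 0" using c s unfolding I_c_iff by auto
    have "msubst (sub_c s) (4 * n) = msubst (sub_c s) r1 * (- msubst (sub_c s) cof_cc)"
      unfolding n rhom_combination[OF rhom_msubst] sub_c_vanish[OF s] by simp
    then have "msubst (sub_c s) r1 * (- msubst (sub_c s) cof_cc) = 0" using z by (simp add: rhom_simps[OF rhom_msubst])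
    moreover have "msubst (sub_c s) cof_cc \<noteq> 0"
    proof
      assume "msubst (sub_c s) cof_cc = 0"
      then have "ev (\<lambda>_. 0) (msubst (sub_c s) cof_cc) = 0" by (simp add: ev_simps)
      then show False by (simp add: sub_simps sub_c_def ev_simps)
    qed
    ultimately show ?thesis unfolding I_c_iff using mpoly_no_zero_divisors by fastforce
  qed
  then have "r1 * cof_cc \<in> cof_ideal" by (intro I_c_both_signs) simp_all
  note r = \<open>r1 * cof_cc \<in> cof_ideal\<close> \<open>r2 * cof_bb \<in> cof_ideal\<close> \<open>r3 * cof_aa \<in> cof_ideal\<close>
  have "4 * n = (2*r4*cof_bc + 2*r5*cof_ac + 2*r6*cof_ab + 4*r7*tE) - r1*cof_cc - r2*cof_bb - r3*cof_aa"
    unfolding n by (simp only: mult_minus_right) (simp only: diff_conv_add_uminus add_ac)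
  then show ?thesis
    by (simp only:) (intro is_ideal_diff[OF is_ideal_cof_ideal] is_ideal_add[OF is_ideal_cof_ideal]
        is_ideal_mult[OF is_ideal_cof_ideal] cof_ideal_mem r)
qed

section \<open>Syzygies of the Gram entries\<close>

definition kill_w :: "tvar \<Rightarrow> tvar mpoly" where
  "kill_w t = (case t of Tab \<Rightarrow> mConst (1/2) * (ta*tb) | _ \<Rightarrow> mVar t)"

definition kill_vw :: "tvar \<Rightarrow> tvar mpoly" where
  "kill_vw t = (case t of Tab \<Rightarrow> mConst (1/2) * (ta*tb) | Tac \<Rightarrow> mConst (1/2) * (ta*tc) | _ \<Rightarrow> mVar t)"

definition kill_uvw :: "tvar \<Rightarrow> tvar mpoly" where
  "kill_uvw t = (case t of Tab \<Rightarrow> mConst (1/2) * (ta*tb) | Tac \<Rightarrow> mConst (1/2) * (ta*tc)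
     | Tbc \<Rightarrow> mConst (1/2) * (tb*tc) | _ \<Rightarrow> mVar t)"

text \<open>Each of \<open>tu\<close>, \<open>tv\<close>, \<open>tw\<close> is linear in a variable
  of its own, so setting it to zero amounts to solving for that variable.\<close>

lemma kill_mod:
  shows kill_w_mod: "p - msubst kill_w p \<in> gen_ideal {tw}"
    and kill_vw_mod: "p - msubst kill_vw p \<in> gen_ideal {tv, tw}"
    and kill_uvw_mod: "p - msubst kill_uvw p \<in> gen_ideal {tu, tv, tw}"
proof -
  note I = is_ideal_gen_ideal
  have half: "mConst (1/2) * (2 * p) = p" for p :: "tvar mpoly"
    using half_simps(2)[of p] by (simp add: mult.left_commute)
  have w: "tab - mConst (1/2) * (ta*tb) = (- mConst (1/2)) * tw" and v: "tac - mConst (1/2) * (ta*tc) = (- mConst (1/2)) * tv"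
    and u: "tbc - mConst (1/2) * (tb*tc) = (- mConst (1/2)) * tu"
    by (simp_all add: tu_def tv_def tw_def right_diff_distrib half)
  have m: "tab - mConst (1/2) * (ta*tb) \<in> gen_ideal S" if "tw \<in> S" for S
    unfolding w by (rule is_ideal_mult[OF I gen_ideal_mem[OF that]])
  have m': "tac - mConst (1/2) * (ta*tc) \<in> gen_ideal S" if "tv \<in> S" for S
    unfolding v by (rule is_ideal_mult[OF I gen_ideal_mem[OF that]])
  have m'': "tbc - mConst (1/2) * (tb*tc) \<in> gen_ideal S" if "tu \<in> S" for S
    unfolding u by (rule is_ideal_mult[OF I gen_ideal_mem[OF that]])
  show "p - msubst kill_w p \<in> gen_ideal {tw}"
  proof (rule rhom_cong_mod_ideal[OF I rhom_id rhom_msubst])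
    show "mVar v - msubst kill_w (mVar v) \<in> gen_ideal {tw}" for v
      by (cases v) (simp_all add: kill_w_def m is_ideal_zero[OF I])
  qed simp
  show "p - msubst kill_vw p \<in> gen_ideal {tv, tw}"
  proof (rule rhom_cong_mod_ideal[OF I rhom_id rhom_msubst])
    show "mVar t - msubst kill_vw (mVar t) \<in> gen_ideal {tv, tw}" for t
      by (cases t) (simp_all add: kill_vw_def m m' is_ideal_zero[OF I])
  qed simp
  show "p - msubst kill_uvw p \<in> gen_ideal {tu, tv, tw}"
  proof (rule rhom_cong_mod_ideal[OF I rhom_id rhom_msubst])
    show "mVar t - msubst kill_uvw (mVar t) \<in> gen_ideal {tu, tv, tw}" for t
      by (cases t) (simp_all add: kill_uvw_def m m' m'' is_ideal_zero[OF I])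
  qed simp
qed

lemma kill_values:
  "msubst kill_w tw = 0" "msubst kill_w tv = tv"
  "msubst kill_vw tw = 0" "msubst kill_vw tv = 0" "msubst kill_vw tu = tu"
  "msubst kill_uvw tw = 0" "msubst kill_uvw tv = 0" "msubst kill_uvw tu = 0"
  by (simp_all add: tu_def tv_def tw_def msubst_simps kill_w_def kill_vw_def kill_uvw_def half_simps)

lemma nonzero_by_ev: "ev \<tau> p \<noteq> 0 \<Longrightarrow> p \<noteq> 0"
  by (auto simp: ev_simps)

lemma tu_nonzero: "tu \<noteq> 0" and tv_nonzero: "tv \<noteq> 0" and tw_nonzero: "tw \<noteq> 0"
  by (rule nonzero_by_ev[of "\<lambda>v. if v \<in> {Tab, Tac, Tbc} then 1 else 0"], simp add: tu_def tv_def tw_def ev_simps)+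

text \<open>A regular sequence: setting tv = tw = 0 puts l3 into the ideal of \<open>tv\<close>,
  \<open>tw\<close>; then tw = 0 treats l4, and cancelling \<open>tw\<close> gives l5.\<close>

lemma koszul:
  assumes "l3 * tu + l4 * tv + l5 * tw = 0"
  shows "\<exists>\<alpha> \<beta> \<gamma>. l3 = \<alpha>*tv + \<beta>*tw \<and> l4 = - \<alpha>*tu + \<gamma>*tw \<and> l5 = - \<beta>*tu - \<gamma>*tv"
proof -
  have "msubst kill_vw (l3 * tu + l4 * tv + l5 * tw) = 0" using assms by (simp add: rhom_zero[OF rhom_msubst])
  then have "msubst kill_vw l3 * tu = 0" by (simp add: rhom_simps[OF rhom_msubst] kill_values)
  then have "msubst kill_vw l3 = 0" using mpoly_no_zero_divisors tu_nonzero by blast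
  then have "l3 \<in> gen_ideal {tv, tw}" using kill_vw_mod[of l3] by simp
  then obtain \<alpha> \<beta> where "l3 - \<alpha>*tv - \<beta>*tw = 0"
    unfolding gen_ideal_insert gen_ideal_empty by blast
  then have l3: "l3 = \<alpha>*tv + \<beta>*tw" by (simp add: algebra_simps)
  have eq: "(l4 + \<alpha>*tu) * tv + (l5 + \<beta>*tu) * tw = 0"
    using assms unfolding l3 by (simp add: algebra_simps)
  then have "msubst kill_w ((l4 + \<alpha>*tu) * tv + (l5 + \<beta>*tu) * tw) = 0" by (simp add: rhom_zero[OF rhom_msubst])
  then have "msubst kill_w (l4 + \<alpha>*tu) * tv = 0"
    by (simp only: rhom_add[OF rhom_msubst] rhom_mult[OF rhom_msubst] kill_values) simp
  then have "msubst kill_w (l4 + \<alpha>*tu) = 0" using mpoly_no_zero_divisors tv_nonzero by blast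
  then have "l4 + \<alpha>*tu \<in> gen_ideal {tw}" using kill_w_mod[of "l4 + \<alpha>*tu"] by simp
  then obtain \<gamma> where "l4 + \<alpha>*tu - \<gamma>*tw = 0"
    unfolding gen_ideal_insert gen_ideal_empty by blast
  then have l4: "l4 = - \<alpha>*tu + \<gamma>*tw" by (simp add: algebra_simps eq_neg_iff_add_eq_0)
  have "(\<gamma>*tv + (l5 + \<beta>*tu)) * tw = 0" using eq unfolding l4 by (simp add: algebra_simps)
  then have "\<gamma>*tv + (l5 + \<beta>*tu) = 0" using mpoly_no_zero_divisors tw_nonzero by blast
  then have "l5 = - \<beta>*tu - \<gamma>*tv" by (simp add: algebra_simps eq_neg_iff_add_eq_0)
  with l3 l4 show ?thesis by blast
qed

text \<open>Modulo \<open>tu\<close>, \<open>tv\<close>, \<open>tw\<close> the polynomial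
  \<open>tE\<close> is linear in t_abc, and \<open>tG\<close> is the product P of the diagonal Gram
  entries, free of t_abc. Such a pair is regular, so its relations are multiples e of (-P,
  tE).\<close>

lemma syzygy_E_G:
  assumes "d*tE + g*tG \<in> gen_ideal {tu, tv, tw}"
  shows "\<exists>e. g - e*tE \<in> gen_ideal {tu, tv, tw} \<and> d + e*((4-ta*ta)*(4-tb*tb)*(4-tc*tc)) \<in> gen_ideal {tu, tv, tw}"
proof -
  let ?I = "gen_ideal {tu, tv, tw}" and ?P = "(4-ta*ta)*(4-tb*tb)*(4-tc*tc)" and ?k = "msubst kill_uvw"
  note I = is_ideal_gen_ideal[of "{tu, tv, tw}"]
  define Y where "Y = ?k pP"
  have kE: "?k tE = 2*tabc - Y" by (simp add: tE_def Y_def msubst_simps kill_uvw_def)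
  have kG: "?k tG = ?P" by (simp add: tG_def gram_det_def rhom_simps[OF rhom_msubst] kill_values)
    (simp add: msubst_simps kill_uvw_def)
  have "?I \<subseteq> {p. ?k p = 0}"
    by (rule gen_ideal_least[OF is_ideal_kernel[OF rhom_msubst]]) (simp add: kill_values)
  then have "?k (d*tE + g*tG) = 0" using assms by blast
  then have eq: "?k d * ?k tE + ?k g * ?P = 0" by (simp only: rhom_add[OF rhom_msubst] rhom_mult[OF rhom_msubst] kG)
  \<comment> \<open>Solves tE = 0 for t_abc.\<close>
  define s where "s t = (case t of Tabc \<Rightarrow> mConst (1/2) * Y | _ \<Rightarrow> mVar t)" for t
  have sY: "msubst s Y = Y"
    by (simp add: Y_def pP_def msubst_simps kill_uvw_def s_def)
  have sE: "msubst s (?k tE) = 0"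
    unfolding kE by (simp add: rhom_simps[OF rhom_msubst] sY s_def half_simps)
  have sP: "msubst s ?P = ?P" by (simp add: msubst_simps s_def)
  have P0: "?P \<noteq> 0" by (rule nonzero_by_ev[of "\<lambda>_. 0"]) (simp add: ev_simps)
  have "msubst s (?k d * ?k tE + ?k g * ?P) = 0" unfolding eq by (simp add: rhom_zero[OF rhom_msubst])
  then have "msubst s (?k g) * ?P = 0"
    by (simp only: rhom_add[OF rhom_msubst] rhom_mult[OF rhom_msubst, of _ "?k d"] rhom_mult[OF rhom_msubst, of _ "?k g"] sE sP) simp
  then have "msubst s (?k g) = 0" using mpoly_no_zero_divisors P0 by blast
  moreover have "?k g - msubst s (?k g) \<in> gen_ideal {?k tE}"
  proof (rule rhom_cong_mod_ideal[OF is_ideal_gen_ideal rhom_id rhom_msubst])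
    have "tabc - mConst (1/2) * Y = mConst (1/2) * ?k tE"
      using half_simps(2)[of tabc] by (simp add: kE right_diff_distrib mult.left_commute)
    moreover have "mConst (1/2) * ?k tE \<in> gen_ideal {?k tE}"
      by (rule is_ideal_mult[OF is_ideal_gen_ideal]) (simp add: gen_ideal_mem)
    ultimately show "mVar v - msubst s (mVar v) \<in> gen_ideal {?k tE}" for v
      by (cases v) (simp_all add: s_def is_ideal_zero[OF is_ideal_gen_ideal])
  qed simp
  ultimately obtain e where "?k g - e * ?k tE = 0"
    unfolding gen_ideal_insert gen_ideal_empty by auto
  then have e: "?k g = e * ?k tE" by simp
  have kE0: "?k tE \<noteq> 0"
    by (rule nonzero_by_ev[of "\<lambda>v. if v = Tabc then 1 else 0"])
      (simp add: kE Y_def pP_def msubst_simps kill_uvw_def ev_simps)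
  have "(?k d + e * ?P) * ?k tE = ?k d * ?k tE + (e * ?k tE) * ?P" by (simp only: distrib_right) (simp only: mult_ac)
  then have "(?k d + e * ?P) * ?k tE = 0" using eq unfolding e by simp
  then have kd: "?k d + e * ?P = 0" using mpoly_no_zero_divisors kE0 by blast
  have "g - e*tE = (g - ?k g) - e * (tE - ?k tE)" by (simp add: e algebra_simps)
  moreover have "\<dots> \<in> ?I" by (intro is_ideal_diff[OF I] is_ideal_mult[OF I] kill_uvw_mod)
  moreover have "d + e*?P = (d - ?k d) + (?k d + e * ?P)" by simp
  then have "d + e*?P \<in> ?I" unfolding kd using kill_uvw_mod[of d] by simp
  ultimately show ?thesis by metis
qed

lemma I_0_mod_kernel:
  assumes "f \<in> I_0"
  shows "\<exists>h3 h4 h5. tproj (2*f - (h3*g3 + h4*g4 + h5*g5)) = 0"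
proof -
  obtain r0 r1 r2 r3 r4 r5 where "f - r0*(tabc^2 - pP*tabc + qQ) - r1*(ta*tbc - tb*tac) - r2*(tb*tac - tc*tab)
     - r3*g3 - r4*g4 - r5*g5 = 0"
    using assms unfolding I_0_def gen_ideal_insert gen_ideal_empty g3_def g4_def g5_def by blast
  then have f: "f = r0*(tabc^2 - pP*tabc + qQ) + r1*(ta*tbc - tb*tac) + r2*(tb*tac - tc*tab)
     + r3*g3 + r4*g4 + r5*g5" by (simp add: algebra_simps)
  define k0 k1 k2 where k: "k0 = tabc^2 - pP*tabc + qQ" "k1 = 2*(ta*tbc - tb*tac) - (ta*g3 - tb*g4)"
    "k2 = 2*(tb*tac - tc*tab) - (tb*g4 - tc*g5)"
  have "2*f - ((2*r3 + r1*ta)*g3 + (2*r4 - r1*tb + r2*tb)*g4 + (2*r5 - r2*tc)*g5) = 2*r0*k0 + r1*k1 + r2*k2"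
    unfolding f k by (simp add: algebra_simps)
  moreover have "tproj k0 = 0" "tproj k1 = 0" "tproj k2 = 0" unfolding k by (rule tproj_kernel)+
  ultimately have "tproj (2*f - ((2*r3 + r1*ta)*g3 + (2*r4 - r1*tb + r2*tb)*g4 + (2*r5 - r2*tc)*g5)) = 0"
    by (simp only: rhom_add[OF rhom_tproj] rhom_mult[OF rhom_tproj]) simp
  then show ?thesis by blast
qed

text \<open>The square of the determinant is the Gram determinant: \<open>tE\<close> is 4d and
  \<open>tG\<close> is 64 times the Gram determinant, whence the factor 4.\<close>

lemma tproj_tG: "tproj tG = 4 * tproj tE * tproj tE"
proof -
  have "4*tE*tE - tG = 16 * (tabc^2 - pP*tabc + qQ)"
    by (simp add: tG_def gram_det_def tE_def pP_def qQ_def tu_def tv_def tw_def power2_eq_square algebra_simps)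
  then have "tproj (4*tE*tE - tG) = 16 * tproj (tabc^2 - pP*tabc + qQ)"
    by (simp only: rhom_mult[OF rhom_tproj] rhom_numeral[OF rhom_tproj])
  then show ?thesis unfolding tproj_kernel(1) by (simp add: tproj_simps)
qed

text \<open>The membership is a syzygy of \<open>tu\<close>, \<open>tv\<close>, \<open>tw\<close> up
  to explicit ones. For each type, putting \<open>g3\<close>, \<open>g4\<close>, \<open>g5\<close>
  in place of \<open>tu\<close>, \<open>tv\<close>, \<open>tw\<close> gives an element that
  \<open>tproj_kernel\<close> and \<open>tproj_tG\<close> send to zero.\<close>

lemma syzygy_in_kernel:
  assumes "4 * (h3*tu + h4*tv + h5*tw) \<in> cof_ideal"
  shows "tproj (4 * (h3*g3 + h4*g4 + h5*g5)) = 0"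
proof -
  let ?A = "4-ta*ta" and ?B = "4-tb*tb" and ?C = "4-tc*tc"
  obtain d g c1 c2 c3 where "4 * (h3*tu + h4*tv + h5*tw) - d*tE - g*tG - c1*cof_bc - c2*cof_ac - c3*cof_ab = 0"
    using assms unfolding cof_ideal_def gen_ideal_insert gen_ideal_empty by blast
  then have eq: "d*tE + g*tG = (4*h3 - c1*?A + c2*tw + c3*tv)*tu + (4*h4 + c1*tw - c2*?B)*tv + (4*h5 - c3*?C)*tw"
    by (simp add: algebra_simps)
  have mem: "tu \<in> gen_ideal {tu, tv, tw}" "tv \<in> gen_ideal {tu, tv, tw}" "tw \<in> gen_ideal {tu, tv, tw}"
    by (simp_all add: gen_ideal_mem)
  have "d*tE + g*tG \<in> gen_ideal {tu, tv, tw}"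
    unfolding eq by (intro is_ideal_add[OF is_ideal_gen_ideal] is_ideal_mult[OF is_ideal_gen_ideal] mem)
  from syzygy_E_G[OF this] obtain e where e: "g - e*tE \<in> gen_ideal {tu, tv, tw}" "d + e*(?A*?B*?C) \<in> gen_ideal {tu, tv, tw}"
    by blast
  obtain q1 q2 q3 where "g - e*tE - q1*tu - q2*tv - q3*tw = 0"
    using e(1) unfolding gen_ideal_insert gen_ideal_empty by blast
  then have g: "g = e*tE + q1*tu + q2*tv + q3*tw" by (simp add: algebra_simps)
  obtain d1 d2 d3 where "d + e*(?A*?B*?C) - d1*tu - d2*tv - d3*tw = 0"
    using e(2) unfolding gen_ideal_insert gen_ideal_empty by blast
  then have d: "d = - e*(?A*?B*?C) + d1*tu + d2*tv + d3*tw" by (simp add: algebra_simps eq_neg_iff_add_eq_0)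
  \<comment> \<open>The terms of \<open>tG\<close> other than P are distributed over the
    coefficients of \<open>tu\<close>, \<open>tv\<close>, \<open>tw\<close>; the mixed term 2 tu tv
    tw goes to \<open>tu\<close>.\<close>
  define l3 l4 l5 where "l3 = 4*h3 - c1*?A + c2*tw + c3*tv - d1*tE - q1*tG - e*tE*(2*tv*tw - ?A*tu)"
    and "l4 = 4*h4 + c1*tw - c2*?B - d2*tE - q2*tG + e*tE*(?B*tv)"
    and "l5 = 4*h5 - c3*?C - d3*tE - q3*tG + e*tE*(?C*tw)"
  have "l3*tu + l4*tv + l5*tw = ((4*h3 - c1*?A + c2*tw + c3*tv)*tu + (4*h4 + c1*tw - c2*?B)*tv + (4*h5 - c3*?C)*tw)
      - (d1*tu + d2*tv + d3*tw)*tE - (q1*tu + q2*tv + q3*tw)*tG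
      - e*tE*(2*tu*tv*tw - ?A*tu*tu - ?B*tv*tv - ?C*tw*tw)"
    unfolding l3_def l4_def l5_def by (simp add: algebra_simps)
  also have "\<dots> = e*tE*(tG - ?A*?B*?C) - e*tE*(2*tu*tv*tw - ?A*tu*tu - ?B*tv*tv - ?C*tw*tw)"
    unfolding eq[symmetric] d g by (simp add: algebra_simps)
  also have "tG - ?A*?B*?C = 2*tu*tv*tw - ?A*tu*tu - ?B*tv*tv - ?C*tw*tw"
    by (simp add: tG_def gram_det_def)
  also have "e*tE*(2*tu*tv*tw - ?A*tu*tu - ?B*tv*tv - ?C*tw*tw) - e*tE*(2*tu*tv*tw - ?A*tu*tu - ?B*tv*tv - ?C*tw*tw) = 0"
    by (rule diff_self)
  finally obtain \<alpha> \<beta> \<gamma> where l: "l3 = \<alpha>*tv + \<beta>*tw" "l4 = - \<alpha>*tu + \<gamma>*tw" "l5 = - \<beta>*tu - \<gamma>*tv"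
    using koszul by blast
  have h: "4*h3 = l3 + (c1*?A - c2*tw - c3*tv + d1*tE + q1*tG + e*tE*(2*tv*tw - ?A*tu))"
    "4*h4 = l4 + (- c1*tw + c2*?B + d2*tE + q2*tG - e*tE*(?B*tv))"
    "4*h5 = l5 + (c3*?C + d3*tE + q3*tG - e*tE*(?C*tw))"
    unfolding l3_def l4_def l5_def by (simp_all add: algebra_simps)
  have "4 * (h3*g3 + h4*g4 + h5*g5) = (4*h3)*g3 + (4*h4)*g4 + (4*h5)*g5" by (simp add: algebra_simps)
  also have "\<dots> = \<alpha>*(tv*g3 - tu*g4) + \<beta>*(tw*g3 - tu*g5) + \<gamma>*(tw*g4 - tv*g5)
     + c1*(?A*g3 - tw*g4) + c2*(?B*g4 - tw*g3) + c3*(?C*g5 - tv*g3)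
     + (d1 + e*(2*tv*tw - ?A*tu))*(tE*g3) + (d2 - e*(?B*tv))*(tE*g4) + (d3 - e*(?C*tw))*(tE*g5)
     + (q1*g3 + q2*g4 + q3*g5)*tG"
    unfolding h l by (simp add: algebra_simps)
  finally have "tproj (4 * (h3*g3 + h4*g4 + h5*g5)) = tproj ((q1*g3 + q2*g4 + q3*g5)*tG)"
    by (simp only: rhom_add[OF rhom_tproj] rhom_mult[OF rhom_tproj, of _ "tv*g3 - tu*g4"]
        rhom_mult[OF rhom_tproj, of _ "tw*g3 - tu*g5"] rhom_mult[OF rhom_tproj, of _ "tw*g4 - tv*g5"]
        rhom_mult[OF rhom_tproj, of _ "?A*g3 - tw*g4"] rhom_mult[OF rhom_tproj, of _ "?B*g4 - tw*g3"]
        rhom_mult[OF rhom_tproj, of _ "?C*g5 - tv*g3"] rhom_mult[OF rhom_tproj, of _ "tE*g3"]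
        rhom_mult[OF rhom_tproj, of _ "tE*g4"] rhom_mult[OF rhom_tproj, of _ "tE*g5"] tproj_kernel(4-12)) simp
  \<comment> \<open>\<open>tG\<close> becomes 4 tE^2, and \<open>tE\<close> annihilates
    \<open>g3\<close>, \<open>g4\<close>, \<open>g5\<close> in the quotient.\<close>
  also have "\<dots> = 4 * tproj tE * (tproj q1 * tproj (tE*g3) + tproj q2 * tproj (tE*g4) + tproj q3 * tproj (tE*g5))"
    by (simp add: rhom_add[OF rhom_tproj] rhom_mult[OF rhom_tproj] tproj_tG algebra_simps)
  finally show ?thesis by (simp add: tproj_kernel(4-6))
qed

theorem tproj_eq_zero_iff: "tproj f = 0 \<longleftrightarrow> f \<in> I_Bor"
proof
  assume "tproj f = 0"
  then show "f \<in> I_Bor"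
    unfolding I_Bor_def
    by (simp add: kernel_subset_I_ns kernel_subset_I_a kernel_subset_I_b kernel_subset_I_c kernel_subset_I_0)
next
  assume "f \<in> I_Bor"
  then have f: "f \<in> I_ns" "f \<in> I_a 1" "f \<in> I_a (-1)" "f \<in> I_b 1" "f \<in> I_b (-1)" "f \<in> I_c 1" "f \<in> I_c (-1)" "f \<in> I_0"
    unfolding I_Bor_def by auto
  obtain h3 h4 h5 where h: "tproj (2*f - (h3*g3 + h4*g4 + h5*g5)) = 0"
    using I_0_mod_kernel[OF f(8)] by blast
  let ?n = "h3*tu + h4*tv + h5*tw"
  have n: "?n \<in> I" if I: "is_ideal I" and g: "g3 + tu \<in> I" "g4 + tv \<in> I" "g5 + tw \<in> I"
    and "f \<in> I" and k: "2*f - (h3*g3 + h4*g4 + h5*g5) \<in> I" for I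
  proof -
    have "?n = (2*f - (h3*g3 + h4*g4 + h5*g5)) - 2*f + (h3*(g3 + tu) + h4*(g4 + tv) + h5*(g5 + tw))"
      by (simp add: algebra_simps)
    also have "\<dots> \<in> I"
      by (intro is_ideal_add[OF I] is_ideal_diff[OF I] is_ideal_mult[OF I] that)
    finally show ?thesis .
  qed
  have "2 * (g3 + tu) = (ta*pP - 2*tab*tac - 4*tbc + 2*tb*tc) + ta*tE"
    "2 * (g4 + tv) = (tb*pP - 2*tab*tbc - 4*tac + 2*ta*tc) + tb*tE"
    "2 * (g5 + tw) = (tc*pP - 2*tac*tbc - 4*tab + 2*ta*tb) + tc*tE"
    by (simp_all add: g3_def g4_def g5_def tu_def tv_def tw_def tE_def algebra_simps)
  moreover have "ta*pP - 2*tab*tac - 4*tbc + 2*tb*tc \<in> I_ns" "tb*pP - 2*tab*tbc - 4*tac + 2*ta*tc \<in> I_ns"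
    "tc*pP - 2*tac*tbc - 4*tab + 2*ta*tb \<in> I_ns"
    unfolding I_ns_def by (rule gen_ideal_mem, simp)+
  ultimately have "2 * (g3 + tu) \<in> I_ns" "2 * (g4 + tv) \<in> I_ns" "2 * (g5 + tw) \<in> I_ns"
    by (simp_all only: is_ideal_add[OF is_ideal_I_ns] is_ideal_mult[OF is_ideal_I_ns] I_ns_gram(1))
  then have "?n \<in> I_ns"
    by (intro n[OF is_ideal_I_ns _ _ _ f(1) kernel_subset_I_ns[OF h]]) (blast intro: is_ideal_numeral_cancel[OF is_ideal_I_ns])+
  moreover have "?n \<in> I_a s" if "s = 1 \<or> s = -1" "f \<in> I_a s" for s
    by (rule n) (use that kernel_subset_I_a[OF h] I_a_prime[of s] in \<open>simp_all add: is_prime_ideal_def I_a_iff sub_a_vanish\<close>)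
  moreover have "?n \<in> I_b s" if "s = 1 \<or> s = -1" "f \<in> I_b s" for s
    by (rule n) (use that kernel_subset_I_b[OF h] I_b_prime[of s] in \<open>simp_all add: is_prime_ideal_def I_b_iff sub_b_vanish\<close>)
  moreover have "?n \<in> I_c s" if "s = 1 \<or> s = -1" "f \<in> I_c s" for s
    by (rule n) (use that kernel_subset_I_c[OF h] I_c_prime[of s] in \<open>simp_all add: is_prime_ideal_def I_c_iff sub_c_vanish\<close>)
  ultimately have "4 * ?n \<in> cof_ideal"
    using f by (intro eight_intersection_cofactors) simp_all
  then have "tproj (4 * (h3*g3 + h4*g4 + h5*g5)) = 0" by (rule syzygy_in_kernel)
  \<comment> \<open>The factor 8 combines the 2 of \<open>I_0_mod_kernel\<close> with the 4 of the
    cofactor computation.\<close>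
  moreover have "8 * f = 4 * (2*f - (h3*g3 + h4*g4 + h5*g5)) + 4 * (h3*g3 + h4*g4 + h5*g5)"
    by (simp add: algebra_simps)
  then have "tproj (8 * f) = 4 * tproj (2*f - (h3*g3 + h4*g4 + h5*g5)) + tproj (4 * (h3*g3 + h4*g4 + h5*g5))"
    by (simp only: rhom_add[OF rhom_tproj] rhom_mult[OF rhom_tproj, of 4 "2*f - (h3*g3 + h4*g4 + h5*g5)"] rhom_numeral[OF rhom_tproj])
  ultimately have "8 * f \<in> {p. tproj p = 0}" using h by simp
  then have "f \<in> {p. tproj p = 0}" by (rule is_ideal_numeral_cancel[OF is_ideal_kernel[OF rhom_tproj]])
  then show "tproj f = 0" by simp
qed

section \<open>Irreducible components\<close>

definition vanishes :: "(tvar \<Rightarrow> complex) \<Rightarrow> tvar mpoly set \<Rightarrow> bool" where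
  "vanishes \<sigma> P \<longleftrightarrow> (\<forall>f\<in>P. ev \<sigma> f = 0)"

lemma vanishes_gen_ideal: "vanishes \<sigma> (gen_ideal S) \<longleftrightarrow> (\<forall>g\<in>S. ev \<sigma> g = 0)"
proof
  assume "\<forall>g\<in>S. ev \<sigma> g = 0"
  then have "gen_ideal S \<subseteq> {f. ev \<sigma> f = 0}"
    by (intro gen_ideal_least[OF is_ideal_kernel[OF rhom_ev]]) auto
  then show "vanishes \<sigma> (gen_ideal S)" by (auto simp: vanishes_def)
qed (use gen_ideal_superset in \<open>auto simp: vanishes_def\<close>)

definition tpoint :: "complex \<Rightarrow> complex \<Rightarrow> complex \<Rightarrow> complex \<Rightarrow> complex \<Rightarrow> complex \<Rightarrow> complex \<Rightarrow> tvar \<Rightarrow> complex" where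
  "tpoint a b c ab ac bc abc t = (case t of Ta \<Rightarrow> a | Tb \<Rightarrow> b | Tc \<Rightarrow> c | Tab \<Rightarrow> ab | Tac \<Rightarrow> ac | Tbc \<Rightarrow> bc | Tabc \<Rightarrow> abc)"

lemma tpoint_simps [simp]:
  "tpoint a b c ab ac bc abc Ta = a" "tpoint a b c ab ac bc abc Tb = b" "tpoint a b c ab ac bc abc Tc = c"
  "tpoint a b c ab ac bc abc Tab = ab" "tpoint a b c ab ac bc abc Tac = ac" "tpoint a b c ab ac bc abc Tbc = bc"
  "tpoint a b c ab ac bc abc Tabc = abc"
  by (simp_all add: tpoint_def)

definition ideal_list :: "tvar mpoly set list" where
  "ideal_list = [I_ns, I_a 1, I_a (-1), I_b 1, I_b (-1), I_c 1, I_c (-1), I_0]"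

text \<open>The characters of the triple \<open>(g, g\<^sup>2, g\<^sup>3)\<close> with \<open>tr g = 3\<close>, of triples with one entry \<open>\<plusminus>1\<close>, and of the
  quaternion triple \<open>(i, j, - k)\<close>.\<close>

definition point_list :: "(tvar \<Rightarrow> complex) list" where
  "point_list = [tpoint 3 7 18 18 47 123 322,
     tpoint 2 3 5 3 5 7 7, tpoint (-2) 3 5 (-3) (-5) 7 (-7),
     tpoint 3 2 5 3 7 5 7, tpoint 3 (-2) 5 (-3) 7 (-5) (-7),
     tpoint 3 5 2 7 3 5 7, tpoint 3 5 (-2) 7 (-3) (-5) (-7),
     tpoint 0 0 0 0 0 0 2]"

text \<open>A diagonal table yields distinctness and incomparability at once: if P were contained in
  Q, the point chosen for Q would lie on the locus of P.\<close>

lemma point_ideal_table: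
  "map (\<lambda>P. map (\<lambda>\<sigma>. vanishes \<sigma> P) point_list) ideal_list = map (\<lambda>i. map (\<lambda>j. i = j) [0..<8]) [0..<8::nat]"
proof -
  have a: "vanishes \<sigma> (I_a s) \<longleftrightarrow> \<sigma> Ta = 2*s \<and> \<sigma> Tab = s * \<sigma> Tb \<and> \<sigma> Tac = s * \<sigma> Tc \<and> \<sigma> Tabc = s * \<sigma> Tbc" for \<sigma> s
    by (simp add: I_a_def vanishes_gen_ideal ev_simps)
  have b: "vanishes \<sigma> (I_b s) \<longleftrightarrow> \<sigma> Tb = 2*s \<and> \<sigma> Tab = s * \<sigma> Ta \<and> \<sigma> Tbc = s * \<sigma> Tc \<and> \<sigma> Tabc = s * \<sigma> Tac" for \<sigma> s
    by (simp add: I_b_def vanishes_gen_ideal ev_simps)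
  have c: "vanishes \<sigma> (I_c s) \<longleftrightarrow> \<sigma> Tc = 2*s \<and> \<sigma> Tac = s * \<sigma> Ta \<and> \<sigma> Tbc = s * \<sigma> Tb \<and> \<sigma> Tabc = s * \<sigma> Tab" for \<sigma> s
    by (simp add: I_c_def vanishes_gen_ideal ev_simps)
  show ?thesis
    by (simp add: point_list_def ideal_list_def a b c upt_rec)
      (simp add: I_ns_def I_0_def vanishes_gen_ideal ev_simps pP_def qQ_def)
qed

lemma eight_ideals_list: "eight_ideals = set ideal_list"
  by (simp add: eight_ideals_def ideal_list_def)

lemma length_lists: "length ideal_list = 8" "length point_list = 8"
  by (simp_all add: ideal_list_def point_list_def)

lemma vanishes_iff_index:
  assumes "i < 8" "j < 8"
  shows "vanishes (point_list ! j) (ideal_list ! i) \<longleftrightarrow> i = j"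
proof -
  have "map (\<lambda>P. map (\<lambda>\<sigma>. vanishes \<sigma> P) point_list) ideal_list ! i ! j = (map (\<lambda>i. map (\<lambda>j. i = j) [0..<8]) [0..<8::nat]) ! i ! j"
    by (simp only: point_ideal_table)
  then show ?thesis using assms by (simp add: length_lists)
qed

lemma eight_ideals_incomparable:
  assumes "P \<in> eight_ideals" "Q \<in> eight_ideals" "P \<subseteq> Q"
  shows "P = Q"
proof -
  obtain i j where ij: "i < 8" "P = ideal_list ! i" "j < 8" "Q = ideal_list ! j"
    using assms(1,2) unfolding eight_ideals_list in_set_conv_nth length_lists by metis
  have "vanishes (point_list ! j) Q" using vanishes_iff_index[of j j] ij by simp
  then have "vanishes (point_list ! j) P" using assms(3) by (auto simp: vanishes_def)
  then show ?thesis using vanishes_iff_index[of i j] ij by simp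
qed

lemma card_eight_ideals: "card eight_ideals = 8"
proof -
  have "distinct ideal_list"
    unfolding distinct_conv_nth length_lists
  proof (intro allI impI)
    fix i j :: nat assume "i < 8" "j < 8" "i \<noteq> j"
    then show "ideal_list ! i \<noteq> ideal_list ! j"
      using vanishes_iff_index[of i j] vanishes_iff_index[of j j] by auto
  qed
  then show ?thesis unfolding eight_ideals_list by (simp add: distinct_card length_lists)
qed

lemma eight_ideals_prime: "P \<in> eight_ideals \<Longrightarrow> is_prime_ideal P"
  unfolding eight_ideals_def using I_ns_prime I_a_prime I_b_prime I_c_prime I_0_prime by auto

lemma I_Bor_Inter: "I_Bor = \<Inter> eight_ideals"
  unfolding I_Bor_def eight_ideals_def by auto

lemma prime_ideal_power:
  assumes "is_prime_ideal P" "p ^ n \<in> P"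
  shows "p \<in> P"
  using assms(2)
proof (induction n)
  case 0
  then show ?case using assms(1) by (simp add: is_prime_ideal_def)
next
  case (Suc n)
  then show ?case using assms(1) by (auto simp: is_prime_ideal_def)
qed

text \<open>Otherwise each P contains an element outside Q, and the product of these lies in the
  intersection but not in the prime Q.\<close>

lemma prime_ideal_Inter:
  assumes "finite A" "is_prime_ideal Q" "\<And>P. P \<in> A \<Longrightarrow> is_ideal P" "\<Inter> A \<subseteq> Q"
  shows "\<exists>P\<in>A. P \<subseteq> Q"
proof (rule ccontr)
  assume "\<not> ?thesis"
  then have "\<forall>P\<in>A. \<exists>x. x \<in> P \<and> x \<notin> Q" by blast
  then obtain x where x: "\<And>P. P \<in> A \<Longrightarrow> x P \<in> P \<and> x P \<notin> Q" by metis
  have "(\<Prod>P\<in>A. x P) \<in> P" if "P \<in> A" for P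
    unfolding prod.remove[OF assms(1) that]
    by (rule is_ideal_mult_right[OF assms(3)[OF that]]) (use x that in blast)
  then have "(\<Prod>P\<in>A. x P) \<in> Q" using assms(4) by blast
  moreover have "(\<Prod>P\<in>B. x P) \<notin> Q" if "B \<subseteq> A" for B
    using finite_subset[OF that assms(1)] that
  proof (induction B)
    case empty
    then show ?case using assms(2) by (simp add: is_prime_ideal_def)
  next
    case (insert P B)
    then show ?case using assms(2) x by (auto simp: is_prime_ideal_def)
  qed
  ultimately show False by blast
qed

lemma minimal_primes_I_Bor: "minimal_primes_over I_Bor = eight_ideals"
proof -
  have contains: "\<exists>P\<in>eight_ideals. P \<subseteq> Q" if "is_prime_ideal Q" "I_Bor \<subseteq> Q" for Q
    using that eight_ideals_prime unfolding I_Bor_Inter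
    by (intro prime_ideal_Inter) (auto simp: eight_ideals_def is_prime_ideal_def)
  have over: "I_Bor \<subseteq> P" if "P \<in> eight_ideals" for P
    using that unfolding I_Bor_Inter by blast
  show ?thesis
  proof (intro set_eqI iffI)
    fix P assume P: "P \<in> minimal_primes_over I_Bor"
    then obtain P' where P': "P' \<in> eight_ideals" "P' \<subseteq> P"
      using contains unfolding minimal_primes_over_def by blast
    then have "\<not> P' \<subset> P"
      using P eight_ideals_prime over unfolding minimal_primes_over_def by blast
    with P' show "P \<in> eight_ideals" by auto
  next
    fix P assume P: "P \<in> eight_ideals"
    have "\<not> (\<exists>Q. is_prime_ideal Q \<and> I_Bor \<subseteq> Q \<and> Q \<subset> P)"
    proof
      assume "\<exists>Q. is_prime_ideal Q \<and> I_Bor \<subseteq> Q \<and> Q \<subset> P"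
      then obtain Q where Q: "is_prime_ideal Q" "I_Bor \<subseteq> Q" "Q \<subset> P" by blast
      obtain P' where "P' \<in> eight_ideals" "P' \<subseteq> Q" using contains[OF Q(1,2)] by blast
      with Q(3) show False using eight_ideals_incomparable[of P' P] P by auto
    qed
    then show "P \<in> minimal_primes_over I_Bor"
      using eight_ideals_prime[OF P] over[OF P] unfolding minimal_primes_over_def by blast
  qed
qed

lemma trace_map_kernel: "msubst trace_map p \<in> J_Bor \<longleftrightarrow> p \<in> I_Bor"
  unfolding tproj_eq_zero_iff[symmetric] tproj_def by (simp add: proj_eq_zero_iff)

lemma B_Bor_reduced:
  assumes "f \<in> B_Bor" "f ^ n \<in> J_Bor"
  shows "f \<in> J_Bor"
proof -
  obtain p where "f - msubst trace_map p \<in> J_Bor" using B_Bor_trace_generated[OF assms(1)] by blast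
  then have f: "proj f = tproj p" by (simp add: tproj_def proj_eq_iff)
  have "tproj (p ^ n) = proj (f ^ n)" by (simp add: f rhom_power[OF rhom_proj] rhom_power[OF rhom_tproj])
  also have "\<dots> = 0" using assms(2) by (simp add: proj_eq_zero_iff)
  finally have "p ^ n \<in> \<Inter> eight_ideals" unfolding tproj_eq_zero_iff I_Bor_Inter .
  then have "p \<in> \<Inter> eight_ideals" using prime_ideal_power eight_ideals_prime by blast
  then have "tproj p = 0" unfolding tproj_eq_zero_iff I_Bor_Inter .
  then show ?thesis using f by (simp add: proj_eq_zero_iff)
qed

theorem mainTheorem17:
  shows
    \<comment> \<open>B(Gamma_Bor) is reduced\<close>
    "(\<forall>f\<in>B_Bor. \<forall>n::nat. f ^ n \<in> J_Bor \<longrightarrow> f \<in> J_Bor)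
     \<comment> \<open>t \<mapsto> trace functions: C[t]/I_Bor \<rightarrow> B(Gamma_Bor) is injective ...\<close>
     \<and> (\<forall>p. msubst trace_map p \<in> J_Bor \<longleftrightarrow> p \<in> I_Bor)
     \<comment> \<open>... and surjective onto the invariants\<close>
     \<and> (\<forall>f\<in>B_Bor. \<exists>p. f - msubst trace_map p \<in> J_Bor)
     \<comment> \<open>the eight ideals are prime and pairwise distinct\<close>
     \<and> (\<forall>P\<in>eight_ideals. is_prime_ideal P)
     \<and> card eight_ideals = 8
     \<comment> \<open>irreducible components of X = minimal primes over I_Bor: exactly these eight\<close>
     \<and> minimal_primes_over I_Bor = eight_ideals
     \<comment> \<open>X_a^\<pm>, X_b^\<pm>, X_c^\<pm> are isomorphic to C^3\<close>
     \<and> (\<forall>I\<in>{I_a 1, I_a (-1), I_b 1, I_b (-1), I_c 1, I_c (-1)}.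
          \<exists>\<sigma> :: tvar \<Rightarrow> gen mpoly. surj (msubst \<sigma>) \<and>
             (\<forall>p. msubst \<sigma> p = 0 \<longleftrightarrow> p \<in> I))"
proof (intro conjI)
  show "\<forall>f\<in>B_Bor. \<forall>n::nat. f ^ n \<in> J_Bor \<longrightarrow> f \<in> J_Bor" using B_Bor_reduced by blast
  show "\<forall>p. msubst trace_map p \<in> J_Bor \<longleftrightarrow> p \<in> I_Bor" using trace_map_kernel by blast
  show "\<forall>f\<in>B_Bor. \<exists>p. f - msubst trace_map p \<in> J_Bor" using B_Bor_trace_generated by blast
  show "\<forall>P\<in>eight_ideals. is_prime_ideal P" using eight_ideals_prime by blast
  show "card eight_ideals = 8" by (rule card_eight_ideals)
  show "minimal_primes_over I_Bor = eight_ideals" by (rule minimal_primes_I_Bor)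
  show "\<forall>I\<in>{I_a 1, I_a (-1), I_b 1, I_b (-1), I_c 1, I_c (-1)}.
          \<exists>\<sigma> :: tvar \<Rightarrow> gen mpoly. surj (msubst \<sigma>) \<and> (\<forall>p. msubst \<sigma> p = 0 \<longleftrightarrow> p \<in> I)"
  proof
    fix I :: "tvar mpoly set"
    assume "I \<in> {I_a 1, I_a (-1), I_b 1, I_b (-1), I_c 1, I_c (-1)}"
    then obtain s where "s = 1 \<or> s = -1" "I = I_a s \<or> I = I_b s \<or> I = I_c s" by blast
    then show "\<exists>\<sigma> :: tvar \<Rightarrow> gen mpoly. surj (msubst \<sigma>) \<and> (\<forall>p. msubst \<sigma> p = 0 \<longleftrightarrow> p \<in> I)"
      by (metis surj_sub_a I_a_iff surj_sub_b I_b_iff surj_sub_c I_c_iff)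
  qed
qed

end
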